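(* Let $m$ and $n$ be natural numbers such that $m$, $m+16n^2$ and $m+25n^2$ are all prime numbers congruent to $11$ modulo $24$. Let $E$ be the elliptic curve over $\mathbb{Q}$ defined by \[ y^2 = x^3-5(m+16n^2)x^2+4(m+16n^2)(m+25n^2)x. \] Then $E(\mathbb{Q}) \cong \mathbb{Z}/2\mathbb{Z} \times \mathbb{Z}^2$. *)

theory Defs
  imports
    Complex_Main
    "HOL-Algebra.Elementary_Groups"
    "HOL-Number_Theory.Cong"
    "HOL-Computational_Algebra.Primes"
begin

datatype 'a ec_point = Infinity | Affine 'a 'a

definition ec_points :: "'a::field_char_0 \<Rightarrow> 'a \<Rightarrow> 'a \<Rightarrow> 'a ec_point set" where
  "ec_points a2 a4 a6 =
     insert Infinity {Affine x y | x y. y^2 = x^3 + a2 * x^2 + a4 * x + a6}"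

text \<open>
  The chord-and-tangent law on \<open>y^2 = x^3 + a2 x^2 + a4 x + a6\<close>. It is meant for points of
  the curve, where \<open>x1 = x2\<close> and \<open>y1 \<noteq> - y2\<close> force the two points to coincide, so that the
  remaining case with \<open>x1 = x2\<close> is the tangent case (with \<open>y1 \<noteq> 0\<close>). The constant \<open>a6\<close> does not
  occur in the formulas.
\<close>

fun ec_add :: "'a::field_char_0 \<Rightarrow> 'a \<Rightarrow> 'a ec_point \<Rightarrow> 'a ec_point \<Rightarrow> 'a ec_point" where
  "ec_add a2 a4 Infinity Q = Q"
| "ec_add a2 a4 P Infinity = P"
| "ec_add a2 a4 (Affine x1 y1) (Affine x2 y2) =
     (if x1 = x2 \<and> y1 = - y2 then Infinity
      else let l = (if x1 = x2 then (3 * x1^2 + 2 * a2 * x1 + a4) / (2 * y1)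
                    else (y2 - y1) / (x2 - x1));
               x3 = l^2 - a2 - x1 - x2
           in Affine x3 (l * (x1 - x3) - y1))"

definition ec_group :: "'a::field_char_0 \<Rightarrow> 'a \<Rightarrow> 'a \<Rightarrow> 'a ec_point monoid" where
  "ec_group a2 a4 a6 =
     \<lparr>carrier = ec_points a2 a4 a6, monoid.mult = ec_add a2 a4, one = Infinity\<rparr>"

text \<open>
  The usual discriminant \<open>- b2^2 b8 - 8 b4^3 - 27 b6^2 + 9 b2 b4 b6\<close> of a Weierstrass equation
  with \<open>a1 = a3 = 0\<close>; the equation defines an elliptic curve iff it does not vanish.
\<close>

definition ec_disc :: "'a::field_char_0 \<Rightarrow> 'a \<Rightarrow> 'a \<Rightarrow> 'a" where
  "ec_disc a2 a4 a6 =
     - ((4 * a2)^2 * (4 * a2 * a6 - a4^2)) - 8 * (2 * a4)^3 - 27 * (4 * a6)^2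
     + 9 * (4 * a2) * (2 * a4) * (4 * a6)"

lemma ec_disc_nonzero:
  fixes m n :: nat
  assumes "m > 0"
  shows "ec_disc (- 5 * of_nat (m + 16 * n^2))
           (4 * of_nat (m + 16 * n^2) * of_nat (m + 25 * n^2)) (0 :: rat) \<noteq> 0"
proof -
  define p q :: rat where "p = of_nat (m + 16 * n^2)" and "q = of_nat (m + 25 * n^2)"
  have "25 * p - 16 * q = 9 * of_nat m"
    by (simp add: p_def q_def)
  moreover have "ec_disc (- 5 * p) (4 * p * q) 0 = 256 * p^3 * q^2 * (25 * p - 16 * q)"
    by (simp add: ec_disc_def power_mult_distrib algebra_simps eval_nat_numeral)
  moreover have "p > 0" "q > 0"
    unfolding p_def q_def of_nat_0_less_iff using assms by simp_all
  ultimately show ?thesis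
    using assms unfolding p_def[symmetric] q_def[symmetric] by simp
qed

end

theory Submission
  imports Defs "HOL-Algebra.FiniteProduct" "HOL-Computational_Algebra.Squarefree"
begin

text \<open>
  Write \<open>E: y^2 = x (x^2 + A x + B)\<close> with \<open>A = -5p\<close>, \<open>B = 4pq\<close>, where \<open>p = m + 16 n^2\<close> and \<open>q = m + 25 n^2\<close>.
  Since \<open>d = A^2 - 4B = 9mp\<close> is not a square, \<open>u = x/y\<close> and \<open>v = (x^2 - B)/(x^2 + A x + B)\<close> identify
  the rational points of \<open>E\<close> with those of the Jacobi quartic \<open>v^2 = 1 - 2A u^2 + d u^4\<close>, on which
  the addition formulas have no exceptional cases; associativity becomes a polynomial identity.

  The isogenous curve \<open>E'\<close> has coefficients \<open>10p\<close>, \<open>9mp\<close>. Congruences modulo \<open>3\<close>, \<open>4\<close> and \<open>8\<close> leave only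
  the classes \<open>1, p, q, pq\<close> on \<open>E\<close> and \<open>1, mp, -m, -p\<close> on \<open>E'\<close>, and these come from the torsion points and
  from points with \<open>x = p\<close> and \<open>x = -m\<close>. Hence \<open>E(\<rat>)/2E(\<rat>)\<close> has order \<open>8\<close>. The naive height of
  \<open>u\<close> gives finite generation, and the absolute value of the \<open>2\<close>-adic valuation of \<open>u\<close> grows by one
  under each doubling, so that \<open>O\<close> and \<open>(0, 0)\<close> are the only torsion points.
\<close>

section \<open>The Jacobi quartic and the group law\<close>

text \<open>That 16, 25 and their difference 9 are squares explains the family. The relation
  \<open>25 * p - 16 * q = 9 * m\<close> turns the two discriminants \<open>A^2 - 4 * B\<close> into
  \<open>9 * m * p\<close> and \<open>64 * p * q\<close>, so only classes built from three primes
  and few small numbers need testing; and \<open>p - m\<close> and \<open>q - p\<close> are squares,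
  which supplies the rational points. The count to 8: the dual isogeny kills the point
  \<open>(0, 0)\<close> of \<open>E'\<close>, whose class is \<open>m * p\<close>, so the four
  classes on \<open>E'\<close> add only a factor 2 to the four on \<open>E\<close>. One factor 2 of
  the 8 is due to \<open>(0, 0)\<close> on \<open>E\<close>, which leaves rank 2. The second
  generator is the image of the point with \<open>x = -m\<close> under the dual isogeny; its class
  on \<open>E\<close> is trivial, so its independence can only be seen on \<open>E'\<close>. That
  neither \<open>B\<close> nor \<open>d\<close> is a square serves twice: it makes the formulas on
  the quartic and for the isogeny free of exceptions, and it leaves each curve with a single
  rational point of order two.\<close>

locale two_torsion_curve =
  fixes A B :: "'a::field_char_0"
  assumes B_nonsquare: "r^2 \<noteq> B" and d_nonsquare: "r^2 \<noteq> A^2 - 4*B"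
begin

definition d where "d = A^2 - 4*B"

definition quartic :: "('a \<times> 'a) set" where
  "quartic = {(u, v). v^2 = 1 - 2*A*u^2 + d*u^4}"

text \<open>The addition law of a Jacobi quartic with neutral element \<open>(0, 1)\<close>. The
  point \<open>(0, -1)\<close> has order two and will be the image of \<open>(0, 0)\<close>.\<close>

fun qadd :: "'a \<times> 'a \<Rightarrow> 'a \<times> 'a \<Rightarrow> 'a \<times> 'a" where
  "qadd (u1, v1) (u2, v2) =
     ((u1*v2 + u2*v1) / (1 - d*u1^2*u2^2),
      ((1 + d*u1^2*u2^2)*(v1*v2 - 2*A*u1*u2) + 2*d*u1*u2*(u1^2 + u2^2)) / (1 - d*u1^2*u2^2)^2)"

fun qneg :: "'a \<times> 'a \<Rightarrow> 'a \<times> 'a" where "qneg (u, v) = (- u, v)"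

lemma B_nonzero: "B \<noteq> 0"
  using B_nonsquare[of 0] by auto

text \<open>A vanishing denominator would make \<open>d\<close> the square of
  \<open>1/(u1*u2)\<close>. It holds for all pairs, on the quartic or not, and justifies every later
  division by such a denominator.\<close>

lemma qadd_denom: "1 - d*u1^2*u2^2 \<noteq> 0"
proof
  assume *: "1 - d*u1^2*u2^2 = 0"
  then have "u1 \<noteq> 0" "u2 \<noteq> 0" by auto
  then have "(1/(u1*u2))^2 = d" using * by (simp add: field_simps)
  then show False using d_nonsquare d_def by metis
qed

text \<open>On the quartic \<open>v^2 = (1 - A*u^2)^2 - 4*B*u^4\<close>, so a zero of
  \<open>v\<close> would make \<open>B\<close> a square. The isogeny divides by \<open>v\<close> in
  these coordinates.\<close>

lemma quartic_v_nonzero: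
  assumes "(u, v) \<in> quartic" shows "v \<noteq> 0"
proof
  assume "v = 0"
  then have *: "1 - 2*A*u^2 + d*u^4 = 0" using assms by (simp add: quartic_def)
  then have "u \<noteq> 0" by auto
  have "(1 - A*u^2)^2 = 4*B*u^4" using * unfolding d_def by algebra
  then have "((1 - A*u^2)/(2*u^2))^2 = B" using \<open>u \<noteq> 0\<close> by (simp add: field_simps)
  then show False using B_nonsquare by blast
qed

lemma qadd_closed:
  assumes "P \<in> quartic" "Q \<in> quartic" shows "qadd P Q \<in> quartic"
proof -
  obtain u1 v1 u2 v2 where P: "P = (u1, v1)" "Q = (u2, v2)" by (metis surj_pair)
  define D where "D = 1 - d*u1^2*u2^2"
  define U where "U = u1*v2 + u2*v1"
  define V where "V = (1 + d*u1^2*u2^2)*(v1*v2 - 2*A*u1*u2) + 2*d*u1*u2*(u1^2 + u2^2)"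
  have D: "D \<noteq> 0" using qadd_denom D_def by simp
  have "v1^2 = 1 - 2*A*u1^2 + d*u1^4" "v2^2 = 1 - 2*A*u2^2 + d*u2^4"
    using assms P by (auto simp: quartic_def)
  then have "V^2 = D^4 - 2*A*U^2*D^2 + d*U^4"
    unfolding D_def U_def V_def by algebra
  then have "(V/D^2)^2 = (D^4 - 2*A*U^2*D^2 + d*U^4)/D^4"
    by (simp add: power_divide)
  also have "\<dots> = 1 - 2*A*(U/D)^2 + d*(U/D)^4"
    using D by (simp add: field_simps eval_nat_numeral)
  finally have "(V/D^2)^2 = 1 - 2*A*(U/D)^2 + d*(U/D)^4" .
  then show ?thesis unfolding P by (simp add: quartic_def D_def U_def V_def)
qed

lemma qadd_commute: "qadd P Q = qadd Q P"
  by (cases P; cases Q) (simp add: algebra_simps)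

lemma qadd_0: "qadd (0, 1) P = P"
  by (cases P) simp

lemma qneg_closed: "P \<in> quartic \<Longrightarrow> qneg P \<in> quartic"
  by (cases P) (simp add: quartic_def)

lemma qadd_qneg:
  assumes "P \<in> quartic" shows "qadd P (qneg P) = (0, 1)"
proof -
  obtain u v where P: "P = (u, v)" by (metis surj_pair)
  have v: "v^2 = 1 - 2*A*u^2 + d*u^4" using assms P by (simp add: quartic_def)
  have D: "1 - d*u^2*u^2 \<noteq> 0" by (rule qadd_denom)
  have "(1 + d*u^2*u^2)*(v*v + 2*A*u*u) - 2*d*u*u*(u^2 + u^2) = (1 - d*u^2*u^2)^2"
    using v by algebra
  then show ?thesis using D by (simp add: P)
qed

text \<open>With denominators cleared this is a polynomial identity modulo the three quartic
  equations. Treating the first coordinate alone keeps it small.\<close>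

lemma fst_qadd_assoc:
  assumes "P \<in> quartic" "Q \<in> quartic" "R \<in> quartic"
  shows "fst (qadd (qadd P Q) R) = fst (qadd P (qadd Q R))"
proof -
  obtain u1 v1 u2 v2 u3 v3 where P: "P = (u1, v1)" "Q = (u2, v2)" "R = (u3, v3)"
    by (metis surj_pair)
  define D where "D = 1 - d*u1^2*u2^2"
  define D' where "D' = 1 - d*u2^2*u3^2"
  define U where "U = u1*v2 + u2*v1"
  define U' where "U' = u2*v3 + u3*v2"
  define V where "V = (1 + d*u1^2*u2^2)*(v1*v2 - 2*A*u1*u2) + 2*d*u1*u2*(u1^2 + u2^2)"
  define V' where "V' = (1 + d*u2^2*u3^2)*(v2*v3 - 2*A*u2*u3) + 2*d*u2*u3*(u2^2 + u3^2)"
  have D: "D \<noteq> 0" "D' \<noteq> 0" using qadd_denom D_def D'_def by auto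
  have E: "1 - d*(U/D)^2*u3^2 \<noteq> 0" "1 - d*u1^2*(U'/D')^2 \<noteq> 0" by (rule qadd_denom)+
  have E': "1 - d*(U/D)^2*u3^2 = (D^2 - d*U^2*u3^2)/D^2"
    "1 - d*u1^2*(U'/D')^2 = (D'^2 - d*U'^2*u1^2)/D'^2"
    using D by (simp_all add: field_simps)
  have E'': "D^2 - d*U^2*u3^2 \<noteq> 0" "D'^2 - d*U'^2*u1^2 \<noteq> 0" using E E' D by auto
  have "v1^2 = 1 - 2*A*u1^2 + d*u1^4" "v2^2 = 1 - 2*A*u2^2 + d*u2^4" "v3^2 = 1 - 2*A*u3^2 + d*u3^4"
    using assms P by (auto simp: quartic_def)
  then have key: "(U*D*v3 + V*u3)*(D'^2 - d*U'^2*u1^2) = (U'*D'*v1 + V'*u1)*(D^2 - d*U^2*u3^2)"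
    unfolding D_def D'_def U_def U'_def V_def V'_def by algebra
  have "fst (qadd (qadd P Q) R) = (U/D*v3 + u3*(V/D^2)) / (1 - d*(U/D)^2*u3^2)"
    unfolding P by (simp add: D_def U_def V_def)
  also have "\<dots> = (U*D*v3 + V*u3)/(D^2 - d*U^2*u3^2)"
    unfolding E' using D E'' by (simp add: field_simps power2_eq_square)
  also have "\<dots> = (U'*D'*v1 + V'*u1)/(D'^2 - d*U'^2*u1^2)"
    using key E'' by (simp add: frac_eq_eq)
  also have "\<dots> = (u1*(V'/D'^2) + U'/D'*v1) / (1 - d*u1^2*(U'/D')^2)"
    unfolding E' using D E'' by (simp add: field_simps power2_eq_square)
  also have "\<dots> = fst (qadd P (qadd Q R))"
    unfolding P by (simp add: D'_def U'_def V'_def)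
  finally show ?thesis .
qed

text \<open>This special case of associativity is the only one in which second coordinates are
  compared by computation; \<open>qadd_assoc\<close> uses it to strip a summand.\<close>

lemma qadd_cancel:
  assumes "P \<in> quartic" "Q \<in> quartic" shows "qadd (qadd P Q) (qneg Q) = P"
proof -
  obtain u1 v1 u2 v2 where P: "P = (u1, v1)" "Q = (u2, v2)" by (metis surj_pair)
  define D where "D = 1 - d*u1^2*u2^2"
  define s where "s = (u1*v2 + u2*v1)/D"
  define t where "t = ((1 + d*u1^2*u2^2)*(v1*v2 - 2*A*u1*u2) + 2*d*u1*u2*(u1^2 + u2^2))/D^2"
  have D: "D \<noteq> 0" using qadd_denom D_def by simp
  have E: "1 - d*s^2*u2^2 \<noteq> 0" by (rule qadd_denom)
  have v: "v1^2 = 1 - 2*A*u1^2 + d*u1^4" "v2^2 = 1 - 2*A*u2^2 + d*u2^4"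
    using assms P by (auto simp: quartic_def)
  have st: "D*s = u1*v2 + u2*v1"
      "D^2*t = (1 + d*u1^2*u2^2)*(v1*v2 - 2*A*u1*u2) + 2*d*u1*u2*(u1^2 + u2^2)"
    using D by (auto simp: s_def t_def)
  \<comment> \<open>The factor \<open>D^4\<close> makes \<open>s\<close> and \<open>t\<close> occur
    only as \<open>D*s\<close> and \<open>D^2*t\<close>, which \<open>st\<close> turns into
    polynomials.\<close>
  have "D^4*(((1 + d*s^2*u2^2)*(t*v2 + 2*A*s*u2) - 2*d*s*u2*(s^2 + u2^2)))
     = (D^2 + d*(D*s)^2*u2^2)*(D^2*t*v2 + 2*A*(D*s)*D*u2) - 2*d*(D*s)*u2*D*((D*s)^2 + D^2*u2^2)"
    by algebra
  also have "\<dots> = v1*(D^2 - d*(D*s)^2*u2^2)^2"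
    unfolding st unfolding D_def using v by algebra
  also have "\<dots> = D^4 * (v1*(1 - d*s^2*u2^2)^2)"
    by algebra
  finally have "(1 + d*s^2*u2^2)*(t*v2 + 2*A*s*u2) - 2*d*s*u2*(s^2 + u2^2) = v1*(1 - d*s^2*u2^2)^2"
    using D by simp
  then have "snd (qadd (qadd P Q) (qneg Q)) = snd P"
    using E unfolding P by (simp add: D_def[symmetric] s_def[symmetric] t_def[symmetric])
  moreover have "fst (qadd (qadd P Q) (qneg Q)) = fst P"
    using fst_qadd_assoc[OF assms qneg_closed[OF assms(2)]] qadd_qneg[OF assms(2)]
    by (metis qadd_0 qadd_commute)
  ultimately show ?thesis by (simp add: prod_eq_iff)
qed

text \<open>Equality of the \<open>u\<close>-coordinates leaves the sign of \<open>v\<close> open; it is fixed by comparing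
  \<open>u\<close>-coordinates again after adding the inverse of \<open>R\<close> to both sides.\<close>

lemma qadd_assoc:
  assumes "P \<in> quartic" "Q \<in> quartic" "R \<in> quartic"
  shows "qadd (qadd P Q) R = qadd P (qadd Q R)"
proof (cases "fst R = 0")
  case True
  then have "R = (0, 1) \<or> R = (0, -1)"
    using assms(3) by (cases R) (auto simp: quartic_def power2_eq_1_iff)
  then show ?thesis by (cases P; cases Q) (auto simp: algebra_simps minus_divide_left)
next
  case False
  define S where "S = qadd (qadd P Q) R"
  define S' where "S' = qadd P (qadd Q R)"
  define W where "W = qneg R"
  note closed = qadd_closed qneg_closed assms
  obtain a where a: "a = fst S" "a = fst S'"
    using fst_qadd_assoc[OF assms] S_def S'_def by auto
  obtain b c where W: "W = (b, c)" by (metis surj_pair)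
  have b: "b \<noteq> 0" using False W W_def by (cases R) auto
  have "qadd S W = qadd P Q"
    unfolding S_def W_def by (simp add: qadd_cancel closed)
  moreover have "fst (qadd S' W) = fst (qadd P (qadd (qadd Q R) W))"
    unfolding S'_def W_def by (rule fst_qadd_assoc) (simp_all add: closed)
  moreover have "qadd (qadd Q R) W = Q"
    unfolding W_def by (simp add: qadd_cancel closed)
  ultimately have "fst (qadd S W) = fst (qadd S' W)" by simp
  moreover have "S = (a, snd S)" "S' = (a, snd S')" using a by (metis prod.collapse)+
  ultimately have "(a*c + b*snd S)/(1 - d*a^2*b^2) = (a*c + b*snd S')/(1 - d*a^2*b^2)"
    unfolding W by (metis fst_conv qadd.simps)
  then have "snd S = snd S'" using b qadd_denom by simp
  then have "S = S'" using a by (metis prod_eqI)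
  then show ?thesis unfolding S_def S'_def .
qed

section \<open>The cubic mapped into the quartic\<close>

abbreviation curve where "curve \<equiv> ec_points A B 0"

lemma affine_in_curve: "Affine x y \<in> curve \<longleftrightarrow> y^2 = x^3 + A*x^2 + B*x"
  by (simp add: ec_points_def)

lemma infinity_in_curve [simp]: "Infinity \<in> curve"
  by (simp add: ec_points_def)

lemma quadratic_nonzero: "x^2 + A*x + B \<noteq> 0"
proof
  assume "x^2 + A*x + B = 0"
  then have "(2*x + A)^2 = A^2 - 4*B" by algebra
  then show False using d_nonsquare by blast
qed

lemma curve_y_zero_iff:
  assumes "Affine x y \<in> curve" shows "y = 0 \<longleftrightarrow> x = 0"
proof -
  have "y^2 = x*(x^2 + A*x + B)"
    using assms by (simp add: affine_in_curve algebra_simps eval_nat_numeral)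
  then show ?thesis using quadratic_nonzero[of x] by auto
qed

text \<open>Chord and tangent in one shape: the line \<open>y = l*x + c\<close> meets the cubic in
  \<open>x1\<close>, \<open>x2\<close>, \<open>x3\<close>, and the last three equations compare
  coefficients in \<open>x^3 + A*x^2 + B*x - (l*x + c)^2 = (x - x1)*(x - x2)*(x - x3)\<close>. Later
  arguments use only these relations and not the case distinction for the slope.\<close>

lemma ec_add_line:
  assumes P: "Affine x1 y1 \<in> curve" and Q: "Affine x2 y2 \<in> curve"
    and nopp: "\<not> (x1 = x2 \<and> y1 = - y2)"
  obtains l c x3 where "ec_add A B (Affine x1 y1) (Affine x2 y2) = Affine x3 (- (l*x3 + c))"
    "y1 = l*x1 + c" "y2 = l*x2 + c" "A = l^2 - x1 - x2 - x3"
    "B = x1*x2 + x1*x3 + x2*x3 + 2*l*c" "c^2 = x1*x2*x3"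
proof -
  have y: "y1^2 = x1^3 + A*x1^2 + B*x1" "y2^2 = x2^3 + A*x2^2 + B*x2"
    using P Q by (simp_all add: affine_in_curve)
  define l where "l = (if x1 = x2 then (3*x1^2 + 2*A*x1 + B)/(2*y1) else (y2 - y1)/(x2 - x1))"
  define x3 where "x3 = l^2 - A - x1 - x2"
  define c where "c = y1 - l*x1"
  have "ec_add A B (Affine x1 y1) (Affine x2 y2) = Affine x3 (l*(x1 - x3) - y1)"
    using nopp by (auto simp: l_def x3_def Let_def)
  then have "ec_add A B (Affine x1 y1) (Affine x2 y2) = Affine x3 (- (l*x3 + c))"
    by (simp add: c_def algebra_simps)
  moreover have y1: "y1 = l*x1 + c" and A: "A = l^2 - x1 - x2 - x3" by (simp_all add: c_def x3_def)
  moreover have "y2 = l*x2 + c \<and> B = x1*x2 + x1*x3 + x2*x3 + 2*l*c \<and> c^2 = x1*x2*x3"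
  proof (cases "x1 = x2")
    case True
    then have "y1^2 = y2^2" using y by simp
    then have y12: "y1 = y2" using nopp True by (auto simp: power2_eq_iff)
    then have "y1 \<noteq> 0" using nopp True by auto
    then have l: "l*(2*y1) = 3*x1^2 + 2*A*x1 + B" using True by (simp add: l_def)
    have B: "B = x1*x1 + x1*x3 + x1*x3 + 2*l*c" using l A y1 True by algebra
    then have "c^2 = x1*x1*x3" using y A y1 True by algebra
    then show ?thesis using B True y12 y1 by auto
  next
    case False
    then have "l*(x2 - x1) = y2 - y1" by (simp add: l_def)
    then have y2: "y2 = l*x2 + c" using y1 by algebra
    have "(x1 - x2)*(B - (x1*x2 + x1*x3 + x2*x3 + 2*l*c)) = 0"
      using y y2 A y1 by algebra
    then have B: "B = x1*x2 + x1*x3 + x2*x3 + 2*l*c" using False by simp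
    then have "c^2 = x1*x2*x3" using y A y1 by algebra
    then show ?thesis using B y2 by auto
  qed
  ultimately show ?thesis using that by blast
qed

lemma ec_add_closed:
  assumes "P \<in> curve" "Q \<in> curve" shows "ec_add A B P Q \<in> curve"
proof (cases "P = Infinity \<or> Q = Infinity")
  case True
  then show ?thesis using assms by (cases P; cases Q) auto
next
  case False
  then obtain x1 y1 x2 y2 where PQ: "P = Affine x1 y1" "Q = Affine x2 y2"
    by (meson ec_point.exhaust)
  show ?thesis
  proof (cases "x1 = x2 \<and> y1 = - y2")
    case True
    then show ?thesis unfolding PQ by simp
  next
    case False
    from ec_add_line[OF assms[unfolded PQ] False] obtain l c x3 where
      *: "ec_add A B P Q = Affine x3 (- (l*x3 + c))"
      "A = l^2 - x1 - x2 - x3" "B = x1*x2 + x1*x3 + x2*x3 + 2*l*c" "c^2 = x1*x2*x3"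
      unfolding PQ by metis
    from *(2-) have "(- (l*x3 + c))^2 = x3^3 + A*x3^2 + B*x3" by algebra
    then show ?thesis unfolding *(1) by (simp add: affine_in_curve)
  qed
qed

text \<open>The denominator \<open>x^2 + A*x + B\<close> of the second coordinate never vanishes.
  The value at \<open>(0, 0)\<close> is the limit there: \<open>x/y\<close> tends to 0 and the
  second fraction to \<open>-B/B\<close>.\<close>

fun to_quartic :: "'a ec_point \<Rightarrow> 'a \<times> 'a" where
  "to_quartic Infinity = (0, 1)"
| "to_quartic (Affine x y) = (if x = 0 then (0, -1) else (x/y, (x^2 - B)/(x^2 + A*x + B)))"

lemma to_quartic_affine:
  assumes "Affine x y \<in> curve" "x \<noteq> 0"
  shows "to_quartic (Affine x y) = (x/y, (x^2 - B)*x/y^2)"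
proof -
  have "y^2 = x*(x^2 + A*x + B)"
    using assms by (simp add: affine_in_curve algebra_simps eval_nat_numeral)
  then show ?thesis using assms(2) by simp
qed

lemma to_quartic_closed:
  assumes "P \<in> curve" shows "to_quartic P \<in> quartic"
proof (cases "\<exists>x y. P = Affine x y \<and> x \<noteq> 0")
  case True
  then obtain x y where P: "P = Affine x y" "x \<noteq> 0" by auto
  then have "y \<noteq> 0" using assms curve_y_zero_iff by blast
  have "y^2 = x^3 + A*x^2 + B*x" using assms P by (simp add: affine_in_curve)
  then have "(x^2 - B)^2*x^2 = y^4 - 2*A*x^2*y^2 + d*x^4" unfolding d_def by algebra
  then have "((x^2 - B)*x/y^2)^2 = (y^4 - 2*A*x^2*y^2 + d*x^4)/y^4"
    by (simp add: power_divide power_mult_distrib)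
  also have "\<dots> = 1 - 2*A*(x/y)^2 + d*(x/y)^4"
    using \<open>y \<noteq> 0\<close> by (simp add: field_simps eval_nat_numeral)
  finally show ?thesis using to_quartic_affine assms P by (simp add: quartic_def)
next
  case False
  then show ?thesis by (cases P) (auto simp: quartic_def)
qed

text \<open>Since \<open>x^2 + A*x + B = y^2/x = x/u^2\<close>, one gets
  \<open>v + 1 = (2*x + A)*u^2\<close>, which can be solved for \<open>x\<close>. This inverse map
  gives injectivity.\<close>

lemma to_quartic_x:
  assumes "Affine x y \<in> curve" "x \<noteq> 0" "to_quartic (Affine x y) = (u, v)"
  shows "u \<noteq> 0" "x = (v + 1 - A*u^2)/(2*u^2)" "y = x/u"
proof -
  have "y \<noteq> 0" using assms curve_y_zero_iff by blast
  then show u: "u \<noteq> 0" "y = x/u" using assms by auto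
  have y: "y^2 = x^3 + A*x^2 + B*x" using assms by (simp add: affine_in_curve)
  have uv: "u*y = x" "v*y^2 = (x^2 - B)*x" using assms to_quartic_affine \<open>y \<noteq> 0\<close> by auto
  have "y^2*(2*u^2*x - (v + 1 - A*u^2)) = 0" using y uv by algebra
  then have "2*u^2*x = v + 1 - A*u^2" using \<open>y \<noteq> 0\<close> by simp
  then show "x = (v + 1 - A*u^2)/(2*u^2)" using u \<open>y \<noteq> 0\<close> by (simp add: field_simps)
qed

lemma inj_to_quartic: "inj_on to_quartic curve"
proof (rule inj_onI)
  fix P Q assume PQ: "P \<in> curve" "Q \<in> curve" "to_quartic P = to_quartic Q"
  obtain u v where uv: "to_quartic P = (u, v)" "to_quartic Q = (u, v)"
    using PQ(3) by (metis surj_pair)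
  have *: "R = Infinity \<and> u = 0 \<and> v = 1 \<or> R = Affine 0 0 \<and> u = 0 \<and> v = -1 \<or>
      (u \<noteq> 0 \<and> R = Affine ((v + 1 - A*u^2)/(2*u^2)) ((v + 1 - A*u^2)/(2*u^2)/u))"
    if "R \<in> curve" "to_quartic R = (u, v)" for R
  proof (cases R)
    case Infinity
    then show ?thesis using that by auto
  next
    case (Affine x y)
    show ?thesis
    proof (cases "x = 0")
      case True
      then show ?thesis using that Affine curve_y_zero_iff[of x y] by auto
    next
      case False
      then show ?thesis using to_quartic_x[of x y u v] that Affine by auto
    qed
  qed
  show "P = Q" using *[OF PQ(1) uv(1)] *[OF PQ(2) uv(2)] by auto
qed

text \<open>Translation by \<open>(0, 0)\<close> is \<open>(u, v)\<close> to \<open>(-u, -v)\<close>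
  on the quartic. It is treated apart because the general computation divides by
  \<open>x1*x2\<close>; here \<open>B = x*x3\<close> yields the new abscissa.\<close>

lemma to_quartic_hom_T:
  assumes "Affine x y \<in> curve" "x \<noteq> 0"
  shows "to_quartic (ec_add A B (Affine 0 0) (Affine x y))
    = qadd (to_quartic (Affine 0 0)) (to_quartic (Affine x y))"
proof -
  have T: "Affine 0 0 \<in> curve" by (simp add: affine_in_curve)
  obtain l c x3 where
    *: "ec_add A B (Affine 0 0) (Affine x y) = Affine x3 (- (l*x3 + c))"
    and **: "0 = l*0 + c" "y = l*x + c" "A = l^2 - 0 - x - x3" "B = 0*x + 0*x3 + x*x3 + 2*l*c"
    using ec_add_line[OF T assms(1)] assms(2) by metis
  then have c: "c = 0" and B: "B = x*x3" and y: "y = l*x" by auto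
  have x3: "x3 \<noteq> 0" using B B_nonzero by auto
  have l: "l \<noteq> 0" using y assms curve_y_zero_iff[of x y] by auto
  have "ec_add A B (Affine 0 0) (Affine x y) \<in> curve" by (intro ec_add_closed T assms)
  then have "to_quartic (Affine x3 (- (l*x3 + c))) = (x3/(- (l*x3 + c)), (x3^2 - B)*x3/(- (l*x3 + c))^2)"
    unfolding * using x3 by (rule to_quartic_affine)
  also have "\<dots> = (- (x/y), - ((x^2 - B)*x/y^2))"
    using x3 l assms(2) unfolding c B y by (simp add: field_simps power2_eq_square)
  finally show ?thesis unfolding * to_quartic_affine[OF assms] by simp
qed

lemma to_quartic_neg: "to_quartic (Affine x (- y)) = qneg (to_quartic (Affine x y))"
  by simp

lemma to_quartic_hom:
  assumes "P \<in> curve" "Q \<in> curve"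
  shows "to_quartic (ec_add A B P Q) = qadd (to_quartic P) (to_quartic Q)"
proof (cases "P = Infinity \<or> Q = Infinity")
  case True
  then show ?thesis using qadd_0 qadd_commute[of _ "(0,1)"] by (cases P; cases Q) auto
next
  case False
  then obtain x1 y1 x2 y2 where PQ: "P = Affine x1 y1" "Q = Affine x2 y2"
    by (meson ec_point.exhaust)
  note on = assms[unfolded PQ]
  have comm: "ec_add A B (Affine x 0) (Affine 0 0) = ec_add A B (Affine 0 0) (Affine x 0)" for x
    by auto
  have opp: "to_quartic (ec_add A B P Q) = qadd (to_quartic P) (to_quartic Q)"
    if "x1 = x2 \<and> y1 = - y2"
  proof -
    have "to_quartic P = qneg (to_quartic Q)"
      using that to_quartic_neg[of x2 y2] unfolding PQ by (simp split: if_splits)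
    then show ?thesis
      using qadd_qneg[OF to_quartic_closed[OF assms(2)]] qadd_commute that unfolding PQ by simp
  qed
  show ?thesis
  proof (cases "x1 = x2 \<and> y1 = - y2")
    case True
    then show ?thesis by (rule opp)
  next
    case nopp: False
    consider "x1 = 0" | "x2 = 0" | "x1 \<noteq> 0" "x2 \<noteq> 0" by blast
    then show ?thesis
    proof cases
      case 1
      then have "y1 = 0" using on curve_y_zero_iff by blast
      moreover have "x2 \<noteq> 0" using 1 calculation nopp on curve_y_zero_iff by force
      ultimately show ?thesis unfolding PQ using 1 on to_quartic_hom_T by blast
    next
      case 2
      then have y2: "y2 = 0" using on curve_y_zero_iff by blast
      moreover have x1: "x1 \<noteq> 0" using 2 calculation nopp on curve_y_zero_iff by force
      moreover have "ec_add A B (Affine x1 y1) (Affine 0 0) = ec_add A B (Affine 0 0) (Affine x1 y1)"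
      proof -
        have y: "y1^2 = x1^3 + A*x1^2 + B*x1" using on by (simp add: affine_in_curve)
        define l where "l = y1/x1"
        have "y1 = l*x1" using x1 l_def by simp
        then show ?thesis using x1 by (simp add: Let_def algebra_simps)
      qed
      ultimately show ?thesis unfolding PQ using 2 on to_quartic_hom_T[of x1 y1] qadd_commute by simp
    next
      case 3
      obtain l c x3 where
        add: "ec_add A B P Q = Affine x3 (- (l*x3 + c))"
        and l: "y1 = l*x1 + c" "y2 = l*x2 + c" "A = l^2 - x1 - x2 - x3"
        "B = x1*x2 + x1*x3 + x2*x3 + 2*l*c" "c^2 = x1*x2*x3"
        using ec_add_line[OF on nopp] unfolding PQ by metis
      have y: "y1 \<noteq> 0" "y2 \<noteq> 0" using on 3 curve_y_zero_iff by auto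
      \<comment> \<open>By \<open>x3 = c^2/(x1*x2)\<close> the sum has \<open>u = -c/w\<close> and
        \<open>v = (c^4 - B*x1^2*x2^2)/(x1*x2*w^2)\<close>. These expressions stay correct for
        \<open>c = 0\<close>, when the sum is \<open>(0, 0)\<close>.\<close>
      define w where "w = l*c + x1*x2"
      have D: "1 - d*(x1/y1)^2*(x2/y2)^2 \<noteq> 0" by (rule qadd_denom)
      define Dn where "Dn = y1^2*y2^2 - d*x1^2*x2^2"
      have Dn: "1 - d*(x1/y1)^2*(x2/y2)^2 = Dn/(y1^2*y2^2)"
        using y by (simp add: Dn_def field_simps)
      have "Dn \<noteq> 0" using D Dn by auto
      \<comment> \<open>Everything is rewritten in \<open>l\<close>, \<open>c\<close>,
        \<open>x1\<close>, \<open>x2\<close>, \<open>x3\<close>, so \<open>c^2 = x1*x2*x3\<close> is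
        the only relation left for the two identities.\<close>
      have ku: "x1*x2*((x2^2 - B)*y1 + (x1^2 - B)*y2)*w = - c*Dn"
        using l(5) unfolding w_def Dn_def d_def unfolding l(1-4) by algebra
      define K where "K = (y1^2*y2^2 + d*x1^2*x2^2)*((x1^2 - B)*(x2^2 - B) - 2*A*y1*y2)
       + 2*d*y1*y2*(x1^2*y2^2 + x2^2*y1^2)"
      have kv: "x1^2*x2^2*K*w^2 = (c^4 - B*x1^2*x2^2)*Dn^2"
        using l(5) unfolding K_def w_def Dn_def d_def unfolding l(1-4) by algebra
      have w: "w \<noteq> 0"
      proof
        assume "w = 0"
        then have "c = 0" using ku \<open>Dn \<noteq> 0\<close> by simp
        then show False using \<open>w = 0\<close> 3 by (simp add: w_def)
      qed
      have "qadd (to_quartic P) (to_quartic Q) = (- c/w, (c^4 - B*x1^2*x2^2)/(x1*x2*w^2))"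
      proof -
        have "x1/y1*((x2^2 - B)*x2/y2^2) + x2/y2*((x1^2 - B)*x1/y1^2)
            = x1*x2*((x2^2 - B)*y1 + (x1^2 - B)*y2)/(y1^2*y2^2)"
          using y by (simp add: field_simps power2_eq_square)
        also have "x1*x2*((x2^2 - B)*y1 + (x1^2 - B)*y2) = - c*Dn/w"
          using ku w by (metis nonzero_eq_divide_eq)
        finally have u: "x1/y1*((x2^2 - B)*x2/y2^2) + x2/y2*((x1^2 - B)*x1/y1^2)
            = (- c*Dn/w)/(y1^2*y2^2)" .
        have "(1 + d*(x1/y1)^2*(x2/y2)^2)*((x1^2 - B)*x1/y1^2*((x2^2 - B)*x2/y2^2) - 2*A*(x1/y1)*(x2/y2))
            + 2*d*(x1/y1)*(x2/y2)*((x1/y1)^2 + (x2/y2)^2)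
            = x1*x2*K/(y1^2*y2^2)^2"
          unfolding K_def using y by (simp add: field_simps eval_nat_numeral)
        also have "x1*x2*K = (c^4 - B*x1^2*x2^2)*Dn^2/(x1*x2*w^2)"
        proof -
          have "x1*x2*K*(x1*x2*w^2) = (c^4 - B*x1^2*x2^2)*Dn^2"
            using kv by (simp add: power2_eq_square ac_simps)
          then show ?thesis using w 3 by (simp add: nonzero_eq_divide_eq)
        qed
        finally have v: "(1 + d*(x1/y1)^2*(x2/y2)^2)*((x1^2 - B)*x1/y1^2*((x2^2 - B)*x2/y2^2) - 2*A*(x1/y1)*(x2/y2))
            + 2*d*(x1/y1)*(x2/y2)*((x1/y1)^2 + (x2/y2)^2)
            = ((c^4 - B*x1^2*x2^2)*Dn^2/(x1*x2*w^2))/(y1^2*y2^2)^2" .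
        show ?thesis
          unfolding PQ to_quartic_affine[OF on(1) 3(1)] to_quartic_affine[OF on(2) 3(2)] qadd.simps u v Dn
          using y \<open>Dn \<noteq> 0\<close> by (simp add: power_divide)
      qed
      also have "\<dots> = to_quartic (ec_add A B P Q)"
      proof (cases "c = 0")
        case True
        then have "x3 = 0" using l 3 by simp
        then have "to_quartic (ec_add A B P Q) = (0, -1)" using add by simp
        moreover have "B = x1*x2" "w = x1*x2" using l True \<open>x3 = 0\<close> w_def by auto
        ultimately show ?thesis using True 3 by (simp add: power2_eq_square)
      next
        case False
        have x3: "x3 = c^2/(x1*x2)" using l(5) 3 by simp
        have "x3 \<noteq> 0" using x3 False 3 by simp
        have y3: "l*x3 + c = c*w/(x1*x2)" unfolding x3 w_def using 3 by (simp add: field_simps power2_eq_square)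
        have "Affine x3 (- (l*x3 + c)) \<in> curve" using ec_add_closed[OF assms] add by simp
        note to_quartic_affine[OF this \<open>x3 \<noteq> 0\<close>]
        then have *: "to_quartic (ec_add A B P Q) = (x3/(- (c*w/(x1*x2))), (x3^2 - B)*x3/(- (c*w/(x1*x2)))^2)"
          unfolding add y3 .
        show ?thesis unfolding * x3 using False 3 w by (simp add: field_simps eval_nat_numeral)
      qed
      finally show ?thesis by simp
    qed
  qed
qed

section \<open>The group structure on the cubic\<close>

fun ec_neg :: "'a ec_point \<Rightarrow> 'a ec_point" where
  "ec_neg Infinity = Infinity"
| "ec_neg (Affine x y) = Affine x (- y)"

lemma ec_neg_closed: "P \<in> curve \<Longrightarrow> ec_neg P \<in> curve"
  by (cases P) (simp_all add: affine_in_curve)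

lemma ec_add_neg: "ec_add A B (ec_neg P) P = Infinity"
  by (cases P) simp_all

lemma ec_comm_group: "comm_group (ec_group A B 0)"
proof (rule comm_groupI)
  fix P Q R
  assume "P \<in> carrier (ec_group A B 0)" "Q \<in> carrier (ec_group A B 0)" "R \<in> carrier (ec_group A B 0)"
  then have PQR: "P \<in> curve" "Q \<in> curve" "R \<in> curve" by (simp_all add: ec_group_def)
  note to_quartic_inject = inj_onD[OF inj_to_quartic]
  have "ec_add A B (ec_add A B P Q) R = ec_add A B P (ec_add A B Q R)"
    by (rule to_quartic_inject) (simp_all add: to_quartic_hom ec_add_closed qadd_assoc to_quartic_closed PQR)
  then show "P \<otimes>\<^bsub>ec_group A B 0\<^esub> Q \<otimes>\<^bsub>ec_group A B 0\<^esub> R =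
      P \<otimes>\<^bsub>ec_group A B 0\<^esub> (Q \<otimes>\<^bsub>ec_group A B 0\<^esub> R)"
    by (simp add: ec_group_def)
  have "ec_add A B P Q = ec_add A B Q P"
    by (rule to_quartic_inject) (simp_all add: to_quartic_hom ec_add_closed qadd_commute PQR)
  then show "P \<otimes>\<^bsub>ec_group A B 0\<^esub> Q = Q \<otimes>\<^bsub>ec_group A B 0\<^esub> P"
    by (simp add: ec_group_def)
qed (auto simp: ec_group_def ec_add_closed intro: ec_neg_closed ec_add_neg)

section \<open>Abscissas modulo squares\<close>

fun descent :: "'a ec_point \<Rightarrow> 'a" where
  "descent Infinity = 1"
| "descent (Affine x y) = (if x = 0 then B else x)"

lemma descent_nonzero: "descent P \<noteq> 0"
  by (cases P) (simp_all add: B_nonzero)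

text \<open>If \<open>c\<close> is nonzero, the product of the three abscissas is
  \<open>c^2\<close>. If \<open>c = 0\<close>, one of them is 0 and \<open>B\<close> is the product
  of the other two; this is why \<open>descent\<close> takes the value \<open>B\<close> at
  \<open>(0, 0)\<close>, and the product is then \<open>B^2\<close>. Hence \<open>descent\<close> is
  a homomorphism modulo squares.\<close>

lemma descent_add:
  assumes "P \<in> curve" "Q \<in> curve"
  obtains r where "r \<noteq> 0" "descent (ec_add A B P Q) * (descent P * descent Q) = r^2"
proof (cases "P = Infinity \<or> Q = Infinity")
  case True
  then have "descent (ec_add A B P Q) * (descent P * descent Q) = (descent (ec_add A B P Q))^2"
    by (cases P; cases Q) (auto simp: power2_eq_square)
  then show ?thesis using that descent_nonzero by blast
next
  case False
  then obtain x1 y1 x2 y2 where PQ: "P = Affine x1 y1" "Q = Affine x2 y2"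
    by (meson ec_point.exhaust)
  note on = assms[unfolded PQ]
  show ?thesis
  proof (cases "x1 = x2 \<and> y1 = - y2")
    case True
    then have "descent (ec_add A B P Q) * (descent P * descent Q) = (descent P)^2"
      unfolding PQ by (simp add: power2_eq_square)
    then show ?thesis using that descent_nonzero by blast
  next
    case nopp: False
    obtain l c x3 where
      add: "ec_add A B P Q = Affine x3 (- (l*x3 + c))"
      and l: "B = x1*x2 + x1*x3 + x2*x3 + 2*l*c" "c^2 = x1*x2*x3"
      using ec_add_line[OF on nopp] unfolding PQ by metis
    show ?thesis
    proof (cases "c = 0")
      case False
      then have "x1 \<noteq> 0" "x2 \<noteq> 0" "x3 \<noteq> 0" using l(2) by auto
      then have "descent (ec_add A B P Q) * (descent P * descent Q) = c^2"
        unfolding add unfolding PQ l(2) by simp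
      then show ?thesis using that False by blast
    next
      case True
      then have B: "B = x1*x2 + x1*x3 + x2*x3" "x1 = 0 \<or> x2 = 0 \<or> x3 = 0" using l by auto
      have "descent (ec_add A B P Q) * (descent P * descent Q)
          = (if x3 = 0 then B else x3) * ((if x1 = 0 then B else x1) * (if x2 = 0 then B else x2))"
        unfolding add unfolding PQ by simp
      also have "\<dots> = B^2"
        using B B_nonzero by (auto simp: power2_eq_square)
      finally have "descent (ec_add A B P Q) * (descent P * descent Q) = B^2" .
      then show ?thesis using that B_nonzero by blast
    qed
  qed
qed

abbreviation T where "T \<equiv> Affine 0 (0::'a)"

lemma T_on [simp]: "T \<in> curve"
  by (simp add: affine_in_curve)

lemma descent_affine: "x \<noteq> 0 \<Longrightarrow> descent (Affine x y) = x"
  by simp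

lemma descent_T: "descent T = B"
  by simp

lemma affine_nonzero:
  assumes "P \<in> curve" "P \<noteq> Infinity" "P \<noteq> T"
  obtains x y where "P = Affine x y" "x \<noteq> 0" "y^2 = x^3 + A * x^2 + B * x"
    "fst (to_quartic P) \<noteq> 0"
proof (cases P)
  case (Affine x y)
  have "y^2 = x^3 + A * x^2 + B * x" using assms(1) unfolding Affine affine_in_curve .
  moreover have "x \<noteq> 0" "y \<noteq> 0" using assms Affine curve_y_zero_iff[of x y] by auto
  ultimately show ?thesis using that Affine by simp
qed (use assms in simp)

end

section \<open>Two-isogenies\<close>

text \<open>The parameter \<open>s\<close> rescales the target. With \<open>s = 1\<close> it is the
  usual isogenous curve; repeating the construction with \<open>s = 2\<close> leads back to the
  original equation and not to its rescaling with coefficients \<open>4*A\<close> and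
  \<open>16*B\<close>. So one locale covers both isogenies.\<close>

locale two_isogeny =
  E: two_torsion_curve A B + E': two_torsion_curve A' B' for A B A' B' :: "'a::field_char_0" +
  fixes s :: 'a
  assumes s_nonzero: "s \<noteq> 0" and A': "A'*s^2 = - 2*A" and B': "B'*s^4 = A^2 - 4*B"
begin

fun isog :: "'a ec_point \<Rightarrow> 'a ec_point" where
  "isog Infinity = Infinity"
| "isog (Affine x y) =
     (if x = 0 then Infinity else Affine (y^2/(s^2*x^2)) (y*(x^2 - B)/(s^3*x^2)))"

fun qisog :: "'a \<times> 'a \<Rightarrow> 'a \<times> 'a" where
  "qisog (u, v) = (s*u/v, (1 - E.d*u^4)/v^2)"

lemma isog_closed:
  assumes "P \<in> E.curve" shows "isog P \<in> E'.curve"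
proof (cases "\<exists>x y. P = Affine x y \<and> x \<noteq> 0")
  case True
  then obtain x y where P: "P = Affine x y" "x \<noteq> 0" by auto
  define X Y where "X = y^2/(s^2*x^2)" and "Y = y*(x^2 - B)/(s^3*x^2)"
  have y: "y^2 = x^3 + A*x^2 + B*x" using assms P by (simp add: E.affine_in_curve)
  have XY: "X*(s^2*x^2) = y^2" "Y*(s^3*x^2) = y*(x^2 - B)"
    using s_nonzero P(2) by (simp_all add: X_def Y_def)
  have "(s^6*x^6)*(X^3 + A'*X^2 + B'*X)
      = (X*(s^2*x^2))^3 + (A'*s^2)*x^2*(X*(s^2*x^2))^2 + (B'*s^4)*x^4*(X*(s^2*x^2))" by algebra
  also have "\<dots> = y^6 - 2*A*x^2*y^4 + (A^2 - 4*B)*x^4*y^2"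
    unfolding XY A' B' by algebra
  also have "\<dots> = x^2*(y*(x^2 - B))^2" using y by algebra
  also have "\<dots> = x^2*(Y*(s^3*x^2))^2" unfolding XY ..
  also have "\<dots> = (s^6*x^6)*Y^2" by algebra
  finally have "Y^2 = X^3 + A'*X^2 + B'*X" using s_nonzero P(2) by simp
  then show ?thesis unfolding P using P(2) by (simp add: E'.affine_in_curve X_def Y_def)
next
  case False
  then show ?thesis by (cases P) auto
qed

lemma to_quartic_isog:
  assumes "P \<in> E.curve" shows "E'.to_quartic (isog P) = qisog (E.to_quartic P)"
proof (cases "\<exists>x y. P = Affine x y \<and> x \<noteq> 0")
  case True
  then obtain x y where P: "P = Affine x y" "x \<noteq> 0" by auto
  note on = assms[unfolded P(1)]
  have y: "y^2 = x^3 + A*x^2 + B*x" using on by (simp add: E.affine_in_curve)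
  have "y \<noteq> 0" using on P E.curve_y_zero_iff by blast
  have "x^2 - B \<noteq> 0" using E.B_nonsquare[of x] by simp
  define X Y where "X = y^2/(s^2*x^2)" and "Y = y*(x^2 - B)/(s^3*x^2)"
  have X: "X \<noteq> 0" using \<open>y \<noteq> 0\<close> P s_nonzero by (simp add: X_def)
  have Q: "isog P = Affine X Y" using P by (simp add: X_def Y_def)
  have "E'.to_quartic (Affine X Y) = (X/Y, (X^2 - B')*X/Y^2)"
    using E'.to_quartic_affine X isog_closed[OF assms] Q by auto
  also have "X/Y = s*(x/y)/((x^2 - B)*x/y^2)"
    using \<open>y \<noteq> 0\<close> P s_nonzero \<open>x^2 - B \<noteq> 0\<close> unfolding X_def Y_def
    by (simp add: divide_simps) (simp add: eval_nat_numeral)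
  also have "(X^2 - B')*X/Y^2 = (1 - E.d*(x/y)^4)/((x^2 - B)*x/y^2)^2"
  proof -
    have XY: "X*(s^2*x^2) = y^2" "Y*(s^3*x^2) = y*(x^2 - B)"
      using s_nonzero P(2) by (simp_all add: X_def Y_def)
    have "s^6*x^6*((X^2 - B')*X) = ((X*(s^2*x^2))^2 - (B'*s^4)*x^4)*(X*(s^2*x^2))"
      by algebra
    also have "\<dots> = (y^4 - E.d*x^4)*y^2"
      unfolding XY B' E.d_def by algebra
    finally have 1: "s^6*x^6*((X^2 - B')*X) = (y^4 - E.d*x^4)*y^2" .
    have "s^6*x^6*Y^2 = (Y*(s^3*x^2))^2*x^2" by algebra
    also have "\<dots> = (y*(x^2 - B))^2*x^2" unfolding XY ..
    finally have 2: "s^6*x^6*Y^2 = y^2*((x^2 - B)*x)^2" by algebra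
    have "(X^2 - B')*X/Y^2 = (s^6*x^6*((X^2 - B')*X))/(s^6*x^6*Y^2)"
      using s_nonzero P(2) by simp
    also have "\<dots> = (y^4 - E.d*x^4)/((x^2 - B)*x)^2"
      unfolding 1 2 using \<open>y \<noteq> 0\<close> by simp
    also have "\<dots> = ((y^4 - E.d*x^4)/y^4)/(((x^2 - B)*x)^2/y^4)"
      using \<open>y \<noteq> 0\<close> by simp
    also have "(y^4 - E.d*x^4)/y^4 = 1 - E.d*(x/y)^4"
      using \<open>y \<noteq> 0\<close> by (simp add: power_divide diff_divide_distrib)
    also have "((x^2 - B)*x)^2/y^4 = ((x^2 - B)*x/y^2)^2"
      by (simp add: power_divide)
    finally show ?thesis .
  qed
  finally show ?thesis using E.to_quartic_affine[OF on P(2)] Q P by simp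
next
  case False
  then show ?thesis by (cases P) auto
qed

text \<open>On the quartics neither addition law has cases. The identities \<open>ku\<close> and
  \<open>kv\<close> express \<open>M/W = U*D/V\<close> and \<open>N/W^2 = (D^4 - d*U^4)/V^2\<close>
  without denominators, where the left sides belong to the sum of the images (up to
  \<open>s\<close>) and the right sides to the image of the sum. They hold modulo the two quartic
  equations, with \<open>16*B\<close> in the place of \<open>E'.d*s^4\<close>.\<close>

lemma qisog_hom:
  assumes "P \<in> E.quartic" "Q \<in> E.quartic"
  shows "qisog (E.qadd P Q) = E'.qadd (qisog P) (qisog Q)"
proof -
  obtain u1 v1 u2 v2 where P: "P = (u1, v1)" "Q = (u2, v2)" by (metis surj_pair)
  define d where "d = A^2 - 4*B"
  have d: "E.d = d" "E'.d*s^4 = 16*B"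
  proof -
    show "E.d = d" by (simp add: E.d_def d_def)
    have "E'.d*s^4 = (A'*s^2)^2 - 4*(B'*s^4)" unfolding E'.d_def by algebra
    also have "\<dots> = 16*B" unfolding A' B' by algebra
    finally show "E'.d*s^4 = 16*B" .
  qed
  define D where "D = 1 - d*u1^2*u2^2"
  define U where "U = u1*v2 + u2*v1"
  define V where "V = (1 + d*u1^2*u2^2)*(v1*v2 - 2*A*u1*u2) + 2*d*u1*u2*(u1^2 + u2^2)"
  have v: "v1^2 = 1 - 2*A*u1^2 + d*u1^4" "v2^2 = 1 - 2*A*u2^2 + d*u2^4"
    using assms P by (auto simp: E.quartic_def d)
  have v0: "v1 \<noteq> 0" "v2 \<noteq> 0" using assms P E.quartic_v_nonzero by auto
  have D: "D \<noteq> 0" using E.qadd_denom d D_def by simp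
  have add: "E.qadd P Q = (U/D, V/D^2)" unfolding P by (simp add: d D_def U_def V_def)
  have "V/D^2 \<noteq> 0" using E.qadd_closed[OF assms] E.quartic_v_nonzero add by metis
  then have V: "V \<noteq> 0" by auto
  define W where "W = v1^2*v2^2 - 16*B*u1^2*u2^2"
  define M where "M = u1*v1*(1 - d*u2^4) + u2*v2*(1 - d*u1^4)"
  define N where "N = (v1^2*v2^2 + 16*B*u1^2*u2^2)*((1 - d*u1^4)*(1 - d*u2^4) + 4*A*u1*u2*v1*v2)
    + 32*B*u1*u2*v1*v2*(u1^2*v2^2 + u2^2*v1^2)"
  have ku: "U*D*W = V*M"
    using v unfolding U_def D_def W_def V_def M_def d_def by algebra
  have kv: "(D^4 - d*U^4)*W^2 = V^2*N"
    using v unfolding U_def D_def W_def V_def N_def d_def by algebra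
  have W1: "1 - E'.d*(s*u1/v1)^2*(s*u2/v2)^2 = W/(v1^2*v2^2)"
  proof -
    have "E'.d*(s*u1/v1)^2*(s*u2/v2)^2 = (E'.d*s^4)*u1^2*u2^2/(v1^2*v2^2)"
      by (simp add: power_divide power_mult_distrib eval_nat_numeral ac_simps)
    then show ?thesis using v0 by (simp add: d W_def diff_divide_distrib)
  qed
  have W: "W \<noteq> 0" using E'.qadd_denom[of "s*u1/v1" "s*u2/v2"] W1 by auto
  have "E'.qadd (qisog P) (qisog Q) = (s*M/W, N/W^2)"
  proof -
    have 1: "s*u1/v1*((1 - d*u2^4)/v2^2) + s*u2/v2*((1 - d*u1^4)/v1^2) = s*M/(v1^2*v2^2)"
      unfolding M_def using v0 by (simp add: field_simps eval_nat_numeral)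
    have e1: "E'.d*(s*u1/v1)^2*(s*u2/v2)^2 = 16*B*u1^2*u2^2/(v1^2*v2^2)"
      unfolding d(2)[symmetric]
      by (simp add: power_divide power_mult_distrib eval_nat_numeral ac_simps)
    have e2: "2*A'*(s*u1/v1)*(s*u2/v2) = - 4*A*u1*u2/(v1*v2)"
    proof -
      have "2*A'*(s*u1/v1)*(s*u2/v2) = 2*(A'*s^2)*u1*u2/(v1*v2)"
        by (simp add: power2_eq_square ac_simps)
      then show ?thesis by (simp add: A')
    qed
    have e3: "2*E'.d*(s*u1/v1)*(s*u2/v2)*((s*u1/v1)^2 + (s*u2/v2)^2)
        = 32*B*u1*u2*v1*v2*(u1^2*v2^2 + u2^2*v1^2)/(v1^2*v2^2)^2"
    proof -
      have "2*E'.d*(s*u1/v1)*(s*u2/v2)*((s*u1/v1)^2 + (s*u2/v2)^2)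
        = 2*(E'.d*s^4)*(u1/v1)*(u2/v2)*((u1/v1)^2 + (u2/v2)^2)"
      proof -
        have "2*e*(s*a)*(s*b)*((s*a)^2 + (s*b)^2) = 2*(e*s^4)*a*b*(a^2 + b^2)" for a b e
          by algebra
        from this[of "E'.d" "u1/v1" "u2/v2"] show ?thesis by simp
      qed
      also have "\<dots> = 32*B*u1*u2*v1*v2*(u1^2*v2^2 + u2^2*v1^2)/(v1^2*v2^2)^2"
        unfolding d using v0 by (simp add: field_simps eval_nat_numeral)
      finally show ?thesis .
    qed
    have 2: "(1 + 16*B*u1^2*u2^2/(v1^2*v2^2))*((1 - d*u1^4)/v1^2*((1 - d*u2^4)/v2^2) - (- 4*A*u1*u2/(v1*v2)))
        + 32*B*u1*u2*v1*v2*(u1^2*v2^2 + u2^2*v1^2)/(v1^2*v2^2)^2 = N/(v1^2*v2^2)^2"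
    proof -
      have p: "1 + 16*B*u1^2*u2^2/(v1^2*v2^2) = (v1^2*v2^2 + 16*B*u1^2*u2^2)/(v1^2*v2^2)"
        using v0 by (simp add: add_divide_distrib)
      have q: "(1 - d*u1^4)/v1^2*((1 - d*u2^4)/v2^2) - (- 4*A*u1*u2/(v1*v2))
          = ((1 - d*u1^4)*(1 - d*u2^4) + 4*A*u1*u2*v1*v2)/(v1^2*v2^2)"
        using v0 by (simp add: add_divide_distrib power2_eq_square)
      show ?thesis unfolding p q N_def
        by (simp only: times_divide_times_eq power2_eq_square[of "v1^2*v2^2"] add_divide_distrib[symmetric])
    qed
    show ?thesis unfolding P qisog.simps E'.qadd.simps d(1) 1 W1 unfolding e2 e3 e1 2
      using v0 W by (simp add: power_divide)
  qed
  also have "s*M/W = s*(U/D)/(V/D^2)"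
  proof -
    have "M/W = U*D/V" using ku W V by (simp add: frac_eq_eq mult.commute)
    then have "s*M/W = s*(U*D/V)" by (metis times_divide_eq_right)
    then show ?thesis using D V by (simp add: power2_eq_square)
  qed
  also have "N/W^2 = (1 - d*(U/D)^4)/(V/D^2)^2"
  proof -
    have "N/W^2 = (D^4 - d*U^4)/V^2" using kv W V by (simp add: frac_eq_eq mult.commute)
    also have "\<dots> = ((D^4 - d*U^4)/D^4)/(V^2/D^4)" using D by simp
    also have "(D^4 - d*U^4)/D^4 = 1 - d*(U/D)^4" using D by (simp add: diff_divide_distrib power_divide)
    finally show ?thesis by (simp add: power_divide)
  qed
  finally show ?thesis unfolding add by (simp add: d)
qed

lemma isog_add:
  assumes "P \<in> E.curve" "Q \<in> E.curve"
  shows "isog (ec_add A B P Q) = ec_add A' B' (isog P) (isog Q)"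
  by (rule inj_onD[OF E'.inj_to_quartic])
    (simp_all add: assms isog_closed E.ec_add_closed E'.ec_add_closed to_quartic_isog
      E.to_quartic_hom E'.to_quartic_hom E.to_quartic_closed qisog_hom)

lemma isog_kernel:
  assumes "P \<in> E.curve" "isog P = Infinity" shows "P = Infinity \<or> P = Affine 0 0"
proof (cases P)
  case (Affine x y)
  then have "x = 0" using assms(2) by (auto split: if_splits)
  then show ?thesis using assms(1) Affine E.curve_y_zero_iff by blast
qed simp

text \<open>A preimage of a point with abscissa \<open>w^2\<close> may be sought with
  \<open>y = s*w*x\<close>, which forces \<open>x^2 + A*x + B = s^2*w^2*x\<close>. The discriminant
  of this quadratic is \<open>s^4*(w^4 + A'*w^2 + B')\<close>, that is, the square of
  \<open>s^2*Y/w\<close>, so a root exists. The choice of root gives the right sign of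
  \<open>Y\<close>.\<close>

lemma isog_image:
  assumes "Q \<in> E'.curve" "E'.descent Q = w^2"
  obtains P where "P \<in> E.curve" "isog P = Q"
proof (cases Q)
  case Infinity
  then show ?thesis using that[of Infinity] by simp
next
  case (Affine X Y)
  have "X \<noteq> 0" using assms(2) E'.B_nonsquare Affine by (auto split: if_splits)
  then have X: "X = w^2" "w \<noteq> 0" using assms(2) Affine by auto
  have Y: "Y^2 = X^3 + A'*X^2 + B'*X" using assms(1) Affine by (simp add: E'.affine_in_curve)
  define t where "t = Y/w"
  have t: "t*w = Y" using X by (simp add: t_def)
  have "w^2*(t^2 - (w^4 + A'*w^2 + B')) = 0" using Y t X by algebra
  then have t2: "t^2 = w^4 + A'*w^2 + B'" using X by simp
  define x where "x = (s^2*w^2 - A + s^2*t)/2"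
  have x: "2*x = s^2*w^2 - A + s^2*t" by (simp add: x_def)
  have "4*(x^2 + A*x + B - s^2*w^2*x) = 0"
    using x t2 A' B' by algebra
  then have eq: "x^2 + A*x + B = s^2*w^2*x" by (simp only: mult_eq_0_iff) simp
  have "x \<noteq> 0" using eq E.B_nonzero by auto
  define y where "y = s*w*x"
  have "y^2 = x^3 + A*x^2 + B*x" using eq unfolding y_def by algebra
  then have on: "Affine x y \<in> E.curve" by (simp add: E.affine_in_curve)
  have "x^2 - B = s^2*t*x" using eq x by algebra
  then have "y*(x^2 - B) = Y*(s^3*x^2)" unfolding y_def using t by algebra
  then have "y*(x^2 - B)/(s^3*x^2) = Y" using \<open>x \<noteq> 0\<close> s_nonzero by simp
  moreover have "y^2/(s^2*x^2) = X"
    using \<open>x \<noteq> 0\<close> s_nonzero X unfolding y_def by (simp add: power_mult_distrib)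
  ultimately have "isog (Affine x y) = Q" using \<open>x \<noteq> 0\<close> Affine by simp
  then show ?thesis using that on by blast
qed

lemma descent_isog:
  assumes "P \<in> E.curve"
  obtains r where "r \<noteq> 0" "E'.descent (isog P) = r^2"
proof (cases "\<exists>x y. P = Affine x y \<and> x \<noteq> 0")
  case True
  then obtain x y where P: "P = Affine x y" "x \<noteq> 0" by auto
  have "y \<noteq> 0" using assms P E.curve_y_zero_iff by blast
  then have "y/(s*x) \<noteq> 0" "E'.descent (isog P) = (y/(s*x))^2"
    using P s_nonzero by (auto simp: power_divide power_mult_distrib)
  then show ?thesis using that by blast
next
  case False
  then have "E'.descent (isog P) = 1^2" by (cases P) auto
  then show ?thesis using that[of 1] by simp
qed

end

text \<open>The coefficient conditions alone give \<open>(s*s')^4 = 16\<close>. The value 2 makes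
  the composite equal to doubling; with \<open>-2\<close> it would be the negative of
  doubling.\<close>

locale dual_isogenies =
  phi: two_isogeny A B A' B' s + psi: two_isogeny A' B' A B s' for A B A' B' s s' :: "'a::field_char_0" +
  assumes ss': "s*s' = 2"
begin

lemma psi_phi:
  assumes "P \<in> phi.E.curve" shows "psi.isog (phi.isog P) = ec_add A B P P"
proof (rule inj_onD[OF phi.E.inj_to_quartic])
  obtain u v where uv: "phi.E.to_quartic P = (u, v)" by (metis surj_pair)
  define d where "d = A^2 - 4*B"
  have d: "phi.E.d = d" "phi.E'.d*s^4 = 16*B"
  proof -
    show "phi.E.d = d" by (simp add: phi.E.d_def d_def)
    have "phi.E'.d*s^4 = (A'*s^2)^2 - 4*(B'*s^4)" unfolding phi.E'.d_def by algebra
    also have "\<dots> = 16*B" unfolding phi.A' phi.B' by algebra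
    finally show "phi.E'.d*s^4 = 16*B" .
  qed
  have "(u, v) \<in> phi.E.quartic" using phi.E.to_quartic_closed assms uv by metis
  then have v: "v^2 = 1 - 2*A*u^2 + d*u^4" "v \<noteq> 0"
    using phi.E.quartic_v_nonzero d by (auto simp: phi.E.quartic_def)
  define D where "D = 1 - d*u^2*u^2"
  have D: "D \<noteq> 0" using phi.E.qadd_denom d D_def by metis
  have D': "1 - d*u^4 = D" by (simp add: D_def eval_nat_numeral)
  have "phi.E.to_quartic (psi.isog (phi.isog P)) = psi.qisog (s*u/v, D/v^2)"
    using assms uv by (simp add: psi.to_quartic_isog phi.isog_closed phi.to_quartic_isog d D')
  also have "\<dots> = (2*u*v/D, (v^4 - 16*B*u^4)/D^2)"
  proof -
    have "s'*(s*u/v)/(D/v^2) = (s*s')*u*v/D" using v(2) D by (simp add: power2_eq_square)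
    then have 1: "s'*(s*u/v)/(D/v^2) = 2*u*v/D" by (simp add: ss')
    have "phi.E'.d*(s*u/v)^4 = (phi.E'.d*s^4)*u^4/v^4"
      by (simp add: power_divide power_mult_distrib)
    then have 2: "1 - phi.E'.d*(s*u/v)^4 = (v^4 - 16*B*u^4)/v^4"
      using v(2) by (simp add: d diff_divide_distrib)
    show ?thesis unfolding psi.qisog.simps 1 2 using v(2) D by (simp add: power_divide)
  qed
  also have "v^4 - 16*B*u^4 = (1 + d*u^2*u^2)*(v*v - 2*A*u*u) + 2*d*u*u*(u^2 + u^2)"
    using v(1) unfolding d_def by algebra
  finally show "phi.E.to_quartic (psi.isog (phi.isog P)) = phi.E.to_quartic (ec_add A B P P)"
    by (simp add: phi.E.to_quartic_hom assms uv d D_def algebra_simps)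
qed (simp_all add: assms psi.isog_closed phi.isog_closed phi.E.ec_add_closed)

end

section \<open>Finitely generated abelian groups with one involution\<close>

locale comm_group_involution = comm_group G for G (structure) +
  fixes T
  assumes T_closed [simp]: "T \<in> carrier G" and T_square: "T \<otimes> T = \<one>" and T_nontrivial: "T \<noteq> \<one>"
begin

definition lin :: "nat set \<Rightarrow> (nat \<Rightarrow> 'a) \<Rightarrow> (nat \<Rightarrow> int) \<Rightarrow> 'a" where
  "lin I g a = finprod G (\<lambda>i. g i [^] a i) I"

text \<open>The power of \<open>T\<close> is kept apart, so that the remaining generators can be
  made free. Arbitrary finite index sets allow a generator to be dropped without
  renumbering.\<close>

definition gens :: "nat set \<Rightarrow> (nat \<Rightarrow> 'a) \<Rightarrow> bool" where
  "gens I g \<longleftrightarrow> finite I \<and> g \<in> I \<rightarrow> carrier G \<and>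
     (\<forall>x\<in>carrier G. \<exists>a (e::int). x = T [^] e \<otimes> lin I g a)"

text \<open>Adjoining \<open>T\<close> to the squares removes the contribution of torsion: for
  \<open>r\<close> independent generators the quotient has exactly \<open>2^r\<close>
  elements.\<close>

definition squares :: "'a set" where
  "squares = {t \<otimes> (h \<otimes> h) | t h. t \<in> {\<one>, T} \<and> h \<in> carrier G}"

lemma T_pow: "T [^] (e::int) = (if even e then \<one> else T)"
proof -
  have T2: "T [^] (2::int) = \<one>" using T_square int_pow_mult[of T 1 1] by simp
  have ev: "T [^] (2*k) = \<one>" for k :: int
    using int_pow_pow[of T 2 k] T2 by simp
  show ?thesis
  proof (cases "even e")
    case True
    then show ?thesis using ev by (auto elim!: evenE)
  next
    case False
    then obtain k where "e = 2*k + 1" by (auto elim!: oddE)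
    then show ?thesis using ev int_pow_mult[of T "2*k" 1] False by simp
  qed
qed

lemma lin_closed [simp]:
  assumes "g \<in> I \<rightarrow> carrier G" shows "lin I g a \<in> carrier G"
  unfolding lin_def using assms by (intro finprod_closed) auto

lemma lin_add:
  assumes "g \<in> I \<rightarrow> carrier G"
  shows "lin I g (\<lambda>i. a i + b i) = lin I g a \<otimes> lin I g b"
proof -
  have "lin I g (\<lambda>i. a i + b i) = finprod G (\<lambda>i. g i [^] a i \<otimes> g i [^] b i) I"
    unfolding lin_def using assms by (intro finprod_cong') (auto simp: int_pow_mult Pi_iff)
  also have "\<dots> = lin I g a \<otimes> lin I g b"
    unfolding lin_def using assms by (intro finprod_multf) auto
  finally show ?thesis .
qed

lemma lin_0: "lin I g (\<lambda>i. 0) = \<one>"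
  unfolding lin_def by (simp add: finprod_one_eqI)

lemma lin_uminus:
  assumes "g \<in> I \<rightarrow> carrier G"
  shows "lin I g (\<lambda>i. - a i) = inv (lin I g a)"
proof -
  have "lin I g (\<lambda>i. - a i) \<otimes> lin I g a = \<one>"
    using lin_add[OF assms, of "\<lambda>i. - a i" a] lin_0 by simp
  then show ?thesis using assms by (metis inv_equality lin_closed)
qed

lemma lin_remove:
  assumes "finite I" "g \<in> I \<rightarrow> carrier G" "j \<in> I"
  shows "lin I g a = g j [^] a j \<otimes> lin (I - {j}) g a"
proof -
  have "lin (insert j (I - {j})) g a = g j [^] a j \<otimes> lin (I - {j}) g a"
    unfolding lin_def using assms by (intro finprod_insert) auto
  then show ?thesis using assms by (simp add: insert_absorb)
qed

lemma lin_cong: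
  assumes "g \<in> I \<rightarrow> carrier G" "\<And>i. i \<in> I \<Longrightarrow> g i = g' i" "\<And>i. i \<in> I \<Longrightarrow> a i = a' i"
  shows "lin I g a = lin I g' a'"
proof -
  have "g' i [^] a' i \<in> carrier G" if "i \<in> I" for i
    using assms that by (metis Pi_mem int_pow_closed)
  then show ?thesis unfolding lin_def using assms by (intro finprod_cong') auto
qed

text \<open>Each copy of the new \<open>g j\<close> carries \<open>s\<close> further copies of
  \<open>g i\<close>, so the change of generators becomes an elementary operation on the coefficient
  vector.\<close>

lemma lin_shift:
  assumes "finite I" "g \<in> I \<rightarrow> carrier G" "i \<in> I" "j \<in> I" "i \<noteq> j"
  shows "lin I (g(j := g j \<otimes> g i [^] (s::int))) c = lin I g (c(i := c i + s * c j))"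
proof -
  define g' where "g' = g(j := g j \<otimes> g i [^] s)"
  define c' where "c' = c(i := c i + s * c j)"
  have g': "g' \<in> I \<rightarrow> carrier G" using assms by (auto simp: g'_def Pi_iff)
  have cl: "g i \<in> carrier G" "g j \<in> carrier G" using assms by auto
  define K where "K = I - {j} - {i}"
  have "lin K g c' = lin K g' c"
    by (rule lin_cong) (use assms(2) in \<open>auto simp: K_def g'_def c'_def Pi_iff\<close>)
  then have eq: "lin K g' c = lin K g c'" ..
  have clK: "lin K g c' \<in> carrier G" using assms by (intro lin_closed) (auto simp: K_def)
  have split: "lin I f b = f j [^] b j \<otimes> (f i [^] b i \<otimes> lin K f b)"
    if "f \<in> I \<rightarrow> carrier G" for f and b :: "_ \<Rightarrow> int"
  proof -
    have "f \<in> I - {j} \<rightarrow> carrier G" using that by auto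
    then show ?thesis
      using lin_remove[of I f j b] lin_remove[of "I - {j}" f i b] that assms by (simp add: K_def)
  qed
  have "lin I g' c = (g j \<otimes> g i [^] s) [^] c j \<otimes> (g i [^] c i \<otimes> lin K g c')"
    using split[OF g'] assms(5) by (simp add: eq) (simp add: g'_def)
  also have "\<dots> = g j [^] c j \<otimes> (g i [^] (c i + s * c j) \<otimes> lin K g c')"
    using cl clK by (simp add: int_pow_distrib int_pow_pow int_pow_mult m_ac)
  also have "\<dots> = lin I g c'"
    using split[OF assms(2), of c'] assms(5) by (simp add: c'_def)
  finally show ?thesis by (simp add: g'_def c'_def)
qed

lemma lin_single:
  assumes "finite I" "g \<in> I \<rightarrow> carrier G" "j \<in> I"
  shows "lin I g (\<lambda>i. if i = j then k else 0) = g j [^] k"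
proof -
  have "lin (I - {j}) g (\<lambda>i. if i = j then k else 0) = lin (I - {j}) g (\<lambda>i. 0)"
    by (rule lin_cong) (use assms in auto)
  moreover have "g j \<in> carrier G" using assms by auto
  ultimately show ?thesis using lin_remove[OF assms] lin_0 by simp
qed

lemma gens_transvection:
  assumes "gens I g" "i \<in> I" "j \<in> I" "i \<noteq> j"
  shows "gens I (g(j := g j \<otimes> g i [^] (s::int)))"
proof -
  have I: "finite I" "g \<in> I \<rightarrow> carrier G" using assms by (auto simp: gens_def)
  have "\<exists>a (e::int). x = T [^] e \<otimes> lin I (g(j := g j \<otimes> g i [^] s)) a" if x: "x \<in> carrier G" for x
  proof -
    obtain a and e :: int where "x = T [^] e \<otimes> lin I g a" using assms(1) x unfolding gens_def by blast
    moreover have "(a(i := a i - s * a j))(i := (a(i := a i - s * a j)) i + s * (a(i := a i - s * a j)) j) = a"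
      using assms(4) by auto
    ultimately have "x = T [^] e \<otimes> lin I (g(j := g j \<otimes> g i [^] s)) (a(i := a i - s * a j))"
      using lin_shift[OF I assms(2-4), of s "a(i := a i - s * a j)"] by simp
    then show ?thesis by blast
  qed
  moreover have "g(j := g j \<otimes> g i [^] s) \<in> I \<rightarrow> carrier G" using I assms by (auto simp: Pi_iff)
  ultimately show ?thesis using I by (auto simp: gens_def)
qed

lemma gens_drop:
  assumes "gens I g" "i \<in> I" "g i = \<one> \<or> g i = T"
  shows "gens (I - {i}) g"
proof -
  have I: "finite I" "g \<in> I \<rightarrow> carrier G" using assms by (auto simp: gens_def)
  obtain t :: int where t: "g i = T [^] t"
    using assms(3) T_pow[of 0] T_pow[of 1] by (metis even_zero odd_one)
  have "\<exists>a (e::int). x = T [^] e \<otimes> lin (I - {i}) g a" if x: "x \<in> carrier G" for x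
  proof -
    obtain a and e :: int where "x = T [^] e \<otimes> lin I g a" using assms(1) x unfolding gens_def by blast
    also have "lin I g a = T [^] (t * a i) \<otimes> lin (I - {i}) g a"
      using lin_remove[OF I assms(2)] by (simp add: t int_pow_pow)
    also have "T [^] e \<otimes> \<dots> = T [^] (e + t * a i) \<otimes> lin (I - {i}) g a"
    proof -
      have "lin (I - {i}) g a \<in> carrier G" using I by (intro lin_closed) auto
      then show ?thesis by (simp add: int_pow_mult m_assoc)
    qed
    finally show ?thesis by blast
  qed
  then show ?thesis using I by (auto simp: gens_def)
qed

text \<open>Euclid's algorithm on the coefficients of a relation, realised by transvections of the generators,
  ends with a multiple of a single generator, which is then torsion and can be dropped.\<close>

lemma gens_reduce:
  assumes torsion: "\<forall>x\<in>carrier G. \<forall>k::int. k \<noteq> 0 \<longrightarrow> x [^] k = \<one> \<longrightarrow> x = \<one> \<or> x = T"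
  assumes "gens I g" "lin I g a = \<one> \<or> lin I g a = T" "i \<in> I" "a i \<noteq> 0"
  shows "\<exists>(I'::nat set) g'. gens I' g' \<and> card I' < card I"
  using assms(2-)
proof (induction "nat (\<Sum>i\<in>I. \<bar>a i\<bar>)" arbitrary: g a i rule: less_induct)
  case less
  have I: "finite I" "g \<in> I \<rightarrow> carrier G" using less.prems by (auto simp: gens_def)
  show ?case
  proof (cases "\<exists>j\<in>I. j \<noteq> i \<and> a j \<noteq> 0")
    case False
    have "lin I g a = lin I g (\<lambda>j. if j = i then a i else 0)"
      by (rule lin_cong) (use I False in auto)
    then have p: "g i [^] a i = \<one> \<or> g i [^] a i = T" using lin_single[OF I less.prems(3)] less.prems(2) by simp
    have gi: "g i \<in> carrier G" using I less.prems(3) by auto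
    \<comment> \<open>The relation may have the value \<open>T\<close>; doubling the exponent covers
      both cases.\<close>
    have "g i [^] (a i + a i) = \<one>" using p T_square by (simp only: int_pow_mult[OF gi]) auto
    then have "g i = \<one> \<or> g i = T" using torsion gi less.prems(4)
      by (metis double_zero)
    then have "gens (I - {i}) g" using gens_drop less.prems by blast
    moreover have "card (I - {i}) < card I" using I less.prems(3) by (meson card_Diff1_less)
    ultimately show ?thesis by blast
  next
    case True
    then obtain k l where kl: "k \<in> I" "l \<in> I" "k \<noteq> l" "a k \<noteq> 0" "a l \<noteq> 0" "\<bar>a l\<bar> \<le> \<bar>a k\<bar>"
      using less.prems by (metis linear)
    \<comment> \<open>With this sign \<open>\<bar>a k - s * a l\<bar> = \<bar>a k\<bar> - \<bar>a
      l\<bar>\<close>, so the sum of absolute values drops while \<open>a l\<close> stays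
      nonzero.\<close>
    define s where "s = sgn (a k) * sgn (a l)"
    define a' where "a' = a(k := a k - s * a l)"
    define g' where "g' = g(l := g l \<otimes> g k [^] s)"
    have "gens I g'" unfolding g'_def using gens_transvection[OF less.prems(1) kl(1-3)] .
    moreover have "lin I g' a' = lin I g a"
    proof -
      have "a'(k := a' k + s * a' l) = a" using kl(3) by (auto simp: a'_def)
      then show ?thesis using lin_shift[OF I kl(1-3), of s a'] by (simp add: g'_def)
    qed
    moreover have "a' l \<noteq> 0" using kl by (simp add: a'_def)
    moreover have "nat (\<Sum>i\<in>I. \<bar>a' i\<bar>) < nat (\<Sum>i\<in>I. \<bar>a i\<bar>)"
    proof -
      have "\<bar>a k - s * a l\<bar> < \<bar>a k\<bar>" using kl(4-6) by (auto simp: s_def sgn_if split: if_splits)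
      moreover have "(\<Sum>i\<in>I. \<bar>a i\<bar>) = \<bar>a k\<bar> + (\<Sum>i\<in>I - {k}. \<bar>a i\<bar>)"
        "(\<Sum>i\<in>I. \<bar>a' i\<bar>) = \<bar>a' k\<bar> + (\<Sum>i\<in>I - {k}. \<bar>a' i\<bar>)"
        using I(1) kl(1) by (simp_all add: sum.remove)
      moreover have "(\<Sum>i\<in>I - {k}. \<bar>a' i\<bar>) = (\<Sum>i\<in>I - {k}. \<bar>a i\<bar>)" by (simp add: a'_def)
      ultimately have "(\<Sum>i\<in>I. \<bar>a' i\<bar>) < (\<Sum>i\<in>I. \<bar>a i\<bar>)" by (simp add: a'_def)
      moreover have "0 \<le> (\<Sum>i\<in>I. \<bar>a' i\<bar>)" by (simp add: sum_nonneg)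
      ultimately show ?thesis by (metis nat_less_eq_zless)
    qed
    ultimately show ?thesis using less.hyps[of a' g' l] less.prems(2) kl(2) by auto
  qed
qed

text \<open>A generating family of least size has no nontrivial relation, since a relation would
  allow a smaller family.\<close>

lemma gens_independent:
  assumes torsion: "\<forall>x\<in>carrier G. \<forall>k::int. k \<noteq> 0 \<longrightarrow> x [^] k = \<one> \<longrightarrow> x = \<one> \<or> x = T"
    and "gens (I0::nat set) g0"
  shows "\<exists>(I::nat set) g. gens I g \<and>
    (\<forall>a. lin I g a = \<one> \<or> lin I g a = T \<longrightarrow> (\<forall>i\<in>I. a i = 0))"
proof -
  let ?P = "\<lambda>n. \<exists>(I::nat set) g. gens I g \<and> card I = n"
  have "?P (LEAST n. ?P n)" by (rule LeastI_ex) (use assms(2) in blast)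
  then obtain I :: "nat set" and g where I: "gens I g" "card I = (LEAST n. ?P n)" by blast
  have "a i = 0" if rel: "lin I g a = \<one> \<or> lin I g a = T" "i \<in> I" for a i
  proof (rule ccontr)
    assume "a i \<noteq> 0"
    then obtain I' :: "nat set" and g' where I': "gens I' g'" "card I' < card I"
      using gens_reduce[OF torsion I(1) rel] by blast
    then have "\<not> ?P (card I')" unfolding I(2) by (intro not_less_Least)
    then show False using I'(1) by blast
  qed
  then have "\<forall>a. lin I g a = \<one> \<or> lin I g a = T \<longrightarrow> (\<forall>i\<in>I. a i = 0)" by blast
  with I(1) show ?thesis by blast
qed

section \<open>Classes modulo squares and the rank\<close>

lemma squaresI: "h \<in> carrier G \<Longrightarrow> t = \<one> \<or> t = T \<Longrightarrow> t \<otimes> (h \<otimes> h) \<in> squares"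
  unfolding squares_def by blast

lemma square_in_squares: "h \<in> carrier G \<Longrightarrow> h \<otimes> h \<in> squares"
  using squaresI[of h \<one>] by simp

lemma squaresE:
  assumes "x \<in> squares"
  obtains t h where "t = \<one> \<or> t = T" "t \<in> carrier G" "h \<in> carrier G" "x = t \<otimes> (h \<otimes> h)"
proof -
  from assms obtain t h where "t \<in> {\<one>, T}" "h \<in> carrier G" "x = t \<otimes> (h \<otimes> h)"
    unfolding squares_def by blast
  then show ?thesis using that[of t h] by auto
qed

lemma squares_subgroup: "subgroup squares G"
proof
  show "squares \<subseteq> carrier G" by (auto elim: squaresE)
  show "\<one> \<in> squares" using square_in_squares[of \<one>] by simp
next
  fix x y assume "x \<in> squares" "y \<in> squares"
  then obtain t h t' h' where x: "t = \<one> \<or> t = T" "t \<in> carrier G" "h \<in> carrier G" "x = t \<otimes> (h \<otimes> h)"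
    and y: "t' = \<one> \<or> t' = T" "t' \<in> carrier G" "h' \<in> carrier G" "y = t' \<otimes> (h' \<otimes> h')"
    by (metis squaresE)
  have "x \<otimes> y = (t \<otimes> t') \<otimes> ((h \<otimes> h') \<otimes> (h \<otimes> h'))"
    unfolding x(4) y(4) using x(2,3) y(2,3) by (simp add: m_ac)
  moreover have "t \<otimes> t' = \<one> \<or> t \<otimes> t' = T" using x(1) y(1) T_square by auto
  ultimately show "x \<otimes> y \<in> squares" using squaresI[of "h \<otimes> h'" "t \<otimes> t'"] x(3) y(3) by simp
next
  fix x assume "x \<in> squares"
  then obtain t h where x: "t = \<one> \<or> t = T" "t \<in> carrier G" "h \<in> carrier G" "x = t \<otimes> (h \<otimes> h)"
    by (metis squaresE)
  have "inv T = T" using T_square by (simp add: inv_equality)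
  then have "inv t = \<one> \<or> inv t = T" using x(1) by auto
  moreover have "inv x = inv t \<otimes> (inv h \<otimes> inv h)" unfolding x(4) using x(2,3) by (simp add: inv_mult)
  ultimately show "inv x \<in> squares" using squaresI[of "inv h" "inv t"] x(3) by simp
qed

text \<open>Modulo \<open>squares\<close> every element is its own inverse, so two elements
  congruent to the inverse of \<open>y\<close> are congruent. Congruence is expressed by products
  lying in \<open>squares\<close>, without forming the quotient group.\<close>

lemma squares_cancel:
  assumes "x \<in> carrier G" "y \<in> carrier G" "z \<in> carrier G" "x \<otimes> y \<in> squares" "z \<otimes> y \<in> squares"
  shows "x \<otimes> z \<in> squares"
proof -
  interpret S: subgroup squares G by (rule squares_subgroup)
  have "y \<otimes> y \<in> squares" using assms(2) by (rule square_in_squares)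
  then have "(x \<otimes> y) \<otimes> (z \<otimes> y) \<otimes> inv (y \<otimes> y) \<in> squares" using assms by simp
  moreover have "(x \<otimes> y) \<otimes> (z \<otimes> y) = (x \<otimes> z) \<otimes> (y \<otimes> y)"
    using assms(1-3) by (simp add: m_ac)
  moreover have "(x \<otimes> z) \<otimes> (y \<otimes> y) \<otimes> inv (y \<otimes> y) = x \<otimes> z"
    using assms(1-3) by (simp add: m_assoc)
  ultimately show ?thesis by simp
qed

text \<open>Two systems of representatives modulo \<open>squares\<close> are compared: the products
  \<open>X J\<close> of subsets of a free family, and the four products \<open>w p\<close> of
  \<open>P1\<close> and \<open>P2\<close>. Each maps injectively into the index set of the other, so
  \<open>2 ^ card I = 4\<close>. The isomorphism is then written down in terms of \<open>T\<close>
  and the two free generators.\<close>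

theorem iso_Z2_Z_Z:
  assumes torsion: "\<forall>x\<in>carrier G. \<forall>k::int. k \<noteq> 0 \<longrightarrow> x [^] k = \<one> \<longrightarrow> x = \<one> \<or> x = T"
    and fg: "gens (I0::nat set) g0"
    and P: "P1 \<in> carrier G" "P2 \<in> carrier G"
    and span: "\<And>x. x \<in> carrier G \<Longrightarrow>
      x \<in> squares \<or> x \<otimes> P1 \<in> squares \<or> x \<otimes> P2 \<in> squares \<or> x \<otimes> (P1 \<otimes> P2) \<in> squares"
    and indep: "P1 \<notin> squares" "P2 \<notin> squares" "P1 \<otimes> P2 \<notin> squares"
  shows "G \<cong> integer_mod_group 2 \<times>\<times> (integer_group \<times>\<times> integer_group)"
proof -
  interpret S: subgroup squares G by (rule squares_subgroup)
  obtain I :: "nat set" and g where gens: "gens I g"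
    and free': "\<forall>a. lin I g a = \<one> \<or> lin I g a = T \<longrightarrow> (\<forall>i\<in>I. a i = 0)"
    using gens_independent[OF torsion fg] by (elim exE conjE) (rule that)
  have free: "a i = 0" if "lin I g a = \<one> \<or> lin I g a = T" "i \<in> I" for a i
    using free' that by blast
  have I: "finite I" "g \<in> I \<rightarrow> carrier G" using gens by (auto simp: gens_def)
  have ex: "\<exists>a (e::int). x = T [^] e \<otimes> lin I g a" if "x \<in> carrier G" for x
    using gens that by (simp add: gens_def)
  note lc = lin_closed[OF I(2)]
  define w where "w = (\<lambda>(b, c). (if b then P1 else \<one>) \<otimes> (if c then P2 else \<one>))"
  have w_closed: "w p \<in> carrier G" for p using P by (cases p) (simp add: w_def)
  define X where "X = (\<lambda>J. lin I g (\<lambda>i. of_bool (i \<in> J)))"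
  have X_closed: "X J \<in> carrier G" for J using lc by (simp add: X_def)
  have X_inj: "J = K" if JK: "X J \<otimes> X K \<in> squares" "J \<subseteq> I" "K \<subseteq> I" for J K
  proof -
    from JK(1) obtain h where h: "h \<in> carrier G"
        "X J \<otimes> X K = h \<otimes> h \<or> X J \<otimes> X K = T \<otimes> (h \<otimes> h)"
      by (elim squaresE) auto
    obtain a and e :: int where "h = T [^] e \<otimes> lin I g a" using ex h(1) by blast
    then have "h \<otimes> h = (T [^] e \<otimes> T [^] e) \<otimes> (lin I g a \<otimes> lin I g a)" using lc by (simp add: m_ac)
    also have "T [^] e \<otimes> T [^] e = \<one>" using T_square by (simp add: T_pow)
    also have "\<one> \<otimes> (lin I g a \<otimes> lin I g a) = lin I g (\<lambda>i. a i + a i)"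
      unfolding lin_add[OF I(2)] using lc by simp
    finally have hh: "h \<otimes> h = lin I g (\<lambda>i. a i + a i)" .
    \<comment> \<open>Freeness makes these exponents vanish, so the two indicators add up to the
      even number \<open>2 * a i\<close> and must agree.\<close>
    define b where "b = (\<lambda>i. of_bool (i \<in> J) + of_bool (i \<in> K) - (a i + a i))"
    have "lin I g b = X J \<otimes> X K \<otimes> inv (h \<otimes> h)"
      unfolding hh X_def b_def diff_conv_add_uminus lin_add[OF I(2)] lin_uminus[OF I(2)] ..
    moreover have "T \<otimes> (h \<otimes> h) \<otimes> inv (h \<otimes> h) = T"
      using h(1) by (metis T_closed inv_solve_right m_closed)
    ultimately have "lin I g b = \<one> \<or> lin I g b = T" using h by auto
    then have b0: "b i = 0" if "i \<in> I" for i using free that by blast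
    have "i \<in> J \<longleftrightarrow> i \<in> K" if "i \<in> I" for i
    proof -
      have "of_bool (i \<in> J) + of_bool (i \<in> K) = 2 * a i" using b0[OF that] by (simp add: b_def)
      then have "even (of_bool (i \<in> J) + of_bool (i \<in> K) :: int)" by simp
      then show ?thesis by (cases "i \<in> J"; cases "i \<in> K") simp_all
    qed
    then show ?thesis using that by blast
  qed
  have w_inj: "p = q" if "w p \<otimes> w q \<in> squares" for p q
  proof -
    have cancel: "x \<in> squares" if "y \<in> squares" "z \<in> carrier G" "y = x \<otimes> (z \<otimes> z)" "x \<in> carrier G" for x y z
      using squares_cancel[of x "z \<otimes> z" \<one>] that square_in_squares by simp
    obtain b c b' c' where p: "p = (b, c)" "q = (b', c')" by (metis surj_pair)
    have PP: "P1 \<otimes> P2 \<in> carrier G" using P by simp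
    show ?thesis
    proof (rule ccontr)
      assume "p \<noteq> q"
      then consider "b \<noteq> b'" "c = c'" | "b = b'" "c \<noteq> c'" | "b \<noteq> b'" "c \<noteq> c'" using p by auto
      then show False
      proof cases
        case 1
        then have "w p \<otimes> w q = P1 \<otimes> (w (False, c) \<otimes> w (False, c))"
          unfolding w_def p using P by (cases b; cases b'; cases c) (simp_all add: m_ac)
        then show False using cancel[OF that w_closed _ P(1)] indep(1) by blast
      next
        case 2
        then have "w p \<otimes> w q = P2 \<otimes> (w (b, False) \<otimes> w (b, False))"
          unfolding w_def p using P by (cases b; cases c; cases c') (simp_all add: m_ac)
        then show False using cancel[OF that w_closed _ P(2)] indep(2) by blast
      next
        case 3
        then have "w p \<otimes> w q = P1 \<otimes> P2 \<otimes> (\<one> \<otimes> \<one>)"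
          unfolding w_def p using P by (cases b; cases b'; cases c; cases c') (simp_all add: m_ac)
        then show False using cancel[OF that one_closed _ PP] indep(3) by blast
      qed
    qed
  qed
  have "card (Pow I) \<le> card (UNIV :: (bool \<times> bool) set)"
  proof -
    have "\<exists>p. x \<otimes> w p \<in> squares" if "x \<in> carrier G" for x
      using span[OF that] that P unfolding w_def split_paired_Ex by (auto simp: ex_bool_eq)
    then obtain f where f: "\<And>x. x \<in> carrier G \<Longrightarrow> x \<otimes> w (f x) \<in> squares" by metis
    have "inj_on (\<lambda>J. f (X J)) (Pow I)"
    proof (rule inj_onI)
      fix J K assume *: "J \<in> Pow I" "K \<in> Pow I" "f (X J) = f (X K)"
      have "X J \<otimes> X K \<in> squares"
        by (rule squares_cancel[OF X_closed w_closed X_closed f[OF X_closed]])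
          (use f[OF X_closed, of K] *(3) in simp)
      then show "J = K" using X_inj *(1,2) by blast
    qed
    then show ?thesis by (intro card_inj_on_le) auto
  qed
  moreover have "card (UNIV :: (bool \<times> bool) set) \<le> card (Pow I)"
  proof -
    have "\<exists>J\<subseteq>I. x \<otimes> X J \<in> squares" if x: "x \<in> carrier G" for x
    proof -
      obtain a and e :: int where a: "x = T [^] e \<otimes> lin I g a" using ex x by blast
      define J where "J = {i\<in>I. odd (a i)}"
      \<comment> \<open>Multiplying by \<open>X J\<close> makes all exponents even, so they can be
        halved.\<close>
      define b where "b = (\<lambda>i. (a i + of_bool (i \<in> J)) div 2)"
      have "x \<otimes> X J = T [^] e \<otimes> lin I g (\<lambda>i. a i + of_bool (i \<in> J))"
        unfolding a X_def lin_add[OF I(2)] using lc by (simp add: m_assoc)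
      also have "lin I g (\<lambda>i. a i + of_bool (i \<in> J)) = lin I g (\<lambda>i. b i + b i)"
        by (rule lin_cong) (use I in \<open>auto simp: b_def J_def\<close>)
      also have "\<dots> = lin I g b \<otimes> lin I g b" by (rule lin_add[OF I(2)])
      finally have "x \<otimes> X J \<in> squares" using squaresI[OF lc, of "T [^] e" b] by (simp add: T_pow)
      moreover have "J \<subseteq> I" by (auto simp: J_def)
      ultimately show ?thesis by blast
    qed
    then obtain f where f: "\<And>x. x \<in> carrier G \<Longrightarrow> f x \<subseteq> I \<and> x \<otimes> X (f x) \<in> squares" by metis
    have "inj (\<lambda>p. f (w p))"
    proof (rule injI)
      fix p q assume *: "f (w p) = f (w q)"
      have "w p \<otimes> X (f (w p)) \<in> squares" "w q \<otimes> X (f (w p)) \<in> squares"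
        using f[OF w_closed] * by metis+
      then have "w p \<otimes> w q \<in> squares" by (rule squares_cancel[OF w_closed X_closed w_closed])
      then show "p = q" by (rule w_inj)
    qed
    then show ?thesis using I(1) f w_closed by (intro card_inj_on_le[of "\<lambda>p. f (w p)"]) auto
  qed
  ultimately have "2 ^ card I = (2::nat) ^ 2" using I(1) by (simp add: card_Pow card_UNIV_bool flip: UNIV_Times_UNIV)
  then have "card I = 2" by (simp only: power_inject_exp)
  then obtain i j where ij: "I = {i, j}" "i \<noteq> j" by (meson card_2_iff)
  have cl: "g i \<in> carrier G" "g j \<in> carrier G" using I ij by auto
  have lin: "lin I g a = g i [^] a i \<otimes> g j [^] a j" for a
    unfolding lin_def ij(1) using cl ij(2) by (subst finprod_insert) auto
  let ?H = "integer_mod_group 2 \<times>\<times> (integer_group \<times>\<times> integer_group)"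
  define F where "F = (\<lambda>(e::int, a::int, b::int). T [^] e \<otimes> (g i [^] a \<otimes> g j [^] b))"
  have "F \<in> hom ?H G"
  proof (rule homI)
    fix x assume "x \<in> carrier ?H"
    show "F x \<in> carrier G" using cl by (auto simp: F_def split: prod.splits)
  next
    fix x y assume "x \<in> carrier ?H" "y \<in> carrier ?H"
    obtain e a b e' a' b' where xy: "x = (e, a, b)" "y = (e', a', b')" by (metis surj_pair)
    have "T [^] ((e + e') mod 2) = T [^] e \<otimes> T [^] e'"
      using T_square by (simp add: T_pow)
    then have "F (x \<otimes>\<^bsub>?H\<^esub> y) = (T [^] e \<otimes> T [^] e') \<otimes> (g i [^] (a + a') \<otimes> g j [^] (b + b'))"
      unfolding xy by (simp add: F_def integer_group_def)
    also have "\<dots> = F x \<otimes> F y"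
      unfolding xy F_def using cl by (simp add: int_pow_mult m_ac)
    finally show "F (x \<otimes>\<^bsub>?H\<^esub> y) = F x \<otimes> F y" .
  qed
  moreover have "bij_betw F (carrier ?H) (carrier G)"
    unfolding bij_betw_def
  proof (intro conjI inj_onI equalityI subsetI)
    fix x y assume xy: "x \<in> carrier ?H" "y \<in> carrier ?H" "F x = F y"
    obtain e a b e' a' b' where p: "x = (e, a, b)" "y = (e', a', b')" by (metis surj_pair)
    define c where "c = (\<lambda>k. if k = i then a else b)"
    define c' where "c' = (\<lambda>k. if k = i then a' else b')"
    have eq: "T [^] e \<otimes> lin I g c = T [^] e' \<otimes> lin I g c'"
      using xy(3) ij(2) unfolding p F_def lin c_def c'_def by auto
    have "lin I g (\<lambda>k. c k - c' k) = lin I g c \<otimes> inv (lin I g c')"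
      unfolding diff_conv_add_uminus lin_add[OF I(2)] lin_uminus[OF I(2)] ..
    also have "lin I g c = T [^] (e' - e) \<otimes> lin I g c'"
    proof -
      have "lin I g c = T [^] (- e) \<otimes> (T [^] e \<otimes> lin I g c)"
        using lc by (simp add: int_pow_neg flip: m_assoc)
      also have "\<dots> = T [^] (- e) \<otimes> T [^] e' \<otimes> lin I g c'" unfolding eq using lc by (simp add: m_assoc)
      also have "T [^] (- e) \<otimes> T [^] e' = T [^] (e' - e)" by (simp flip: int_pow_mult)
      finally show ?thesis .
    qed
    also have "T [^] (e' - e) \<otimes> lin I g c' \<otimes> inv (lin I g c') = T [^] (e' - e)"
      using lc by (simp add: m_assoc)
    finally have d: "lin I g (\<lambda>k. c k - c' k) = T [^] (e' - e)" .
    then have "lin I g (\<lambda>k. c k - c' k) = \<one> \<or> lin I g (\<lambda>k. c k - c' k) = T" by (simp add: T_pow)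
    then have z: "c k - c' k = 0" if "k \<in> I" for k using free[of "\<lambda>k. c k - c' k" k] that by blast
    then have "lin I g (\<lambda>k. c k - c' k) = lin I g (\<lambda>k. 0)" by (intro lin_cong) (use I in auto)
    then have "T [^] (e' - e) = \<one>" using d lin_0 by simp
    then have "even (e' - e)" using T_nontrivial by (simp add: T_pow split: if_splits)
    moreover have "e \<in> {0..<2}" "e' \<in> {0..<2}" using xy p by (simp_all add: carrier_integer_mod_group)
    ultimately have "e = e'" by (simp only: atLeastLessThan_iff) presburger
    moreover have "a = a'" "b = b'" using z[of i] z[of j] ij by (auto simp: c_def c'_def)
    ultimately show "x = y" by (simp add: p)
  next
    fix y assume "y \<in> F ` carrier ?H"
    then show "y \<in> carrier G" using cl by (auto simp: F_def)
  next
    fix y assume "y \<in> carrier G"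
    then obtain a and e :: int where "y = T [^] e \<otimes> lin I g a" using ex by blast
    moreover have "T [^] (e mod 2) = T [^] e" by (simp add: T_pow)
    ultimately have "y = F (e mod 2, a i, a j)" by (simp add: F_def lin)
    moreover have "(e mod 2, a i, a j) \<in> carrier ?H" by (simp add: carrier_integer_mod_group)
    ultimately show "y \<in> F ` carrier ?H" by blast
  qed
  ultimately have "F \<in> iso ?H G" by (simp add: iso_def)
  moreover have "group ?H" by (intro DirProd_group) auto
  ultimately show ?thesis using group.iso_sym is_isoI by blast
qed

text \<open>Infinite descent with a multiplicative height. Beyond \<open>C\<close> the bound gives
  \<open>(H h)^2 \<le> C * H x < (H x)^2\<close>, so \<open>h\<close> is strictly smaller than
  \<open>x\<close>; the descent ends in the finite set of height at most \<open>C\<close>. The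
  generators are this set together with \<open>R\<close>.\<close>

theorem gens_by_descent:
  fixes H :: "'a \<Rightarrow> nat"
  assumes "finite R" "R \<subseteq> carrier G" "finite {x \<in> carrier G. H x \<le> C}"
    and descent: "\<And>x. x \<in> carrier G \<Longrightarrow> \<exists>r\<in>R. \<exists>h\<in>carrier G. x = r \<otimes> (h \<otimes> h) \<and> (H h)^2 \<le> C * H x"
  shows "\<exists>(I::nat set) g. gens I g"
proof -
  define S where "S = R \<union> {x \<in> carrier G. H x \<le> C}"
  have "finite S" using assms by (simp add: S_def)
  then obtain g and n :: nat where g: "S = g ` {i. i < n}" by (metis finite_imp_nat_seg_image_inj_on)
  define I where "I = {i. i < n}"
  have I: "finite I" "g \<in> I \<rightarrow> carrier G" using g assms(2) by (auto simp: I_def S_def)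
  define X where "X = {T [^] (e::int) \<otimes> lin I g a | e a. True}"
  have X_closed: "X \<subseteq> carrier G" using I by (auto simp: X_def)
  have X_mult: "x \<otimes> y \<in> X" if "x \<in> X" "y \<in> X" for x y
  proof -
    obtain e e' :: int and a a' where xy: "x = T [^] e \<otimes> lin I g a" "y = T [^] e' \<otimes> lin I g a'"
      using \<open>x \<in> X\<close> \<open>y \<in> X\<close> by (auto simp: X_def)
    have "x \<otimes> y = T [^] (e + e') \<otimes> lin I g (\<lambda>i. a i + a' i)"
      unfolding xy lin_add[OF I(2)] using lin_closed[OF I(2)] by (simp add: int_pow_mult m_ac)
    then show ?thesis by (auto simp: X_def)
  qed
  have S_X: "S \<subseteq> X"
  proof
    fix x assume "x \<in> S"
    then obtain i where i: "i \<in> I" "x = g i" using g by (auto simp: I_def)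
    then have "g i \<in> carrier G" using I by auto
    then have "x = T [^] (0::int) \<otimes> lin I g (\<lambda>k. if k = i then 1 else 0)"
      using lin_single[OF I i(1), of 1] i(2) by simp
    then show "x \<in> X" unfolding X_def by blast
  qed
  have "x \<in> X" if "x \<in> carrier G" for x
    using that
  proof (induction "H x" arbitrary: x rule: less_induct)
    case less
    show ?case
    proof (cases "H x \<le> C")
      case True
      then show ?thesis using less.prems S_X by (auto simp: S_def)
    next
      case False
      obtain r h where rh: "r \<in> R" "h \<in> carrier G" "x = r \<otimes> (h \<otimes> h)" "(H h)^2 \<le> C * H x"
        using descent[OF less.prems] by blast
      have "(H h)^2 < (H x)^2"
        using rh(4) False by (metis le_less_trans mult_less_mono1 not_le not_less_zero power2_eq_square gr0I)
      then have "H h < H x" by (rule power_less_imp_less_base) simp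
      then have "h \<in> X" using less.hyps rh by blast
      moreover have "r \<in> X" using rh(1) S_X by (auto simp: S_def)
      ultimately show ?thesis using rh(3) X_mult by simp
    qed
  qed
  then have "\<forall>x\<in>carrier G. \<exists>a (e::int). x = T [^] e \<otimes> lin I g a" unfolding X_def by blast
  then have "gens I g" unfolding gens_def using I by blast
  then show ?thesis by blast
qed

end

section \<open>Square classes of abscissas\<close>

lemma rat_square_int:
  fixes r :: rat
  assumes "r^2 = of_int n" shows "\<exists>k. r = of_int k"
proof -
  obtain a b where ab: "quotient_of r = (a, b)" by (metis surj_pair)
  then have r: "r = of_int a / of_int b" "b > 0" "coprime a b"
    using quotient_of_div quotient_of_denom_pos quotient_of_coprime by auto
  then have "of_int (a^2) = (of_int (n * b^2) :: rat)"
    using assms by (simp add: power_divide divide_eq_eq)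
  then have "a^2 = n * b^2" by (simp only: of_int_eq_iff)
  then have "b dvd a^2" by simp
  moreover have "coprime b (a^2)" using r by (simp add: coprime_commute)
  ultimately have "b dvd 1" by (meson coprime_common_divisor dvd_refl)
  then have "b = 1" using r by simp
  then show ?thesis using r by auto
qed

lemma squarefree_dvd_square:
  fixes s k :: int
  assumes "squarefree s" "s dvd k^2" shows "s dvd k"
proof -
  define g where "g = gcd s k"
  have "s \<noteq> 0" using assms(1) by auto
  then have g: "g \<noteq> 0" by (simp add: g_def)
  obtain s' k' where sk: "s = g * s'" "k = g * k'" "coprime s' k'"
    using gcd_coprime_exists[of s k] g g_def by (metis mult.commute)
  then have "g * s' dvd g * (g * k'^2)" using assms(2) by (simp add: power2_eq_square mult_ac)
  then have "s' dvd g * k'^2" using g by simp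
  moreover have "coprime s' (k'^2)" using sk by simp
  ultimately have "s' dvd g" by (simp add: coprime_dvd_mult_left_iff)
  then have "s'^2 dvd s" using sk by (simp add: power2_eq_square)
  then have "s' dvd 1" using assms(1) squarefreeD by blast
  then have "s' dvd k'" by (rule unit_imp_dvd)
  then have "g * s' dvd g * k'" by simp
  then show ?thesis using sk(1,2) by simp
qed

text \<open>The quartic \<open>k^2 = s e^4 + A e^2 f^2 + (B/s) f^4\<close> is the classical homogeneous space
  attached to the square class \<open>s\<close>.\<close>

lemma descent_quartic:
  fixes x y :: rat and A B :: int
  assumes "x \<noteq> 0" "y^2 = x^3 + of_int A * x^2 + of_int B * x"
  obtains s t e f k :: int where "squarefree s" "s * t = B" "coprime e f" "e \<noteq> 0" "f \<noteq> 0"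
    "x = of_int s * (of_int e / of_int f)^2" "k^2 = s * e^4 + A * e^2 * f^2 + t * f^4"
proof -
  obtain X Z where XZ: "quotient_of x = (X, Z)" by (metis surj_pair)
  then have xq: "x = of_int X / of_int Z" "Z > 0"
    using quotient_of_div quotient_of_denom_pos by auto
  \<comment> \<open>A fraction has the same square class as numerator times denominator, so the
    squarefree part of \<open>X * Z\<close> represents the class of \<open>x\<close>.\<close>
  define s where "s = squarefree_part (X * Z)"
  define c where "c = square_part (X * Z)"
  have sf: "squarefree s" by (simp add: s_def)
  have s0: "s \<noteq> 0" using sf by auto
  have sc: "X * Z = s * c^2" unfolding s_def c_def by (rule squarefree_decompose)
  define w :: rat where "w = of_int c / of_int Z"
  have "x = of_int (X * Z) / of_int Z^2" using xq by (simp add: power2_eq_square)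
  also have "\<dots> = of_int s * w^2" unfolding sc w_def by (simp add: power_divide)
  finally have xw: "x = of_int s * w^2" .
  then have w0: "w \<noteq> 0" using assms(1) by auto
  obtain e f where ef: "quotient_of w = (e, f)" by (metis surj_pair)
  then have w: "w = of_int e / of_int f" "f > 0" "coprime e f"
    using quotient_of_div quotient_of_denom_pos quotient_of_coprime by auto
  have we: "w * of_int f = of_int e" using w by simp
  define R where "R = s^2 * e^4 + A * s * e^2 * f^2 + B * f^4"
  \<comment> \<open>Dividing the curve equation by \<open>w^2\<close> and multiplying by
    \<open>f^4\<close> gives \<open>K^2 = s * R\<close> with integral right side, hence
    \<open>K\<close> is an integer.\<close>
  define K where "K = y * of_int f^2 / w"
  have "K * w = y * of_int f^2" using w0 by (simp add: K_def)
  then have "(K^2 - of_int s * ((of_int s)^2 * (w * of_int f)^4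
      + of_int A * of_int s * (w * of_int f)^2 * (of_int f)^2 + of_int B * (of_int f)^4)) * w^2 = 0"
    using assms(2) xw by algebra
  then have "K^2 = of_int (s * R)" using w0 unfolding we R_def by simp
  then obtain k' where "K = of_int k'" using rat_square_int by blast
  with \<open>K^2 = of_int (s * R)\<close> have k': "k'^2 = s * R" by (metis of_int_eq_iff of_int_power)
  then have "s dvd k'" using squarefree_dvd_square[OF sf] by simp
  then obtain k where k: "k' = s * k" by auto
  have "s * (s * k^2) = s * R" using k' unfolding k by (simp add: power2_eq_square mult_ac)
  then have sk: "s * k^2 = s^2 * e^4 + A * s * e^2 * f^2 + B * f^4"
    using s0 by (simp add: R_def)
  \<comment> \<open>A prime \<open>r\<close> dividing both divides \<open>s\<close> only once. Then
    \<open>sk\<close> forces \<open>r\<close> to divide \<open>k\<close> and next \<open>e\<close>,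
    against the coprimality of \<open>e\<close> and \<open>f\<close>. Without this,
    \<open>s dvd B\<close> would not follow from \<open>s dvd B * f^4\<close>.\<close>
  have "coprime s f"
  proof (rule ccontr)
    assume "\<not> coprime s f"
    then have "\<not> is_unit (gcd s f)" by (simp add: coprime_iff_gcd_eq_1)
    moreover have "gcd s f \<noteq> 0" using s0 by simp
    ultimately obtain r where "r dvd gcd s f" "prime r" using prime_divisor_exists by blast
    then have r: "prime r" "r dvd s" "r dvd f" by simp_all
    from r(2) obtain s' where s': "s = r * s'" by (rule dvdE)
    from r(3) obtain f' where f': "f = r * f'" by (rule dvdE)
    have r0: "r \<noteq> 0" using r(1) by auto
    have rs': "\<not> r dvd s'"
    proof
      assume "r dvd s'"
      then have "r^2 dvd s" unfolding s' by (simp add: power2_eq_square)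
      then show False using sf squarefreeD r(1) not_prime_unit by blast
    qed
    have "r * (s' * k^2) = r * (r * (s'^2 * e^4 + r * (A * s' * e^2 * f'^2 + B * r * f'^4)))"
      using sk unfolding s' f' by (simp add: algebra_simps eval_nat_numeral)
    then have eq: "s' * k^2 = r * (s'^2 * e^4 + r * (A * s' * e^2 * f'^2 + B * r * f'^4))"
      using r0 by simp
    then have "r dvd s' * k^2" by simp
    then have "r dvd k" using rs' r(1) by (metis prime_dvd_mult_iff prime_dvd_power)
    then obtain l where "k = r * l" by auto
    then have "r * (s' * r * l^2) = r * (s'^2 * e^4 + r * (A * s' * e^2 * f'^2 + B * r * f'^4))"
      using eq by (simp add: power2_eq_square mult_ac)
    then have "s' * r * l^2 = s'^2 * e^4 + r * (A * s' * e^2 * f'^2 + B * r * f'^4)" using r0 by simp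
    then have "s'^2 * e^4 = r * (s' * l^2 - (A * s' * e^2 * f'^2 + B * r * f'^4))"
      by (simp add: algebra_simps)
    then have "r dvd s'^2 * e^4" by simp
    then have "r dvd e" using rs' r(1) by (metis prime_dvd_mult_iff prime_dvd_power)
    then show False using r w(3) by (meson coprime_common_divisor not_prime_unit)
  qed
  have "s dvd B * f^4"
  proof -
    have "B * f^4 = s * (k^2 - s * e^4 - A * e^2 * f^2)" using sk by (simp add: algebra_simps power2_eq_square)
    then show ?thesis by simp
  qed
  then have "s dvd B" using \<open>coprime s f\<close> by (simp add: coprime_dvd_mult_left_iff)
  then obtain t where t: "s * t = B" by auto
  have "s * k^2 = s * (s * e^4 + A * e^2 * f^2 + t * f^4)"
    unfolding sk t[symmetric] by (simp add: algebra_simps power2_eq_square)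
  then have "k^2 = s * e^4 + A * e^2 * f^2 + t * f^4" using s0 by simp
  moreover have "e \<noteq> 0" using w w0 by auto
  ultimately show ?thesis using that sf t w xw by auto
qed

section \<open>Squares modulo 3, 4 and 8\<close>

lemma odd_square_mod_8:
  fixes x :: int assumes "odd x" shows "x^2 mod 8 = 1"
proof -
  obtain k where "x = 2*k + 1" using assms by (auto elim: oddE)
  then have "x^2 = 4 * (k * (k + 1)) + 1" by (simp add: power2_eq_square algebra_simps)
  moreover have "even (k * (k + 1))" by simp
  then obtain j where "k * (k + 1) = 2 * j" by blast
  ultimately have "x^2 = 8 * j + 1" by simp
  then show ?thesis by presburger
qed

lemma square_mod_8:
  fixes x :: int shows "x^2 mod 8 = 0 \<or> x^2 mod 8 = 1 \<or> x^2 mod 8 = 4"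
proof (cases "even x")
  case True
  then obtain y where y: "x = 2 * y" by auto
  show ?thesis
  proof (cases "even y")
    case False
    then obtain z where "y^2 = 2 * z + 1" by (metis even_power oddE)
    then have "x^2 = 4 + 8 * z" using y by (simp add: power_mult_distrib)
    then show ?thesis by simp
  qed (use y in \<open>auto elim!: evenE simp: power_mult_distrib\<close>)
qed (simp add: odd_square_mod_8)

lemma even_square_mod_4:
  fixes x :: int assumes "even x" shows "x^2 mod 4 = 0"
  using assms by (auto elim!: evenE simp: power2_eq_square)

lemma square_mod_4:
  fixes x :: int shows "x^2 mod 4 = 0 \<or> x^2 mod 4 = 1"
proof (cases "even x")
  case False
  then have "x^2 mod 8 = 1" by (rule odd_square_mod_8)
  then show ?thesis by presburger
qed (simp add: even_square_mod_4)

lemma square_mod_3: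
  fixes x :: int assumes "\<not> 3 dvd x" shows "x^2 mod 3 = 1"
proof -
  have "x mod 3 = 1 \<or> x mod 3 = 2" using assms by presburger
  then show ?thesis by (auto simp: power2_eq_square mod_mult_eq[symmetric, of x x])
qed

lemma dvd_prime_mult:
  fixes s p q :: int
  assumes "prime p" "prime q" "s dvd p * q"
  shows "\<bar>s\<bar> \<in> {1, p, q, p * q}"
proof -
  have dq: "\<bar>r\<bar> = 1 \<or> \<bar>r\<bar> = l" if "prime l" "r dvd l" for r l :: int
    using that by (metis abs_dvd_iff abs_ge_zero prime_int_iff)
  show ?thesis
  proof (cases "p dvd s")
    case True
    then obtain r where r: "s = p * r" by auto
    then have "r dvd q" using assms by (auto simp: prime_gt_0_int)
    then show ?thesis using dq[OF assms(2)] r prime_gt_0_int[OF assms(1)] by (auto simp: abs_mult)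
  next
    case False
    then have "coprime s p" using assms(1) by (metis coprime_commute prime_imp_coprime_int)
    then have "s dvd q" using assms(3) by (simp add: coprime_dvd_mult_right_iff)
    then show ?thesis using dq[OF assms(2)] by auto
  qed
qed

lemma mod_8_eq_1D: "(a::int) mod 8 = 1 \<Longrightarrow> odd a \<and> a mod 4 = 1"
  by presburger

lemma mod_4_eq_1D: "(a::int) mod 4 = 1 \<Longrightarrow> odd a \<and> (a - 4 * b) mod 4 = 1 \<and> (9 * a) mod 4 = 1"
  by presburger

lemma odd_square_cong:
  fixes x :: int assumes "odd x" shows "[x^2 = 1] (mod 8)" "[x^2 = 1] (mod 4)"
  using odd_square_mod_8[OF assms] mod_8_eq_1D[of "x^2"] by (simp_all add: cong_def)

lemma even_square_cong:
  fixes x :: int assumes "even x" shows "[x^2 = 0] (mod 4)"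
  using even_square_mod_4[OF assms] by (simp add: cong_def)

lemma double_odd_mod_4: "odd (a::int) \<Longrightarrow> (2 * a) mod 4 = 2"
  by (auto elim!: oddE)

section \<open>Local conditions on the quartics of both curves\<close>

lemma cong_quartic_form:
  fixes e f s c c' t E F M :: int
  assumes "[e^2 = E] (mod M)" "[f^2 = F] (mod M)" "[c = c'] (mod M)"
  shows "[s * e^4 + c * e^2 * f^2 + t * f^4 = s * E^2 + c' * E * F + t * F^2] (mod M)"
proof -
  have "[s * (e^2)^2 + c * e^2 * f^2 + t * (f^2)^2 = s * E^2 + c' * E * F + t * F^2] (mod M)"
    using assms by (intro cong_add cong_mult cong_pow cong_refl)
  then show ?thesis by simp
qed

text \<open>A negative \<open>s\<close> fails over the reals: \<open>t\<close> and the middle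
  coefficient are negative as well. An even \<open>s\<close> fails at 2: then
  \<open>s = 2 * s'\<close> and \<open>t = 2 * t'\<close> with \<open>s' * t' = p * q\<close>, and
  \<open>k^2\<close> would be 5 modulo 8 if \<open>e\<close> and \<open>f\<close> are odd, and 2
  modulo 4 otherwise. What remains are the positive divisors of \<open>p * q\<close>.\<close>

lemma descent_class_E:
  fixes x y :: rat and p q :: int
  assumes p: "prime p" "p mod 8 = 3" and q: "prime q" "q mod 8 = 3"
    and x: "x \<noteq> 0" "y^2 = x^3 + of_int (- 5 * p) * x^2 + of_int (4 * p * q) * x"
  obtains r where "r \<noteq> 0" "x = r^2 \<or> x = of_int p * r^2 \<or> x = of_int q * r^2 \<or> x = of_int (p * q) * r^2"
proof -
  obtain s t e f k where s: "squarefree s" "s * t = 4 * p * q" and ef: "coprime e f" "e \<noteq> 0" "f \<noteq> 0"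
    and xs: "x = of_int s * (of_int e / of_int f)^2"
    and k: "k^2 = s * e^4 + (- 5 * p) * e^2 * f^2 + t * f^4"
    using descent_quartic[OF x] by blast
  have pq: "p > 0" "q > 0" using p q prime_gt_0_int by auto
  have "s > 0"
  proof (rule ccontr)
    assume "\<not> s > 0"
    moreover have "s * t > 0" using s(2) pq by simp
    ultimately have "s < 0" "t < 0" by (auto simp: zero_less_mult_iff)
    then have "s * e^4 < 0" "t * f^4 < 0" using ef by (simp_all add: mult_less_0_iff)
    moreover have "p * e^2 * f^2 \<ge> 0" using pq by simp
    ultimately have "k^2 < 0" using k by simp
    then show False by simp
  qed
  have "odd s"
  proof
    assume "even s"
    then obtain s' where s': "s = 2 * s'" by auto
    have "\<not> 2^2 dvd s" using squarefreeD[OF s(1), of 2] by auto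
    then have os': "odd s'" using s' by (auto simp: power2_eq_square)
    have "s' * t = 2 * (p * q)" using s s' by simp
    then have "even (s' * t)" by simp
    then have "even t" using os' by simp
    then obtain t' where t': "t = 2 * t'" by auto
    have st': "s' * t' = p * q" using s s' t' by simp
    have pq8: "(p * q) mod 8 = 1" using mod_mult_eq[of p 8 q, symmetric] p(2) q(2) by simp
    have st8: "(s' * t') mod 8 = 1" using pq8 st' by simp
    then have "odd (s' * t')" using mod_8_eq_1D by blast
    then have ot': "odd t'" by simp
    have "odd e \<or> odd f" using ef(1) by (metis coprime_common_divisor odd_one)
    then consider "odd e" "odd f" | "even e" "odd f" | "odd e" "even f" by blast
    then show False
    proof cases
      case 1
      have "[k^2 = s * 1^2 + (-15) * 1 * 1 + t * 1^2] (mod 8)"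
      proof -
        have "[- 5 * p = - 5 * 3] (mod 8)" using p(2) by (intro cong_mult cong_refl) (simp add: cong_def)
        from cong_quartic_form[OF odd_square_cong(1)[OF 1(1)] odd_square_cong(1)[OF 1(2)] this]
        show ?thesis unfolding k by simp
      qed
      then have k8: "k^2 mod 8 = (2 * s' - 15 + 2 * t') mod 8" using s' t' by (simp add: cong_def)
      \<comment> \<open>Hence \<open>s'\<close> and \<open>t'\<close> agree modulo 4, so
        \<open>2 * s' + 2 * t'\<close> is 4 modulo 8; subtracting 15 leaves 5.\<close>
      have "(s' * t') mod 4 = 1" using st8 mod_8_eq_1D by blast
      then have "(s' mod 4 * (t' mod 4)) mod 4 = 1" by (simp add: mod_mult_eq)
      moreover have "s' mod 4 = 1 \<or> s' mod 4 = 3" "t' mod 4 = 1 \<or> t' mod 4 = 3"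
        using os' ot' by presburger+
      ultimately have "s' mod 4 = t' mod 4" by auto
      then have "4 dvd s' - t'" by (simp add: mod_eq_dvd_iff)
      then obtain z where z: "s' - t' = 4 * z" by (rule dvdE)
      obtain w where w: "t' = 2 * w + 1" using ot' by (rule oddE)
      have "2 * s' - 15 + 2 * t' = 5 + 8 * (w + z - 2)" using z w by simp
      then have "(2 * s' - 15 + 2 * t') mod 8 = 5" by (simp only: mod_mult_self2) simp
      then have "k^2 mod 8 = 5" using k8 by simp
      then show False using square_mod_8[of k] by simp
    next
      case 2
      have "[k^2 = s * 0^2 + (- 5 * p) * 0 * 1 + t * 1^2] (mod 4)"
        unfolding k by (rule cong_quartic_form[OF even_square_cong[OF 2(1)] odd_square_cong(2)[OF 2(2)] cong_refl])
      then have "k^2 mod 4 = (2 * t') mod 4" using t' by (simp add: cong_def)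
      then show False using square_mod_4[of k] double_odd_mod_4[OF ot'] by simp
    next
      case 3
      have "[k^2 = s * 1^2 + (- 5 * p) * 1 * 0 + t * 0^2] (mod 4)"
        unfolding k by (rule cong_quartic_form[OF odd_square_cong(2)[OF 3(1)] even_square_cong[OF 3(2)] cong_refl])
      then have "k^2 mod 4 = (2 * s') mod 4" using s' by (simp add: cong_def)
      then show False using square_mod_4[of k] double_odd_mod_4[OF os'] by simp
    qed
  qed
  have "s dvd p * q"
  proof -
    have "coprime s 2" using \<open>odd s\<close> by simp
    then have "coprime s (2^2)" by (simp only: coprime_power_right_iff) simp
    moreover have "2^2 * (p * q) = s * t" using s(2) by simp
    then have "s dvd 2^2 * (p * q)" by simp
    ultimately show ?thesis using coprime_dvd_mult_right_iff by blast
  qed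
  from dvd_prime_mult[OF p(1) q(1) this] have "s = 1 \<or> s = p \<or> s = q \<or> s = p * q"
    using \<open>s > 0\<close> by simp
  then show ?thesis using that[of "of_int e / of_int f"] ef xs by auto
qed

text \<open>With \<open>e\<close> divisible by 3, the square \<open>k^2\<close> is divisible by 3
  and hence by 9, as are all terms on the right other than \<open>3 * t * f^4\<close>. The form is
  symmetric, so this also applies with \<open>e\<close> and \<open>f\<close> exchanged.\<close>

lemma three_dvd_quartic:
  fixes e f k s t c :: int
  assumes "k^2 = 3 * s * e^4 + c * e^2 * f^2 + 3 * t * f^4" "3 dvd e" "\<not> 3 dvd t"
  shows "3 dvd f"
proof -
  obtain a where a: "e = 3 * a" using assms by auto
  have three: "prime (3::int)" by simp
  have "k^2 = 3 * (s * e^4 + c * 3 * a^2 * f^2 + t * f^4)"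
    using assms(1) unfolding a by (simp add: power2_eq_square algebra_simps)
  then have "3 dvd k^2" by simp
  then have "3 dvd k" using three prime_dvd_power by blast
  then obtain l where "k = 3 * l" by auto
  then have "t * f^4 = 3 * (l^2 - 27 * s * a^4 - c * a^2 * f^2)"
    using assms(1) unfolding a by (simp add: power2_eq_square eval_nat_numeral)
  then have "3 dvd t * f^4" by simp
  then show ?thesis using assms(3) three by (metis prime_dvd_mult_iff prime_dvd_power)
qed

text \<open>Negative classes do occur here, and signs are settled modulo 4 instead. If 3 divided
  \<open>s\<close>, it would divide \<open>t\<close> too; then either \<open>k^2\<close> is
  \<open>10 * p\<close>, that is 2, modulo 3, or 3 divides both \<open>e\<close> and
  \<open>f\<close>. The condition at 2 is \<open>s mod 4 = 1\<close>, and since \<open>m\<close> and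
  \<open>p\<close> are 3 modulo 4, it selects \<open>1\<close>, \<open>m * p\<close>,
  \<open>-m\<close> and \<open>-p\<close> among the divisors of \<open>m * p\<close>.\<close>

lemma descent_class_E':
  fixes x y :: rat and m p q :: int
  assumes m: "prime m" "m mod 12 = 11" and p: "prime p" "p mod 12 = 11"
    and q: "25 * p - 9 * m = 16 * q"
    and x: "x \<noteq> 0" "y^2 = x^3 + of_int (10 * p) * x^2 + of_int (9 * m * p) * x"
  obtains r where "r \<noteq> 0"
    "x = r^2 \<or> x = of_int (m * p) * r^2 \<or> x = of_int (- m) * r^2 \<or> x = of_int (- p) * r^2"
proof -
  obtain s t e f k where s: "squarefree s" "s * t = 9 * m * p" and ef: "coprime e f" "e \<noteq> 0" "f \<noteq> 0"
    and xs: "x = of_int s * (of_int e / of_int f)^2"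
    and k: "k^2 = s * e^4 + (10 * p) * e^2 * f^2 + t * f^4"
    using descent_quartic[OF x] by blast
  have pm: "p > 0" "m > 0" using p m prime_gt_0_int by auto
  have three: "prime (3::int)" by simp
  have mod3: "p mod 3 = 2" "m mod 3 = 2" and mod4: "p mod 4 = 3" "m mod 4 = 3"
    using p(2) m(2) by presburger+
  have mp3: "(m * p) mod 3 = 1" using mod_mult_eq[of m 3 p, symmetric] mod3 by simp
  have mp4: "(m * p) mod 4 = 1" using mod_mult_eq[of m 4 p, symmetric] mod4 by simp
  have "\<not> 3 dvd s"
  proof
    assume "3 dvd s"
    then obtain s' where s': "s = 3 * s'" by auto
    have "\<not> 3^2 dvd s" using squarefreeD[OF s(1), of 3] by auto
    then have ns': "\<not> 3 dvd s'" using s' by (auto simp: power2_eq_square)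
    have st: "s' * t = 3 * (m * p)" using s s' by simp
    then have "3 dvd s' * t" by simp
    then have "3 dvd t" using ns' three prime_dvd_mult_iff by blast
    then obtain t' where t': "t = 3 * t'" by auto
    have "s' * t' = m * p" using st t' by simp
    moreover have "\<not> 3 dvd m * p" using mp3 by (simp add: dvd_eq_mod_eq_0)
    ultimately have nt': "\<not> 3 dvd t'" by (metis dvd_mult)
    have k': "k^2 = 3 * s' * e^4 + (10 * p) * e^2 * f^2 + 3 * t' * f^4" using k s' t' by simp
    then have k'': "k^2 = 3 * t' * f^4 + (10 * p) * f^2 * e^2 + 3 * s' * e^4" by simp
    have "3 dvd e \<or> 3 dvd f"
    proof (rule ccontr)
      assume *: "\<not> (3 dvd e \<or> 3 dvd f)"
      have "[k^2 = 3 * s' * 1^2 + 2 * 1 * 1 + 3 * t' * 1^2] (mod 3)"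
      proof -
        have "[10 * p = 10 * 2] (mod 3)" using mod3 by (intro cong_mult cong_refl) (simp add: cong_def)
        also have "[10 * 2 = 2] (mod (3::int))" by (simp add: cong_def)
        finally have "[10 * p = 2] (mod 3)" .
        moreover have "[e^2 = 1] (mod 3)" "[f^2 = 1] (mod 3)" using * square_mod_3 by (simp_all add: cong_def)
        ultimately show ?thesis unfolding k' by (intro cong_quartic_form)
      qed
      then have "k^2 mod 3 = (3 * s' + 2 + 3 * t') mod 3" by (simp add: cong_def)
      then have k2: "k^2 mod 3 = 2" by presburger
      show False
      proof (cases "3 dvd k")
        case True
        then have "k^2 mod 3 = 0" by (simp add: power2_eq_square)
        then show False using k2 by simp
      next
        case False
        then show False using k2 square_mod_3 by simp
      qed
    qed
    then have "3 dvd e \<and> 3 dvd f"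
      using three_dvd_quartic[OF k' _ nt'] three_dvd_quartic[OF k'' _ ns'] by blast
    then show False using ef(1) by (metis coprime_common_divisor not_prime_unit three)
  qed
  have st4: "(s * t) mod 4 = 1" using mod_4_eq_1D[OF mp4] s(2) by (simp add: mult.assoc)
  then have "odd (s * t)" using mod_4_eq_1D by blast
  then have odd: "odd s" "odd t" by auto
  have "s mod 4 = 1"
  proof -
    have "odd e \<or> odd f" using ef(1) by (metis coprime_common_divisor odd_one)
    then consider "odd e" "odd f" | "even e" "odd f" | "odd e" "even f" by blast
    then show ?thesis
    proof cases
      case 1
      show ?thesis
      proof (rule ccontr)
        assume "s mod 4 \<noteq> 1"
        then have s4: "s mod 4 = 3" using odd by presburger
        \<comment> \<open>Completing the square in \<open>s * k^2\<close> leaves the term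
          \<open>(25 * p - 9 * m) * p * f^4 = 16 * q * p * f^4\<close>. If \<open>s\<close> were 3
          modulo 4, \<open>g\<close> would be 2 modulo 4; cancelling a factor 4 then gives
          \<open>s * l^2\<close> congruent to 1 modulo 4 with \<open>l\<close> odd, so
          \<open>s\<close> would be 1 after all.\<close>
        define g where "g = s * e^2 + 5 * p * f^2"
        have "s * k^2 = g^2 - (25 * p - 9 * m) * p * f^4"
        proof -
          have "s * k^2 = s^2 * e^4 + 10 * p * s * e^2 * f^2 + (s * t) * f^4" unfolding k by algebra
          also have "\<dots> = g^2 - (25 * p - 9 * m) * p * f^4" unfolding s(2) g_def by algebra
          finally show ?thesis .
        qed
        then have sk: "s * k^2 = g^2 - 16 * (q * p * f^4)" unfolding q by simp
        have ef1: "[e^2 = 1] (mod 4)" "[f^2 = 1] (mod 4)"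
          using odd_square_cong(2) 1 by auto
        have "[5 * p = 5 * 3] (mod 4)" using mod4 by (intro cong_mult cong_refl) (simp add: cong_def)
        moreover have "[s = 3] (mod 4)" using s4 by (simp add: cong_def)
        ultimately have "[g = 3 * 1 + 5 * 3 * 1] (mod 4)"
          unfolding g_def using ef1 by (blast intro: cong_add cong_mult)
        then have g4: "g mod 4 = 2" by (simp add: cong_def)
        have "g = 2 * (g div 2)" "odd (g div 2)" using g4 by presburger+
        then obtain g' where g': "g = 2 * g'" "odd g'" by blast
        have "even (s * k^2)" unfolding sk g'(1) by simp
        then have "even k" using odd by simp
        then obtain l where l: "k = 2 * l" by auto
        have sl: "s * l^2 = g'^2 - 4 * (q * p * f^4)" using sk unfolding g'(1) l by simp
        have "g'^2 mod 4 = 1" using odd_square_cong(2)[OF g'(2)] by (simp add: cong_def)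
        then have sl4: "(s * l^2) mod 4 = 1" unfolding sl using mod_4_eq_1D by blast
        then have "odd (s * l^2)" using mod_4_eq_1D by blast
        then have "l^2 mod 4 = 1" using odd_square_cong(2)[of l] by (simp add: cong_def)
        then have "(s * l^2) mod 4 = 3" using mod_mult_eq[of s 4 "l^2", symmetric] s4 by simp
        then show False using sl4 by simp
      qed
    next
      case 2
      have "[k^2 = s * 0^2 + (10 * p) * 0 * 1 + t * 1^2] (mod 4)"
        unfolding k by (rule cong_quartic_form[OF even_square_cong[OF 2(1)] odd_square_cong(2)[OF 2(2)] cong_refl])
      then have "k^2 mod 4 = t mod 4" by (simp add: cong_def)
      moreover have "t mod 4 \<noteq> 0" using odd by presburger
      ultimately have "t mod 4 = 1" using square_mod_4[of k] by simp
      then show ?thesis using st4 mod_mult_eq[of s 4 t, symmetric] by simp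
    next
      case 3
      have "[k^2 = s * 1^2 + (10 * p) * 1 * 0 + t * 0^2] (mod 4)"
        unfolding k by (rule cong_quartic_form[OF odd_square_cong(2)[OF 3(1)] even_square_cong[OF 3(2)] cong_refl])
      then have "k^2 mod 4 = s mod 4" by (simp add: cong_def)
      moreover have "s mod 4 \<noteq> 0" using odd by presburger
      ultimately show ?thesis using square_mod_4[of k] by simp
    qed
  qed
  have "s dvd m * p"
  proof -
    have "coprime s 3" using \<open>\<not> 3 dvd s\<close> three by (metis coprime_commute prime_imp_coprime_int)
    then have "coprime s (3^2)" by (simp only: coprime_power_right_iff) simp
    moreover have "3^2 * (m * p) = s * t" using s(2) by simp
    then have "s dvd 3^2 * (m * p)" by simp
    ultimately show ?thesis using coprime_dvd_mult_right_iff by blast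
  qed
  from dvd_prime_mult[OF m(1) p(1) this] have "\<bar>s\<bar> \<in> {1, m, p, m * p}" .
  then have "s \<in> {1, m, p, m * p} \<or> - s \<in> {1, m, p, m * p}" by (metis abs_if)
  moreover have "s \<noteq> m" "s \<noteq> p" using \<open>s mod 4 = 1\<close> mod4 by auto
  moreover have "(- s) mod 4 \<noteq> 1" using \<open>s mod 4 = 1\<close> by presburger
  then have "- s \<noteq> 1" "- s \<noteq> m * p" using mp4 by auto
  ultimately have "s = 1 \<or> - s = m \<or> - s = p \<or> s = m * p" by blast
  then have "s = 1 \<or> s = - m \<or> s = - p \<or> s = m * p" by auto
  then show ?thesis using that[of "of_int e / of_int f"] ef xs by auto
qed

section \<open>Heights\<close>

definition height :: "rat \<Rightarrow> nat" where
  "height u = nat (max \<bar>fst (quotient_of u)\<bar> (snd (quotient_of u)))"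

lemma quotient_of_eq:
  assumes "b > 0" "coprime a b" shows "quotient_of (of_int a / of_int b) = (a, b)"
proof -
  have "quotient_of (Fract a b) = (a, b)" using assms by (simp add: quotient_of_Fract normalize_stable)
  then show ?thesis by (simp add: Fract_of_int_quotient)
qed

lemma height_obtain:
  obtains a b where "u = of_int a / of_int b" "b > 0" "coprime a b" "height u = nat (max \<bar>a\<bar> b)"
proof -
  obtain a b where ab: "quotient_of u = (a, b)" by (metis surj_pair)
  then have "u = of_int a / of_int b" "b > 0" "coprime a b" "height u = nat (max \<bar>a\<bar> b)"
    using quotient_of_div quotient_of_denom_pos quotient_of_coprime by (auto simp: height_def)
  then show ?thesis by (rule that)
qed

text \<open>The cancelled factor \<open>g\<close> is exposed because a lower bound for a height
  needs a bound on it, and the 2-adic argument needs it to be odd.\<close>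

lemma quotient_gcd:
  fixes a b :: int
  assumes "b \<noteq> 0"
  obtains g a' b' where "a = g * a'" "b = g * b'" "coprime a' b'" "g \<noteq> 0"
    "quotient_of (of_int a / of_int b) = (a', b')"
    "height (of_int a / of_int b) = nat (max \<bar>a'\<bar> \<bar>b'\<bar>)"
proof -
  obtain a' b' where h: "(of_int a / of_int b :: rat) = of_int a' / of_int b'" "b' > 0" "coprime a' b'"
    "height (of_int a / of_int b) = nat (max \<bar>a'\<bar> b')"
    by (rule height_obtain)
  have h': "quotient_of (of_int a / of_int b) = (a', b')" unfolding h(1) using h(2,3) by (rule quotient_of_eq)
  from h have "of_int (a * b') = (of_int (a' * b) :: rat)" using assms by (simp add: field_simps)
  then have eq: "a * b' = a' * b" by (simp only: of_int_eq_iff)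
  then have "b' dvd a' * b" by (metis dvd_triv_right)
  then have "b' dvd b" using h(3) by (simp add: coprime_dvd_mult_right_iff coprime_commute)
  then obtain g where g: "b = b' * g" by (rule dvdE)
  have "a * b' = (g * a') * b'" using eq g by (simp add: mult_ac)
  then have "a = g * a'" using h(2) by (simp add: mult.commute)
  then show ?thesis using that[of g a' b'] g h h' assms by auto
qed

lemma height_le:
  assumes "b \<noteq> 0" shows "int (height (of_int a / of_int b)) \<le> max \<bar>a\<bar> \<bar>b\<bar>"
proof -
  obtain g a' b' where g: "a = g * a'" "b = g * b'" "g \<noteq> 0"
    "height (of_int a / of_int b) = nat (max \<bar>a'\<bar> \<bar>b'\<bar>)"
    using quotient_gcd[OF assms] by metis
  have "1 * \<bar>c\<bar> \<le> \<bar>g * c\<bar>" for c using g(3) unfolding abs_mult by (intro mult_right_mono) auto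
  then have "\<bar>a'\<bar> \<le> \<bar>a\<bar>" "\<bar>b'\<bar> \<le> \<bar>b\<bar>" using g by auto
  then show ?thesis using g(4) by (auto simp: le_max_iff_disj)
qed

lemma finite_height_le: "finite {u. height u \<le> c}"
proof -
  have "{u. height u \<le> c} \<subseteq> (\<lambda>(a, b). of_int a / of_int b) ` ({- int c..int c} \<times> {- int c..int c})"
  proof
    fix u assume u: "u \<in> {u. height u \<le> c}"
    obtain a b where ab: "u = of_int a / of_int b" "b > 0" "height u = nat (max \<bar>a\<bar> b)"
      by (metis height_obtain)
    then have "(a, b) \<in> {- int c..int c} \<times> {- int c..int c}" using u by auto
    then show "u \<in> (\<lambda>(a, b). of_int a / of_int b) ` ({- int c..int c} \<times> {- int c..int c})"
      using ab(1) by force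
  qed
  then show ?thesis by (rule finite_subset) simp
qed

lemma quartic_integral:
  fixes u v :: rat and A d :: int
  assumes "v^2 = 1 - 2 * of_int A * u^2 + of_int d * u^4"
  obtains M N W where "u = of_int M / of_int N" "v = of_int W / of_int N^2" "N > 0" "coprime M N"
    "W^2 = N^4 - 2 * A * M^2 * N^2 + d * M^4" "int (height u) = max \<bar>M\<bar> N"
proof -
  obtain M N where u: "u = of_int M / of_int N" "N > 0" "coprime M N" "height u = nat (max \<bar>M\<bar> N)"
    by (rule height_obtain)
  have uN: "u * of_int N = of_int M" using u by simp
  have "(v * of_int N^2)^2 = of_int N^4 - 2 * of_int A * (u * of_int N)^2 * of_int N^2 + of_int d * (u * of_int N)^4"
    using assms by algebra
  then have sq: "(v * of_int N^2)^2 = of_int (N^4 - 2 * A * M^2 * N^2 + d * M^4)" unfolding uN by simp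
  then obtain W where W: "v * of_int N^2 = of_int W" using rat_square_int by blast
  then have "W^2 = N^4 - 2 * A * M^2 * N^2 + d * M^4" using sq by (metis of_int_eq_iff of_int_power)
  moreover have "v = of_int W / of_int N^2" using W u(2) by (simp add: field_simps)
  moreover have "int (height u) = max \<bar>M\<bar> N" using u by simp
  ultimately show ?thesis using that u by blast
qed

section \<open>Heights of points and of translates\<close>

locale rational_curve = two_torsion_curve "of_int a" "of_int b :: rat" for a b :: int
begin

definition ht :: "rat ec_point \<Rightarrow> nat" where
  "ht P = height (fst (to_quartic P))"

lemma integral_point:
  assumes "P \<in> curve"
  obtains M N W where "to_quartic P = (of_int M / of_int N, of_int W / of_int N^2)" "N > 0" "coprime M N"
    "W^2 = N^4 - 2 * a * M^2 * N^2 + (a^2 - 4 * b) * M^4" "int (ht P) = max \<bar>M\<bar> N"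
proof -
  obtain u v where uv: "to_quartic P = (u, v)" by (metis surj_pair)
  have "(u, v) \<in> quartic" using to_quartic_closed[OF assms] uv by simp
  then have "v^2 = 1 - 2 * of_int a * u^2 + of_int (a^2 - 4 * b) * u^4"
    by (simp add: quartic_def d_def)
  then obtain M N W where "u = of_int M / of_int N" "v = of_int W / of_int N^2" "N > 0" "coprime M N"
    "W^2 = N^4 - 2 * a * M^2 * N^2 + (a^2 - 4 * b) * M^4" "int (height u) = max \<bar>M\<bar> N"
    by (rule quartic_integral)
  then show ?thesis using that uv by (simp add: ht_def)
qed

lemma finite_ht_le: "finite {P \<in> curve. ht P \<le> c}"
proof -
  let ?S = "{P \<in> curve. ht P \<le> c}"
  have fin: "finite {v. (u, v) \<in> quartic}" for u
  proof (cases "\<exists>v0. (u, v0) \<in> quartic")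
    case True
    then obtain v0 where v0: "(u, v0) \<in> quartic" by blast
    have "v = v0 \<or> v = - v0" if "(u, v) \<in> quartic" for v
      using that v0 by (simp add: quartic_def power2_eq_iff flip: power2_eq_iff)
    then have "{v. (u, v) \<in> quartic} \<subseteq> {v0, - v0}" by auto
    then show ?thesis by (rule finite_subset) simp
  qed simp
  have "to_quartic ` ?S \<subseteq> Sigma {u. height u \<le> c} (\<lambda>u. {v. (u, v) \<in> quartic})"
  proof
    fix R assume "R \<in> to_quartic ` ?S"
    then obtain P where P: "P \<in> curve" "ht P \<le> c" "to_quartic P = R" by auto
    obtain u v where R: "R = (u, v)" by (metis surj_pair)
    then have "height u \<le> c" using P(2,3) by (simp add: ht_def)
    moreover have "(u, v) \<in> quartic" using to_quartic_closed[OF P(1)] P(3) R by simp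
    ultimately show "R \<in> Sigma {u. height u \<le> c} (\<lambda>u. {v. (u, v) \<in> quartic})" using R by simp
  qed
  then have "finite (to_quartic ` ?S)"
    by (rule finite_subset) (intro finite_SigmaI finite_height_le fin)
  moreover have "inj_on to_quartic ?S" using inj_to_quartic by (rule inj_on_subset) auto
  ultimately show ?thesis by (rule finite_imageD)
qed

text \<open>The first coordinate of the sum is \<open>num/den\<close> with both entries quadratic in
  the height of \<open>P\<close>: the quartic equation bounds \<open>W1\<close> by a constant times
  \<open>H^2\<close>. Only an upper bound is wanted, so cancellation can be ignored.\<close>

lemma ht_add:
  assumes Q: "Q \<in> curve"
  obtains C where "\<And>P. P \<in> curve \<Longrightarrow> ht (ec_add (of_int a) (of_int b) P Q) \<le> C * (ht P)^2"
proof -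
  obtain M2 N2 W2 where Q2: "to_quartic Q = (of_int M2 / of_int N2, of_int W2 / of_int N2^2)" "N2 > 0"
    by (rule integral_point[OF Q]) blast
  define e where "e = a^2 - 4 * b"
  define c where "c = 1 + 2 * \<bar>a\<bar> + \<bar>e\<bar>"
  define K where "K = \<bar>W2\<bar> + \<bar>M2\<bar> * N2 * c + (N2^2 + \<bar>e\<bar> * M2^2)"
  have "ht (ec_add (of_int a) (of_int b) P Q) \<le> nat K * (ht P)^2" if P: "P \<in> curve" for P
  proof -
    obtain M1 N1 W1 where P1: "to_quartic P = (of_int M1 / of_int N1, of_int W1 / of_int N1^2)" "N1 > 0"
      and W1: "W1^2 = N1^4 - 2 * a * M1^2 * N1^2 + e * M1^4" and H: "int (ht P) = max \<bar>M1\<bar> N1"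
      using integral_point[OF P] unfolding e_def by metis
    define H where "H = int (ht P)"
    have H0: "H \<ge> 0" "\<bar>M1\<bar> \<le> H" "N1 \<le> H" "\<bar>N1\<bar> \<le> H" using H P1(2) by (auto simp: H_def)
    have sq: "\<bar>x * y\<bar> \<le> H^2" if "\<bar>x\<bar> \<le> H" "\<bar>y\<bar> \<le> H" for x y
      using mult_mono[OF that] H0(1) by (simp add: abs_mult power2_eq_square)
    have 4: "\<bar>x * y\<bar> \<le> H^4" if "\<bar>x\<bar> \<le> H^2" "\<bar>y\<bar> \<le> H^2" for x y
      using mult_mono[OF that] H0(1) by (simp add: abs_mult flip: power_add)
    have M2: "\<bar>M1^2\<bar> \<le> H^2" and N2: "\<bar>N1^2\<bar> \<le> H^2"
      using sq[of M1 M1] sq[of N1 N1] H0 by (simp_all add: power2_eq_square)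
    have M4: "\<bar>M1^4\<bar> \<le> H^4" and N4: "\<bar>N1^4\<bar> \<le> H^4" and MN: "\<bar>M1^2 * N1^2\<bar> \<le> H^4"
      using 4[OF M2 M2] 4[OF N2 N2] 4[OF M2 N2] by (simp_all flip: power_add)
    have "W1^2 \<le> \<bar>N1^4\<bar> + 2 * \<bar>a\<bar> * \<bar>M1^2 * N1^2\<bar> + \<bar>e\<bar> * \<bar>M1^4\<bar>"
    proof -
      have "\<bar>2 * a * (M1^2 * N1^2)\<bar> = 2 * \<bar>a\<bar> * \<bar>M1^2 * N1^2\<bar>" by (simp only: abs_mult abs_numeral)
      moreover have "\<bar>e * M1^4\<bar> = \<bar>e\<bar> * \<bar>M1^4\<bar>" by (rule abs_mult)
      moreover have "W1^2 = N1^4 - 2 * a * (M1^2 * N1^2) + e * M1^4" unfolding W1 by simp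
      ultimately show ?thesis
        using abs_ge_minus_self[of "2 * a * (M1^2 * N1^2)"] abs_ge_self[of "e * M1^4"] abs_ge_self[of "N1^4"]
        by linarith
    qed
    also have "\<dots> \<le> H^4 + 2 * \<bar>a\<bar> * H^4 + \<bar>e\<bar> * H^4"
      using M4 N4 MN by (intro add_mono mult_left_mono) auto
    also have "\<dots> = c * H^4" by (simp add: c_def algebra_simps)
    also have "\<dots> \<le> c^2 * H^4"
    proof -
      have "c * 1 \<le> c * c" by (intro mult_left_mono) (auto simp: c_def)
      then show ?thesis by (intro mult_right_mono) (auto simp: power2_eq_square)
    qed
    also have "\<dots> = (c * H^2)^2" by (simp add: power_mult_distrib)
    finally have "\<bar>W1\<bar> \<le> \<bar>c * H^2\<bar>" by (simp only: abs_le_square_iff)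
    then have W1c: "\<bar>W1\<bar> \<le> c * H^2" by (simp add: c_def)
    define num where "num = M1 * N1 * W2 + M2 * N2 * W1"
    define den where "den = N1^2 * N2^2 - e * M1^2 * M2^2"
    have "1 - d * (of_int M1 / of_int N1)^2 * (of_int M2 / of_int N2)^2 \<noteq> 0" by (rule qadd_denom)
    moreover have D: "1 - d * (of_int M1 / of_int N1)^2 * (of_int M2 / of_int N2)^2
        = of_int den / (of_int N1^2 * of_int N2^2)"
      using P1(2) Q2(2) by (simp add: den_def d_def e_def field_simps)
    ultimately have den: "den \<noteq> 0" by auto
    have "fst (to_quartic (ec_add (of_int a) (of_int b) P Q))
        = (of_int M1 / of_int N1 * (of_int W2 / of_int N2^2) + of_int M2 / of_int N2 * (of_int W1 / of_int N1^2))
          / (of_int den / (of_int N1^2 * of_int N2^2))"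
      unfolding to_quartic_hom[OF P Q] P1(1) Q2(1) qadd.simps D by simp
    also have "\<dots> = of_int num / of_int den"
      using P1(2) Q2(2) den by (simp add: num_def field_simps power2_eq_square)
    finally have "int (ht (ec_add (of_int a) (of_int b) P Q)) \<le> max \<bar>num\<bar> \<bar>den\<bar>"
      unfolding ht_def using height_le[OF den] by simp
    also have "\<dots> \<le> K * H^2"
    proof (rule max.boundedI)
      have "\<bar>num\<bar> \<le> \<bar>M1 * N1\<bar> * \<bar>W2\<bar> + \<bar>M2 * N2\<bar> * \<bar>W1\<bar>"
        using abs_triangle_ineq[of "M1 * N1 * W2" "M2 * N2 * W1"] by (simp add: num_def abs_mult)
      also have "\<dots> \<le> H^2 * \<bar>W2\<bar> + \<bar>M2 * N2\<bar> * (c * H^2)"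
        using sq[of M1 N1] H0 W1c by (intro add_mono mult_right_mono mult_left_mono) auto
      also have "\<dots> = (\<bar>W2\<bar> + \<bar>M2\<bar> * N2 * c) * H^2" using Q2(2) by (simp add: abs_mult algebra_simps)
      also have "\<dots> \<le> K * H^2" unfolding K_def by (intro mult_right_mono) auto
      finally show "\<bar>num\<bar> \<le> K * H^2" .
      have "\<bar>den\<bar> \<le> N1^2 * N2^2 + \<bar>e\<bar> * (M1^2 * M2^2)"
        using abs_triangle_ineq4[of "N1^2 * N2^2" "e * (M1^2 * M2^2)"]
        by (simp add: den_def abs_mult mult.assoc)
      also have "\<dots> \<le> H^2 * N2^2 + \<bar>e\<bar> * (H^2 * M2^2)"
        using M2 N2 by (intro add_mono mult_right_mono mult_left_mono) auto
      also have "\<dots> = (N2^2 + \<bar>e\<bar> * M2^2) * H^2" by (simp add: algebra_simps)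
      also have "\<dots> \<le> K * H^2" unfolding K_def using Q2(2) by (intro mult_right_mono) (auto simp: c_def)
      finally show "\<bar>den\<bar> \<le> K * H^2" .
    qed
    finally have "int (ht (ec_add (of_int a) (of_int b) P Q)) \<le> K * H^2" .
    moreover have "K \<ge> 0" using Q2(2) by (simp add: K_def c_def)
    ultimately have "int (ht (ec_add (of_int a) (of_int b) P Q)) \<le> int (nat K * (ht P)^2)"
      by (simp add: H_def)
    then show ?thesis by (simp only: of_nat_le_iff)
  qed
  then show ?thesis by (rule that)
qed

end

section \<open>Heights under an isogeny\<close>

locale rational_isogeny =
  two_isogeny "of_int a" "of_int b" "of_int a'" "of_int b'" "of_int s :: rat" for a b a' b' s :: int +
  assumes disc_pos: "a^2 - 4 * b > 0"
begin

sublocale R: rational_curve a b ..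
sublocale R': rational_curve a' b' ..

text \<open>The image has first coordinate \<open>s*M*N/W\<close>, and the point is that little can
  cancel. A common factor \<open>g\<close> is prime to \<open>M\<close>, because \<open>W^2\<close>
  is congruent to \<open>N^4\<close> modulo \<open>M\<close>; so \<open>g\<close> divides
  \<open>s*N\<close>, and the equation for \<open>W^2\<close> gives that \<open>g^2\<close> divides
  \<open>s^2*e*M^4\<close>, hence \<open>s^2*e\<close>. So \<open>W\<close> and \<open>M*N\<close>
  are bounded by the height of the image, and with them
  \<open>N^4 + e*M^4 = W^2 + 2*a*M^2*N^2\<close>. The powers in the statement avoid square roots of
  constants.\<close>

lemma ht_isog:
  obtains C where "\<And>P. P \<in> E.curve \<Longrightarrow> (R.ht P)^4 \<le> C * (R'.ht (isog P))^2"
proof -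
  define e where "e = a^2 - 4 * b"
  define K where "K = s^2 * e"
  define C where "C = (1 + 2 * \<bar>a\<bar>) * K^2"
  have s0: "s \<noteq> 0" using s_nonzero by simp
  have "(R.ht P)^4 \<le> nat C * (R'.ht (isog P))^2" if P: "P \<in> E.curve" for P
  proof -
    obtain M N W where P1: "E.to_quartic P = (of_int M / of_int N, of_int W / of_int N^2)" "N > 0" "coprime M N"
      and W: "W^2 = N^4 - 2 * a * M^2 * N^2 + e * M^4" and H: "int (R.ht P) = max \<bar>M\<bar> N"
      using R.integral_point[OF P] unfolding e_def by metis
    have "(of_int W / of_int N^2 :: rat) \<noteq> 0"
      using E.quartic_v_nonzero E.to_quartic_closed[OF P] P1(1) by metis
    then have W0: "W \<noteq> 0" by auto
    have "fst (E'.to_quartic (isog P)) = of_int (s * M * N) / of_int W"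
      unfolding to_quartic_isog[OF P] P1(1) using P1(2) W0 by (simp add: power2_eq_square)
    then have ht': "R'.ht (isog P) = height (of_int (s * M * N) / of_int W)"
      unfolding R'.ht_def by (rule arg_cong)
    obtain g x y where g: "s * M * N = g * x" "W = g * y" "coprime x y" "g \<noteq> 0" "quotient_of (of_int (s * M * N) / of_int W) = (x, y)"
      "height (of_int (s * M * N) / of_int W) = nat (max \<bar>x\<bar> \<bar>y\<bar>)"
      by (rule quotient_gcd[OF W0, of "s * M * N"])
    then have H': "R'.ht (isog P) = nat (max \<bar>x\<bar> \<bar>y\<bar>)" unfolding ht' by simp
    have cMW: "coprime M W"
    proof -
      have "W^2 = (e * M^3 - 2 * a * M * N^2) * M + N^4"
        unfolding W by (simp add: algebra_simps eval_nat_numeral)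
      then have "gcd M (W^2) = gcd M (N^4)" by (simp only: gcd_add_mult)
      moreover have "coprime M (N^4)" using P1(3) by simp
      ultimately have "coprime M (W^2)" by (simp only: coprime_iff_gcd_eq_1)
      then show ?thesis by simp
    qed
    have "g dvd W" using g(2) by simp
    then have cg: "coprime M g" using cMW by (metis coprime_divisors dvd_refl)
    have "g dvd M * (s * N)" using g(1) by (simp add: mult_ac)
    then have "g dvd s * N" using cg by (simp add: coprime_dvd_mult_right_iff coprime_commute)
    then have "g^2 dvd (s * N)^2" by (rule dvd_power_same)
    moreover have "g^2 dvd s^2 * W^2" using g(2) by (simp add: power_mult_distrib)
    moreover have "s^2 * (e * M^4) = s^2 * W^2 - (s * N)^2 * (N^2 - 2 * a * M^2)"
      unfolding W by (simp add: power_mult_distrib algebra_simps eval_nat_numeral)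
    ultimately have "g^2 dvd s^2 * (e * M^4)" by simp
    then have "g^2 dvd K * M^4" by (simp add: K_def mult.assoc)
    then have "g^2 dvd K" using cg by (simp add: coprime_dvd_mult_left_iff coprime_commute)
    moreover have K0: "K > 0" using disc_pos s0 by (simp add: K_def e_def)
    ultimately have "g^2 \<le> K" by (rule zdvd_imp_le)
    moreover have "\<bar>g\<bar> * 1 \<le> \<bar>g\<bar> * \<bar>g\<bar>" using g(4) by (intro mult_left_mono) auto
    then have "\<bar>g\<bar> \<le> g^2" by (simp add: power2_eq_square)
    ultimately have gK: "\<bar>g\<bar> \<le> K" by simp
    define h where "h = int (R'.ht (isog P))"
    have h: "\<bar>x\<bar> \<le> h" "\<bar>y\<bar> \<le> h" "h \<ge> 0" using H' by (auto simp: h_def)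
    have "\<bar>W\<bar> \<le> K * h" unfolding g(2) abs_mult using gK h K0 by (intro mult_mono) auto
    then have "\<bar>W\<bar>^2 \<le> (K * h)^2" by (intro power_mono) auto
    then have W2: "W^2 \<le> (K * h)^2" by simp
    have "\<bar>s * M * N\<bar> \<le> K * h" unfolding g(1) abs_mult using gK h K0 by (intro mult_mono) auto
    moreover have "1 * \<bar>M * N\<bar> \<le> \<bar>s\<bar> * \<bar>M * N\<bar>" using s0 by (intro mult_right_mono) auto
    ultimately have "\<bar>M * N\<bar> \<le> K * h" by (simp add: abs_mult mult_ac)
    then have "\<bar>M * N\<bar>^2 \<le> (K * h)^2" by (intro power_mono) auto
    then have MN2: "M^2 * N^2 \<le> (K * h)^2" by (simp add: power_mult_distrib)
    have "int (R.ht P)^4 \<le> N^4 + e * M^4"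
    proof -
      have "e \<ge> 1" using disc_pos by (simp add: e_def)
      then have "1 * M^4 \<le> e * M^4" by (intro mult_right_mono) auto
      moreover have "int (R.ht P)^4 = M^4 \<or> int (R.ht P)^4 = N^4" using H by (auto simp: max_def)
      moreover have "N^4 \<ge> 0" "M^4 \<ge> 0" by auto
      ultimately show ?thesis by linarith
    qed
    also have "\<dots> = W^2 + 2 * a * (M^2 * N^2)" unfolding W by (simp add: mult.assoc)
    also have "\<dots> \<le> W^2 + 2 * \<bar>a\<bar> * (M^2 * N^2)"
      by (intro add_left_mono mult_right_mono) auto
    also have "\<dots> \<le> (K * h)^2 + 2 * \<bar>a\<bar> * (K * h)^2"
      using W2 MN2 by (intro add_mono mult_left_mono) auto
    also have "\<dots> = C * h^2" by (simp add: C_def power_mult_distrib algebra_simps)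
    finally have "int (R.ht P)^4 \<le> C * h^2" .
    moreover have "C \<ge> 0" by (simp add: C_def)
    ultimately have "int ((R.ht P)^4) \<le> int (nat C * (R'.ht (isog P))^2)" by (simp add: h_def)
    then show ?thesis by (simp only: of_nat_le_iff)
  qed
  then show ?thesis by (rule that)
qed

end

section \<open>Torsion\<close>

text \<open>Since \<open>f\<close> increases at each doubling, the elements \<open>x [^] 2^j\<close>
  are pairwise distinct, whereas \<open>x [^] k = \<one>\<close> would leave only the finitely many
  powers with exponent \<open>2^j mod k\<close>.\<close>

lemma (in group) not_torsion_by_doubling:
  fixes f :: "'a \<Rightarrow> nat"
  assumes x: "x \<in> carrier G" "N x"
    and double: "\<And>y. \<lbrakk>y \<in> carrier G; N y\<rbrakk> \<Longrightarrow> N (y \<otimes> y) \<and> f (y \<otimes> y) = f y + 1"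
    and k: "k \<noteq> (0::int)"
  shows "x [^] k \<noteq> \<one>"
proof
  assume xk: "x [^] k = \<one>"
  define z where "z = (\<lambda>j::nat. x [^] ((2::int) ^ j))"
  have z: "N (z j) \<and> f (z j) = f x + j" for j
  proof (induction j)
    case (Suc j)
    have "z (Suc j) = z j \<otimes> z j" unfolding z_def using x(1) by (simp flip: int_pow_mult)
    then show ?case using double[of "z j"] Suc x(1) by (simp add: z_def)
  qed (use x in \<open>simp add: z_def\<close>)
  then have "inj z" by (metis add_left_cancel injI)
  moreover have "range z \<subseteq> (\<lambda>i. x [^] i) ` {- \<bar>k\<bar>..\<bar>k\<bar>}"
  proof
    fix y assume "y \<in> range z"
    then obtain j where y: "y = x [^] ((2::int) ^ j)" by (auto simp: z_def)
    have "x [^] (k * (2 ^ j div k)) = \<one>"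
      using int_pow_pow[of x k "2 ^ j div k"] x(1) xk by simp
    moreover have "x [^] ((2::int) ^ j) = x [^] (k * (2 ^ j div k)) \<otimes> x [^] (2 ^ j mod k)"
      by (subst int_pow_mult[OF x(1), symmetric]) simp
    ultimately have "y = x [^] (2 ^ j mod k)" unfolding y using x(1) by simp
    moreover have "2 ^ j mod k \<in> {- \<bar>k\<bar>..\<bar>k\<bar>}" using k abs_mod_less[of k "2 ^ j"] by auto
    ultimately show "y \<in> (\<lambda>i. x [^] i) ` {- \<bar>k\<bar>..\<bar>k\<bar>}" by blast
  qed
  then have "finite (range z)" by (rule finite_subset) simp
  ultimately show False using finite_imageD by blast
qed

context rational_curve
begin

text \<open>Numerator and denominator are coprime, so at most one is even and their product carries
  the absolute value of the 2-adic valuation of \<open>u\<close>, as a natural number.\<close>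

definition val2 :: "rat ec_point \<Rightarrow> nat" where
  "val2 P = (let (M, N) = quotient_of (fst (to_quartic P)) in multiplicity 2 (M * N))"

text \<open>Doubling multiplies \<open>u\<close> or \<open>1/u\<close> by \<open>2\<close> up to a \<open>2\<close>-adic unit.\<close>

lemma val2_double:
  assumes P: "P \<in> curve" and u0: "fst (to_quartic P) \<noteq> 0"
    and e: "odd (a^2 - 4 * b)"
    and not_odd: "\<And>M N W. \<lbrakk>odd M; odd N\<rbrakk> \<Longrightarrow> W^2 \<noteq> N^4 - 2 * a * M^2 * N^2 + (a^2 - 4 * b) * M^4"
  defines "P2 \<equiv> ec_add (of_int a) (of_int b) P P"
  shows "fst (to_quartic P2) \<noteq> 0 \<and> val2 P2 = val2 P + 1"
proof -
  define e where "e = a^2 - 4 * b"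
  obtain M N W where P1: "to_quartic P = (of_int M / of_int N, of_int W / of_int N^2)" "N > 0" "coprime M N"
    and W: "W^2 = N^4 - 2 * a * M^2 * N^2 + e * M^4"
    using integral_point[OF P] unfolding e_def by metis
  have M0: "M \<noteq> 0" using u0 P1 by auto
  have one_odd: "odd M \<noteq> odd N"
  proof
    assume *: "odd M = odd N"
    have "odd M \<or> odd N" using P1(3) by (metis coprime_common_divisor odd_one)
    then show False using * not_odd W unfolding e_def by blast
  qed
  \<comment> \<open>With exactly one of \<open>M\<close> and \<open>N\<close> even, both
    \<open>W\<close> and \<open>c\<close> are odd. The doubled point has
    \<open>u = 2*M*N*W/c\<close>; anything that cancels is odd, so exactly one factor 2 is
    gained.\<close>
  define c where "c = N^4 - e * M^4"
  have oddc: "odd c" using one_odd e by (auto simp: c_def e_def)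
  have "odd (W^2)" unfolding W using one_odd e by (auto simp: e_def)
  then have oddW: "odd W" by simp
  have W0: "W \<noteq> 0" and c0: "c \<noteq> 0" using oddW oddc by auto
  define B' where "B' = 2 * M * N * W"
  have D: "1 - d * (of_int M / of_int N)^2 * (of_int M / of_int N)^2 = of_int c / of_int N^4"
    using P1(2) by (simp add: c_def e_def d_def field_simps eval_nat_numeral)
  have "fst (to_quartic P2) = (of_int M / of_int N * (of_int W / of_int N^2) + of_int M / of_int N * (of_int W / of_int N^2))
      / (of_int c / of_int N^4)"
    unfolding P2_def to_quartic_hom[OF P P] P1(1) qadd.simps D by simp
  also have "\<dots> = of_int B' / of_int c"
    using P1(2) c0 by (simp add: B'_def field_simps eval_nat_numeral)
  finally have u2: "fst (to_quartic P2) = of_int B' / of_int c" .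
  obtain g x y where g: "B' = g * x" "c = g * y" "coprime x y" "g \<noteq> 0"
    "quotient_of (of_int B' / of_int c) = (x, y)"
    by (rule quotient_gcd[OF c0, of B'])
  have og: "odd g" "odd y" using oddc g(2) by auto
  have B0: "B' \<noteq> 0" using M0 P1(2) W0 by (simp add: B'_def)
  then have x0: "x \<noteq> 0" and y0: "y \<noteq> 0" using g(1) og by auto
  have two: "prime_elem (2::int)" by simp
  have m0: "multiplicity 2 n = 0" if "odd n" for n :: int
    using that by (simp add: not_dvd_imp_multiplicity_0)
  have mm: "multiplicity 2 (i * j) = multiplicity 2 i + multiplicity 2 j" if "i \<noteq> 0" "j \<noteq> 0" for i j :: int
    using that prime_elem_multiplicity_mult_distrib[OF two] by blast
  have "val2 P2 = multiplicity 2 (x * y)" unfolding val2_def u2 g(5) by simp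
  also have "\<dots> = multiplicity 2 B'" unfolding g(1) using mm x0 y0 g(4) m0 og by simp
  also have "\<dots> = multiplicity 2 ((2 * W) * (M * N))" by (simp add: B'_def mult_ac)
  also have "\<dots> = multiplicity 2 (2 * W) + multiplicity 2 (M * N)"
    by (rule mm) (use W0 M0 P1(2) in auto)
  also have "multiplicity 2 (2 * W) = 1" using mm[of 2 W] W0 m0[OF oddW] by simp
  also have "multiplicity 2 (M * N) = val2 P"
    unfolding val2_def P1(1) fst_conv quotient_of_eq[OF P1(2,3)] by simp
  finally have "val2 P2 = val2 P + 1" by simp
  moreover have "fst (to_quartic P2) \<noteq> 0" unfolding u2 using B0 c0 by simp
  ultimately show ?thesis by blast
qed

end

section \<open>Two-descent\<close>

definition nonzero_square :: "rat \<Rightarrow> bool" where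
  "nonzero_square x \<longleftrightarrow> (\<exists>r. r \<noteq> 0 \<and> x = r^2)"

lemma nonzero_square_power2: "r \<noteq> 0 \<Longrightarrow> nonzero_square (r^2)"
  by (auto simp: nonzero_square_def)

lemma nonzero_square_mult: "nonzero_square x \<Longrightarrow> nonzero_square y \<Longrightarrow> nonzero_square (x * y)"
  unfolding nonzero_square_def by (metis mult_eq_0_iff power_mult_distrib)

lemma nonzero_square_cancel:
  assumes "nonzero_square (x * y)" "nonzero_square y" shows "nonzero_square x"
proof -
  obtain r s where "r \<noteq> 0" "x * y = r^2" "s \<noteq> 0" "y = s^2" using assms by (auto simp: nonzero_square_def)
  then have "x = (r/s)^2" "r/s \<noteq> 0" by (auto simp: power_divide field_simps)
  then show ?thesis unfolding nonzero_square_def by blast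
qed

lemma prime_product_nonsquare:
  fixes p q c :: int and r :: rat
  assumes "prime p" "prime q" "p \<noteq> q" "c \<noteq> 0"
  shows "r^2 \<noteq> of_int (c^2 * p * q)"
proof
  assume *: "r^2 = of_int (c^2 * p * q)"
  then have "(r / of_int c)^2 = of_int (p * q)" using assms(4) by (simp add: power_divide)
  then obtain k where k: "r / of_int c = of_int k" using rat_square_int by blast
  with \<open>(r / of_int c)^2 = of_int (p * q)\<close> have "of_int (k^2) = (of_int (p * q) :: rat)" by simp
  then have k2: "k^2 = p * q" by (simp only: of_int_eq_iff)
  then have "p dvd k^2" by simp
  then have "p dvd k" using assms(1) prime_dvd_power by blast
  then obtain l where "k = p * l" by (rule dvdE)
  then have "p * (p * l^2) = p * q" using k2 by (simp add: power2_eq_square mult_ac)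
  then have "p * l^2 = q" using assms(1) by auto
  then have "p dvd q" by auto
  then show False using assms primes_dvd_imp_eq by blast
qed

lemma prime_nonsquare:
  fixes p :: int and r :: rat
  assumes "prime p" shows "r^2 \<noteq> of_int p"
proof
  assume *: "r^2 = of_int p"
  then obtain k where k: "r = of_int k" using rat_square_int by blast
  then have "of_int (k^2) = (of_int p :: rat)" using * by simp
  then have k2: "k^2 = p" by (simp only: of_int_eq_iff)
  then have "p dvd k" using assms prime_dvd_power[of p k 2] by simp
  then obtain l where "k = p * l" by (rule dvdE)
  then have "p * (p * l^2) = p * 1" using k2 by (simp add: power2_eq_square mult_ac)
  then have "p * l^2 = 1" using assms by auto
  then have "p dvd 1" by (metis dvd_triv_left)
  then show False using assms not_prime_unit by blast
qed

text \<open>Square classes are listed through known points and not through numbers: adding such a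
  point makes the class of \<open>P\<close> a square, and \<open>isog_image\<close> then provides a
  preimage. The conditions on \<open>P1\<close> and \<open>R\<close> exclude the classes of
  \<open>Infinity\<close> and of the point of order two.\<close>

locale two_descent =
  dual_isogenies A B A' B' s s' for A B A' B' s s' :: rat +
  fixes P1 R :: "rat ec_point" and ht ht' :: "rat ec_point \<Rightarrow> nat"
  assumes P1_on: "P1 \<in> phi.E.curve" and R_on: "R \<in> phi.E'.curve"
    and classes: "P \<in> phi.E.curve \<Longrightarrow> \<exists>K\<in>{Infinity, phi.E.T, P1, ec_add A B phi.E.T P1}.
      nonzero_square (phi.E.descent P * phi.E.descent K)"
    and classes': "Q \<in> phi.E'.curve \<Longrightarrow> \<exists>K\<in>{Infinity, phi.E'.T, R, ec_add A' B' phi.E'.T R}.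
      nonzero_square (phi.E'.descent Q * phi.E'.descent K)"
    and P1_class: "\<not> nonzero_square (phi.E.descent P1)" "\<not> nonzero_square (phi.E.descent P1 * B)"
    and R_class: "\<not> nonzero_square (phi.E'.descent R)" "\<not> nonzero_square (phi.E'.descent R * B')"
    and finite_ht: "finite {P \<in> phi.E.curve. ht P \<le> c}"
    and ht_add: "Q \<in> phi.E.curve \<Longrightarrow> \<exists>C. \<forall>P\<in>phi.E.curve. ht (ec_add A B P Q) \<le> C * (ht P)^2"
    and ht_phi: "\<exists>C. \<forall>P\<in>phi.E.curve. (ht P)^4 \<le> C * (ht' (phi.isog P))^2"
    and ht_psi: "\<exists>C. \<forall>Q\<in>phi.E'.curve. (ht' Q)^4 \<le> C * (ht (psi.isog Q))^2"
begin

abbreviation G where "G \<equiv> ec_group A B 0"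

lemma carrier_G: "carrier G = phi.E.curve" and mult_G: "P \<otimes>\<^bsub>G\<^esub> Q = ec_add A B P Q" and one_G: "\<one>\<^bsub>G\<^esub> = Infinity"
  by (simp_all add: ec_group_def)

sublocale G: comm_group_involution G phi.E.T
proof -
  interpret comm_group G by (rule phi.E.ec_comm_group)
  show "comm_group_involution G phi.E.T"
    by unfold_locales (simp_all add: carrier_G mult_G one_G)
qed

section \<open>Generators modulo doubling\<close>

lemma descent_add_square:
  assumes "P \<in> phi.E.curve" "Q \<in> phi.E.curve"
  shows "nonzero_square (phi.E.descent (ec_add A B P Q) * (phi.E.descent P * phi.E.descent Q))"
  by (metis phi.E.descent_add[OF assms] nonzero_square_power2)

lemma descent_add_square':
  assumes "P \<in> phi.E'.curve" "Q \<in> phi.E'.curve"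
  shows "nonzero_square (phi.E'.descent (ec_add A' B' P Q) * (phi.E'.descent P * phi.E'.descent Q))"
  by (metis phi.E'.descent_add[OF assms] nonzero_square_power2)

abbreviation P2 where "P2 \<equiv> psi.isog R"

lemma P2_on: "P2 \<in> phi.E.curve"
  by (rule psi.isog_closed[OF R_on])

lemma descent_P2: "nonzero_square (phi.E.descent P2)"
  by (metis psi.descent_isog[OF R_on] nonzero_square_power2)

text \<open>Descent in two stages. A known point \<open>K\<close> makes
  \<open>P + K = psi Q\<close>, and a known point \<open>K'\<close> on the other curve makes
  \<open>Q + K' = phi h\<close>; applying \<open>psi\<close> gives
  \<open>P + K + psi K' = 2 h\<close>. As \<open>psi\<close> kills the point of order two,
  \<open>psi K'\<close> is \<open>Infinity\<close> or \<open>P2\<close>, while the part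
  \<open>t\<close> of \<open>K\<close> is absorbed into \<open>squares\<close>.\<close>

lemma span:
  assumes P: "P \<in> phi.E.curve"
  shows "\<exists>x\<in>{\<one>\<^bsub>G\<^esub>, P1}. \<exists>y\<in>{\<one>\<^bsub>G\<^esub>, P2}. P \<otimes>\<^bsub>G\<^esub> (x \<otimes>\<^bsub>G\<^esub> y) \<in> G.squares"
proof -
  have on: "phi.E.T \<in> phi.E.curve" "phi.E'.T \<in> phi.E'.curve" by simp_all
  obtain K where K: "K \<in> {Infinity, phi.E.T, P1, ec_add A B phi.E.T P1}"
    and "nonzero_square (phi.E.descent P * phi.E.descent K)" using classes[OF P] by blast
  obtain t x where tx: "t = \<one>\<^bsub>G\<^esub> \<or> t = phi.E.T" "x \<in> {\<one>\<^bsub>G\<^esub>, P1}" "K = t \<otimes>\<^bsub>G\<^esub> x"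
  proof -
    from K consider "K = Infinity" | "K = phi.E.T" | "K = P1" | "K = ec_add A B phi.E.T P1" by blast
    then show ?thesis
    proof cases
      case 1 then show ?thesis using that[of "\<one>\<^bsub>G\<^esub>" "\<one>\<^bsub>G\<^esub>"] by (simp add: mult_G one_G)
    next
      case 2 then show ?thesis using that[of phi.E.T "\<one>\<^bsub>G\<^esub>"] by (simp add: mult_G one_G)
    next
      case 3 then show ?thesis using that[of "\<one>\<^bsub>G\<^esub>" P1] by (simp add: mult_G one_G)
    next
      case 4 then show ?thesis using that[of phi.E.T P1] by (simp add: mult_G one_G)
    qed
  qed
  have t_on: "t \<in> carrier G" and x_on: "x \<in> carrier G" using tx P1_on on by (auto simp: carrier_G one_G)
  have K_on: "K \<in> phi.E.curve" using tx(3) t_on x_on by (metis G.m_closed carrier_G)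
  have PK: "ec_add A B P K \<in> phi.E.curve" using phi.E.ec_add_closed[OF P K_on] .
  have "nonzero_square (phi.E.descent (ec_add A B P K))"
    using nonzero_square_cancel[OF descent_add_square[OF P K_on]]
      \<open>nonzero_square (phi.E.descent P * phi.E.descent K)\<close> .
  then obtain w where "phi.E.descent (ec_add A B P K) = w^2" by (auto simp: nonzero_square_def)
  then obtain Q where Q: "Q \<in> phi.E'.curve" "psi.isog Q = ec_add A B P K"
    using psi.isog_image[OF PK] by metis
  obtain K' where K': "K' \<in> {Infinity, phi.E'.T, R, ec_add A' B' phi.E'.T R}"
    and sq': "nonzero_square (phi.E'.descent Q * phi.E'.descent K')" using classes'[OF Q(1)] by blast
  have K'_on: "K' \<in> phi.E'.curve" using K' R_on on phi.E'.ec_add_closed by auto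
  have psi_K': "psi.isog K' \<in> {\<one>\<^bsub>G\<^esub>, P2}"
    using K' psi.isog_add[OF on(2) R_on] by (auto simp: one_G)
  have "nonzero_square (phi.E'.descent (ec_add A' B' Q K'))"
    using nonzero_square_cancel[OF descent_add_square'[OF Q(1) K'_on] sq'] .
  then obtain w' where "phi.E'.descent (ec_add A' B' Q K') = w'^2" by (auto simp: nonzero_square_def)
  then obtain h where h: "h \<in> phi.E.curve" "phi.isog h = ec_add A' B' Q K'"
    using phi.isog_image[OF phi.E'.ec_add_closed[OF Q(1) K'_on]] by metis
  have h_on: "h \<in> carrier G" and P_on: "P \<in> carrier G" using h(1) P by (simp_all add: carrier_G)
  define y where "y = psi.isog K'"
  have y_on: "y \<in> carrier G" using psi_K' P2_on y_def by (auto simp: carrier_G one_G)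
  have "P \<otimes>\<^bsub>G\<^esub> K \<otimes>\<^bsub>G\<^esub> y = h \<otimes>\<^bsub>G\<^esub> h"
    using psi.isog_add[OF Q(1) K'_on] psi_phi[OF h(1)] by (simp add: mult_G y_def h(2) Q(2))
  then have "t \<otimes>\<^bsub>G\<^esub> (h \<otimes>\<^bsub>G\<^esub> h) = t \<otimes>\<^bsub>G\<^esub> (P \<otimes>\<^bsub>G\<^esub> (t \<otimes>\<^bsub>G\<^esub> x) \<otimes>\<^bsub>G\<^esub> y)"
    unfolding tx(3) by simp
  also have "\<dots> = (t \<otimes>\<^bsub>G\<^esub> t) \<otimes>\<^bsub>G\<^esub> (P \<otimes>\<^bsub>G\<^esub> (x \<otimes>\<^bsub>G\<^esub> y))"
    using t_on x_on y_on P_on by (simp add: G.m_ac)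
  also have "t \<otimes>\<^bsub>G\<^esub> t = \<one>\<^bsub>G\<^esub>" using tx(1) G.T_square by auto
  finally have "P \<otimes>\<^bsub>G\<^esub> (x \<otimes>\<^bsub>G\<^esub> y) = t \<otimes>\<^bsub>G\<^esub> (h \<otimes>\<^bsub>G\<^esub> h)"
    using P_on x_on y_on by simp
  then have "P \<otimes>\<^bsub>G\<^esub> (x \<otimes>\<^bsub>G\<^esub> y) \<in> G.squares" using G.squaresI[OF h_on tx(1)] by simp
  then show ?thesis using tx(2) psi_K' y_def by blast
qed

lemma descent_squares:
  assumes "P \<in> G.squares"
  shows "nonzero_square (phi.E.descent P) \<or> nonzero_square (phi.E.descent P * B)"
proof -
  obtain t h where th: "t = \<one>\<^bsub>G\<^esub> \<or> t = phi.E.T" "h \<in> phi.E.curve" "P = t \<otimes>\<^bsub>G\<^esub> (h \<otimes>\<^bsub>G\<^esub> h)"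
    using assms by (elim G.squaresE) (auto simp: carrier_G)
  define D where "D = ec_add A B h h"
  have D_on: "D \<in> phi.E.curve" unfolding D_def by (intro phi.E.ec_add_closed th)
  have "nonzero_square (phi.E.descent h * phi.E.descent h)"
    using nonzero_square_power2[OF phi.E.descent_nonzero, of h] by (simp add: power2_eq_square)
  then have D_sq: "nonzero_square (phi.E.descent D)"
    unfolding D_def using descent_add_square[OF th(2) th(2)] nonzero_square_cancel by blast
  show ?thesis
  proof (cases "t = \<one>\<^bsub>G\<^esub>")
    case True
    then have "P = D" using th(3) by (simp add: mult_G one_G D_def)
    then show ?thesis using D_sq by simp
  next
    case False
    then have P: "P = ec_add A B phi.E.T D" using th by (simp add: mult_G D_def)
    have "nonzero_square (phi.E.descent P * B * phi.E.descent D)"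
      using descent_add_square[OF phi.E.T_on D_on] by (simp add: P mult.assoc)
    then show ?thesis using D_sq nonzero_square_cancel by blast
  qed
qed

lemma P1_not_square: "P1 \<notin> G.squares"
  using descent_squares P1_class by blast

text \<open>The class of \<open>P2\<close> is trivial on the first curve, so the sum has the class
  of \<open>P1\<close>.\<close>

lemma P1_P2_not_square: "P1 \<otimes>\<^bsub>G\<^esub> P2 \<notin> G.squares"
proof
  let ?D = "phi.E.descent (P1 \<otimes>\<^bsub>G\<^esub> P2)"
  assume "P1 \<otimes>\<^bsub>G\<^esub> P2 \<in> G.squares"
  then have sq: "nonzero_square ?D \<or> nonzero_square (?D * B)" by (rule descent_squares)
  have "nonzero_square (?D * (phi.E.descent P1 * phi.E.descent P2))"
    unfolding mult_G by (rule descent_add_square[OF P1_on P2_on])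
  then have D1: "nonzero_square (?D * phi.E.descent P1)"
    using nonzero_square_cancel[OF _ descent_P2] by (simp add: mult.assoc)
  from sq show False
  proof
    assume "nonzero_square ?D"
    then show False using D1 nonzero_square_cancel[of "phi.E.descent P1" ?D] P1_class by (simp add: mult.commute)
  next
    assume "nonzero_square (?D * B)"
    then have "nonzero_square ((?D * B) * (?D * phi.E.descent P1))" using D1 by (rule nonzero_square_mult)
    then have "nonzero_square ((phi.E.descent P1 * B) * ?D^2)" by (simp add: power2_eq_square mult_ac)
    then have "nonzero_square (phi.E.descent P1 * B)"
      using nonzero_square_cancel nonzero_square_power2[OF phi.E.descent_nonzero] by blast
    then show False using P1_class by simp
  qed
qed

text \<open>The classes on the first curve do not separate \<open>P2\<close> from zero, so the
  argument moves to the other curve. Writing \<open>P2 = t + 2 h\<close>, the case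
  \<open>t = T\<close> would make \<open>B\<close> a square. Otherwise
  \<open>psi R = psi (phi h)\<close>, so \<open>R - phi h\<close> lies in the kernel of
  \<open>psi\<close>; as \<open>phi h\<close> has trivial class, \<open>R\<close> would have class 1
  or \<open>B'\<close>.\<close>

lemma P2_not_square: "P2 \<notin> G.squares"
proof
  assume "P2 \<in> G.squares"
  then obtain t h where th: "t = \<one>\<^bsub>G\<^esub> \<or> t = phi.E.T" "h \<in> phi.E.curve" "P2 = t \<otimes>\<^bsub>G\<^esub> (h \<otimes>\<^bsub>G\<^esub> h)"
    by (elim G.squaresE) (auto simp: carrier_G)
  define D where "D = ec_add A B h h"
  have D_on: "D \<in> phi.E.curve" unfolding D_def by (intro phi.E.ec_add_closed th)
  have D: "D = psi.isog (phi.isog h)" unfolding D_def using psi_phi[OF th(2)] by simp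
  have D_sq: "nonzero_square (phi.E.descent D)"
    unfolding D by (metis psi.descent_isog[OF phi.isog_closed[OF th(2)]] nonzero_square_power2)
  have "t = \<one>\<^bsub>G\<^esub>"
  proof (rule ccontr)
    assume "t \<noteq> \<one>\<^bsub>G\<^esub>"
    then have P2: "P2 = ec_add A B phi.E.T D" using th by (simp add: mult_G D_def)
    have "nonzero_square (phi.E.descent P2 * B * phi.E.descent D)"
      using descent_add_square[OF phi.E.T_on D_on] by (simp add: P2 mult.assoc)
    then have "nonzero_square (phi.E.descent P2 * B)" using D_sq nonzero_square_cancel by blast
    then have "nonzero_square B"
      using nonzero_square_cancel[of B "phi.E.descent P2"] descent_P2 by (simp add: mult.commute)
    then show False using phi.E.B_nonsquare by (auto simp: nonzero_square_def)
  qed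
  then have P2: "P2 = D" using th(3) by (simp add: mult_G one_G D_def)
  define N where "N = phi.isog (phi.E.ec_neg h)"
  have h': "phi.E.ec_neg h \<in> phi.E.curve" by (rule phi.E.ec_neg_closed[OF th(2)])
  have N_on: "N \<in> phi.E'.curve" unfolding N_def by (rule phi.isog_closed[OF h'])
  have N_sq: "nonzero_square (phi.E'.descent N)"
    unfolding N_def by (metis phi.descent_isog[OF h'] nonzero_square_power2)
  have "phi.isog h \<in> phi.E'.curve" by (rule phi.isog_closed[OF th(2)])
  then have "psi.isog (ec_add A' B' R N) = psi.isog (ec_add A' B' (phi.isog h) N)"
    using psi.isog_add[OF R_on N_on] psi.isog_add[of "phi.isog h" N] N_on P2 D by simp
  also have "ec_add A' B' (phi.isog h) N = phi.isog (ec_add A B h (phi.E.ec_neg h))"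
    unfolding N_def by (rule phi.isog_add[OF th(2) h', symmetric])
  also have "ec_add A B h (phi.E.ec_neg h) = Infinity" by (cases h) simp_all
  finally have "psi.isog (ec_add A' B' R N) = Infinity" by simp
  then have "ec_add A' B' R N = Infinity \<or> ec_add A' B' R N = phi.E'.T"
    using psi.isog_kernel phi.E'.ec_add_closed[OF R_on N_on] by blast
  moreover have "nonzero_square (phi.E'.descent (ec_add A' B' R N) * phi.E'.descent R * phi.E'.descent N)"
    using descent_add_square'[OF R_on N_on] by (simp add: mult.assoc)
  then have "nonzero_square (phi.E'.descent (ec_add A' B' R N) * phi.E'.descent R)"
    using N_sq nonzero_square_cancel by blast
  ultimately show False using R_class by (auto simp: mult.commute)
qed

text \<open>Doubling raises the height at least to the fourth power up to a constant, by the bounds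
  for the two isogenies, while translation by a fixed point at most squares it. With
  \<open>2 h = P - r\<close> this gives \<open>(ht h)^4 \<le> const * (ht P)^2\<close>, whose square
  root is the bound required by \<open>G.gens_by_descent\<close>.\<close>

lemma finitely_generated: "\<exists>(I::nat set) g. G.gens I g"
proof -
  obtain C1 where C1: "\<And>P. P \<in> phi.E.curve \<Longrightarrow> (ht P)^4 \<le> C1 * (ht' (phi.isog P))^2"
    using ht_phi by blast
  obtain C2 where C2: "\<And>Q. Q \<in> phi.E'.curve \<Longrightarrow> (ht' Q)^4 \<le> C2 * (ht (psi.isog Q))^2"
    using ht_psi by blast
  \<comment> \<open>Replacing a constant by its larger square makes both sides squares, so roots can
    be taken within the naturals.\<close>
  have nat_sq: "k \<le> k^2" for k :: nat by (cases k) (auto simp: power2_eq_square)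
  have dbl: "(ht h)^4 \<le> C1^2 * C2 * ht (h \<otimes>\<^bsub>G\<^esub> h)" if h: "h \<in> phi.E.curve" for h
  proof -
    have "((ht h)^4)^2 \<le> (C1 * (ht' (phi.isog h))^2)^2" using C1[OF h] by (rule power_mono) simp
    also have "\<dots> = C1^2 * (ht' (phi.isog h))^4" by (simp add: power_mult_distrib)
    also have "\<dots> \<le> C1^2 * (C2 * (ht (psi.isog (phi.isog h)))^2)"
      using C2[OF phi.isog_closed[OF h]] by (rule mult_left_mono) simp
    also have "\<dots> = (C1^2 * C2) * (ht (h \<otimes>\<^bsub>G\<^esub> h))^2" by (simp add: psi_phi[OF h] mult_G)
    also have "\<dots> \<le> (C1^2 * C2)^2 * (ht (h \<otimes>\<^bsub>G\<^esub> h))^2" by (intro mult_right_mono nat_sq) simp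
    also have "\<dots> = (C1^2 * C2 * ht (h \<otimes>\<^bsub>G\<^esub> h))^2" by (simp add: power_mult_distrib)
    finally show ?thesis by (rule power2_le_imp_le) simp
  qed
  \<comment> \<open>The form of these remainders comes from \<open>span\<close>:
    \<open>P + (x + y) = t + 2 h\<close> means \<open>P = (t - (x + y)) + 2 h\<close>.\<close>
  define Rs where "Rs = (\<lambda>(t, x, y). t \<otimes>\<^bsub>G\<^esub> inv\<^bsub>G\<^esub> (x \<otimes>\<^bsub>G\<^esub> y)) `
    ({\<one>\<^bsub>G\<^esub>, phi.E.T} \<times> {\<one>\<^bsub>G\<^esub>, P1} \<times> {\<one>\<^bsub>G\<^esub>, P2})"
  have on: "phi.E.T \<in> carrier G" "P1 \<in> carrier G" "P2 \<in> carrier G"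
    using P1_on P2_on by (simp_all add: carrier_G)
  have Rs: "finite Rs" "Rs \<subseteq> carrier G" using on by (auto simp: Rs_def)
  have "\<exists>C. \<forall>P\<in>phi.E.curve. ht (P \<otimes>\<^bsub>G\<^esub> inv\<^bsub>G\<^esub> r) \<le> C * (ht P)^2" if r: "r \<in> Rs" for r
  proof -
    have "inv\<^bsub>G\<^esub> r \<in> phi.E.curve" using r Rs(2) by (metis G.inv_closed carrier_G subsetD)
    then show ?thesis unfolding mult_G by (rule ht_add)
  qed
  then obtain D where D: "\<And>r P. \<lbrakk>r \<in> Rs; P \<in> phi.E.curve\<rbrakk> \<Longrightarrow> ht (P \<otimes>\<^bsub>G\<^esub> inv\<^bsub>G\<^esub> r) \<le> D r * (ht P)^2"
    by metis
  define C where "C = C1^2 * C2 * sum D Rs"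
  show ?thesis
  proof (rule G.gens_by_descent[OF Rs])
    show "finite {P \<in> carrier G. ht P \<le> C}" unfolding carrier_G by (rule finite_ht)
    fix P assume P: "P \<in> carrier G"
    then obtain x y where xy: "x \<in> {\<one>\<^bsub>G\<^esub>, P1}" "y \<in> {\<one>\<^bsub>G\<^esub>, P2}" "P \<otimes>\<^bsub>G\<^esub> (x \<otimes>\<^bsub>G\<^esub> y) \<in> G.squares"
      using span unfolding carrier_G by blast
    obtain t h where th: "t = \<one>\<^bsub>G\<^esub> \<or> t = phi.E.T" "t \<in> carrier G" "h \<in> carrier G"
      "P \<otimes>\<^bsub>G\<^esub> (x \<otimes>\<^bsub>G\<^esub> y) = t \<otimes>\<^bsub>G\<^esub> (h \<otimes>\<^bsub>G\<^esub> h)"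
      using xy(3) by (rule G.squaresE)
    define r where "r = t \<otimes>\<^bsub>G\<^esub> inv\<^bsub>G\<^esub> (x \<otimes>\<^bsub>G\<^esub> y)"
    have r: "r \<in> Rs" using th(1) xy(1,2) unfolding Rs_def r_def by force
    have xy_on: "x \<otimes>\<^bsub>G\<^esub> y \<in> carrier G" using xy on by auto
    have r_on: "r \<in> carrier G" using r Rs by blast
    have "P = (t \<otimes>\<^bsub>G\<^esub> (h \<otimes>\<^bsub>G\<^esub> h)) \<otimes>\<^bsub>G\<^esub> inv\<^bsub>G\<^esub> (x \<otimes>\<^bsub>G\<^esub> y)"
      using th(4) P xy_on th(2,3) by (metis G.inv_solve_right G.m_closed)
    also have "\<dots> = r \<otimes>\<^bsub>G\<^esub> (h \<otimes>\<^bsub>G\<^esub> h)"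
      unfolding r_def using th(2,3) xy_on G.inv_closed[OF xy_on] by (simp only: G.m_ac G.m_closed)
    finally have Pr: "P = r \<otimes>\<^bsub>G\<^esub> (h \<otimes>\<^bsub>G\<^esub> h)" .
    then have hh: "h \<otimes>\<^bsub>G\<^esub> h = P \<otimes>\<^bsub>G\<^esub> inv\<^bsub>G\<^esub> r"
      using th(3) r_on P by (metis G.inv_solve_right G.m_closed G.m_comm)
    have "((ht h)^2)^2 \<le> C1^2 * C2 * ht (h \<otimes>\<^bsub>G\<^esub> h)" using dbl[of h] th(3) by (simp add: carrier_G)
    also have "\<dots> \<le> C1^2 * C2 * (D r * (ht P)^2)"
      unfolding hh using D[OF r, of P] P by (intro mult_left_mono) (simp_all add: carrier_G)
    also have "\<dots> \<le> C1^2 * C2 * (sum D Rs * (ht P)^2)"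
      using member_le_sum[OF r _ Rs(1), of D] by (intro mult_left_mono mult_right_mono) simp_all
    also have "\<dots> = C * (ht P)^2" by (simp add: C_def mult.assoc)
    also have "\<dots> \<le> C^2 * (ht P)^2" by (intro mult_right_mono nat_sq) simp
    also have "\<dots> = (C * ht P)^2" by (simp add: power_mult_distrib)
    finally have "(ht h)^2 \<le> C * ht P" by (rule power2_le_imp_le) simp
    then show "\<exists>r\<in>Rs. \<exists>h\<in>carrier G. P = r \<otimes>\<^bsub>G\<^esub> (h \<otimes>\<^bsub>G\<^esub> h) \<and> (ht h)^2 \<le> C * ht P"
      using r th(3) Pr by blast
  qed
qed

theorem iso_if_torsion:
  assumes "\<And>P k. \<lbrakk>P \<in> phi.E.curve; P \<noteq> Infinity; P \<noteq> phi.E.T; k \<noteq> (0::int)\<rbrakk> \<Longrightarrow> P [^]\<^bsub>G\<^esub> k \<noteq> \<one>\<^bsub>G\<^esub>"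
  shows "G \<cong> integer_mod_group 2 \<times>\<times> (integer_group \<times>\<times> integer_group)"
proof -
  obtain I :: "nat set" and g where "G.gens I g" using finitely_generated by blast
  then show ?thesis
  proof (rule G.iso_Z2_Z_Z[rotated])
    show "P1 \<in> carrier G" "P2 \<in> carrier G" using P1_on P2_on by (simp_all add: carrier_G)
    then have "x \<in> G.squares \<or> x \<otimes>\<^bsub>G\<^esub> P1 \<in> G.squares \<or> x \<otimes>\<^bsub>G\<^esub> P2 \<in> G.squares \<or>
        x \<otimes>\<^bsub>G\<^esub> (P1 \<otimes>\<^bsub>G\<^esub> P2) \<in> G.squares" if x: "x \<in> carrier G" for x
      using span[of x] x unfolding carrier_G[symmetric] by auto
    then show "\<And>x. x \<in> carrier G \<Longrightarrow> x \<in> G.squares \<or> x \<otimes>\<^bsub>G\<^esub> P1 \<in> G.squares \<or> x \<otimes>\<^bsub>G\<^esub> P2 \<in> G.squares \<or>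
        x \<otimes>\<^bsub>G\<^esub> (P1 \<otimes>\<^bsub>G\<^esub> P2) \<in> G.squares" .
    show "\<forall>x\<in>carrier G. \<forall>k::int. k \<noteq> 0 \<longrightarrow> x [^]\<^bsub>G\<^esub> k = \<one>\<^bsub>G\<^esub> \<longrightarrow> x = \<one>\<^bsub>G\<^esub> \<or> x = phi.E.T"
      using assms unfolding carrier_G one_G by blast
  qed (rule P1_not_square P2_not_square P1_P2_not_square)+
qed

end

section \<open>The family of curves\<close>

locale prime_triple =
  fixes m p q n :: int
  assumes m_prime: "prime m" and p_prime: "prime p" and q_prime: "prime q"
    and m_mod: "m mod 24 = 11" and p_mod: "p mod 24 = 11" and q_mod: "q mod 24 = 11"
    and p_eq: "p = m + 16 * n^2" and q_eq: "q = m + 25 * n^2" and n_nonzero: "n \<noteq> 0"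
begin

text \<open>Distinct primes keep \<open>4 * p * q\<close> and \<open>9 * m * p\<close> from being
  squares, as the curve locales demand.\<close>

lemma distinct: "p \<noteq> q" "m \<noteq> p"
  using p_eq q_eq n_nonzero by auto

lemma positive: "m > 0" "p > 0" "q > 0"
  using m_prime p_prime q_prime prime_gt_0_int by auto

lemma relation: "25 * p - 9 * m = 16 * q"
  using p_eq q_eq by simp

lemma disc_E: "(- 5 * p)^2 - 4 * (4 * p * q) = 3^2 * m * p"
proof -
  have "(- 5 * p)^2 - 4 * (4 * p * q) = p * (25 * p - 16 * q)" by (simp add: power2_eq_square algebra_simps)
  also have "25 * p - 16 * q = 9 * m" using relation by simp
  finally show ?thesis by simp
qed

lemma disc_E': "(10 * p)^2 - 4 * (9 * m * p) = 8^2 * p * q"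
proof -
  have "(10 * p)^2 - 4 * (9 * m * p) = 4 * p * (25 * p - 9 * m)" by (simp add: power2_eq_square algebra_simps)
  then show ?thesis unfolding relation by simp
qed

abbreviation A where "A \<equiv> of_int (- 5 * p) :: rat"
abbreviation B where "B \<equiv> of_int (4 * p * q) :: rat"
abbreviation A' where "A' \<equiv> of_int (10 * p) :: rat"
abbreviation B' where "B' \<equiv> of_int (9 * m * p) :: rat"

lemma curve_E: "two_torsion_curve A B"
proof
  fix r :: rat
  show "r^2 \<noteq> B"
    using prime_product_nonsquare[OF p_prime q_prime distinct(1), of 2 r] by simp
  have "A^2 - 4 * B = of_int ((- 5 * p)^2 - 4 * (4 * p * q))" by simp
  then show "r^2 \<noteq> A^2 - 4 * B"
    using prime_product_nonsquare[OF m_prime p_prime distinct(2), of 3 r] unfolding disc_E by simp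
qed

lemma curve_E': "two_torsion_curve A' B'"
proof
  fix r :: rat
  show "r^2 \<noteq> B'"
    using prime_product_nonsquare[OF m_prime p_prime distinct(2), of 3 r] by simp
  have "A'^2 - 4 * B' = of_int ((10 * p)^2 - 4 * (9 * m * p))" by simp
  then show "r^2 \<noteq> A'^2 - 4 * B'"
    using prime_product_nonsquare[OF p_prime q_prime distinct(1), of 8 r] unfolding disc_E' by simp
qed

lemma phi_isogeny: "rational_isogeny (- 5 * p) (4 * p * q) (10 * p) (9 * m * p) 1"
proof -
  interpret E: two_torsion_curve A B by (rule curve_E)
  interpret E': two_torsion_curve A' B' by (rule curve_E')
  show ?thesis
  proof
    have "B' * of_int 1^4 = of_int ((- 5 * p)^2 - 4 * (4 * p * q))" unfolding disc_E by simp
    then show "B' * of_int 1^4 = A^2 - 4 * B" by simp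
    show "0 < (- 5 * p)^2 - 4 * (4 * p * q)" unfolding disc_E using positive by simp
  qed simp_all
qed

lemma psi_isogeny: "rational_isogeny (10 * p) (9 * m * p) (- 5 * p) (4 * p * q) 2"
proof -
  interpret E: two_torsion_curve A B by (rule curve_E)
  interpret E': two_torsion_curve A' B' by (rule curve_E')
  show ?thesis
  proof
    have "B * of_int 2^4 = of_int ((10 * p)^2 - 4 * (9 * m * p))" unfolding disc_E' by simp
    then show "B * of_int 2^4 = A'^2 - 4 * B'" by simp
    show "0 < (10 * p)^2 - 4 * (9 * m * p)" unfolding disc_E' using positive by simp
  qed simp_all
qed

sublocale phi: rational_isogeny "- 5 * p" "4 * p * q" "10 * p" "9 * m * p" 1 by (rule phi_isogeny)
sublocale psi: rational_isogeny "10 * p" "9 * m * p" "- 5 * p" "4 * p * q" 2 by (rule psi_isogeny)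
sublocale dual: dual_isogenies A B A' B' "of_int 1" "of_int 2"
  by unfold_locales simp

text \<open>At \<open>x = p\<close> the cubic takes the value \<open>4 * p^2 * (q - p)\<close> with
  \<open>q - p = 9 * n^2\<close>. At \<open>x = -m\<close> the cubic of the isogenous curve takes
  the value \<open>m^2 * (p - m)\<close> with \<open>p - m = 16 * n^2\<close>; this is the origin of
  \<open>R\<close>.\<close>

abbreviation P1 where "P1 \<equiv> Affine (of_int p) (of_int (6 * p * n)) :: rat ec_point"
abbreviation R where "R \<equiv> Affine (of_int (- m)) (of_int (4 * m * n)) :: rat ec_point"
lemma P1_on: "P1 \<in> phi.E.curve"
proof -
  have "(6 * p * n)^2 = p^3 + (- 5 * p) * p^2 + 4 * p * q * p"
    unfolding p_eq q_eq by algebra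
  then have "(of_int ((6 * p * n)^2) :: rat) = of_int (p^3 + (- 5 * p) * p^2 + 4 * p * q * p)" by simp
  then show ?thesis unfolding phi.E.affine_in_curve by simp
qed

lemma R_on: "R \<in> phi.E'.curve"
proof -
  have "(4 * m * n)^2 = (- m)^3 + (10 * p) * (- m)^2 + 9 * m * p * (- m)"
    unfolding p_eq by algebra
  then have "(of_int ((4 * m * n)^2) :: rat) = of_int ((- m)^3 + (10 * p) * (- m)^2 + 9 * m * p * (- m))" by simp
  then show ?thesis unfolding phi.E'.affine_in_curve by simp
qed

lemma descent_P1: "phi.E.descent P1 = of_int p"
  by (rule phi.E.descent_affine) (use positive in simp)

lemma descent_R: "phi.E'.descent R = of_int (- m)"
  by (rule phi.E'.descent_affine) (use positive in simp)

text \<open>As \<open>B * p = q * (2 * p)^2\<close>, the class of \<open>q\<close> is represented by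
  the sum of \<open>(0, 0)\<close> and \<open>P1\<close>.\<close>

lemma descent_T_P1: "nonzero_square (phi.E.descent (ec_add A B phi.E.T P1) * of_int q)"
proof -
  obtain r where "r \<noteq> 0"
    and r: "phi.E.descent (ec_add A B phi.E.T P1) * (B * of_int p) = r^2"
    using phi.E.descent_add[OF phi.E.T_on P1_on] unfolding descent_P1 phi.E.descent_T by metis
  have "x * of_int q * (of_int (2 * p))^2 = x * (B * of_int p)" for x
    by (simp add: power2_eq_square)
  then have "nonzero_square (phi.E.descent (ec_add A B phi.E.T P1) * of_int q * (of_int (2 * p))^2)"
    using \<open>r \<noteq> 0\<close> nonzero_square_power2 r by metis
  then show ?thesis
    by (rule nonzero_square_cancel) (use positive in \<open>intro nonzero_square_power2, simp\<close>)
qed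

lemma descent_T_R: "nonzero_square (phi.E'.descent (ec_add A' B' phi.E'.T R) * of_int (- p))"
proof -
  obtain r where "r \<noteq> 0"
    and r: "phi.E'.descent (ec_add A' B' phi.E'.T R) * (B' * of_int (- m)) = r^2"
    using phi.E'.descent_add[OF phi.E'.T_on R_on] unfolding descent_R phi.E'.descent_T by metis
  have "x * of_int (- p) * (of_int (3 * m))^2 = x * (B' * of_int (- m))" for x
    by (simp add: power2_eq_square)
  then have "nonzero_square (phi.E'.descent (ec_add A' B' phi.E'.T R) * of_int (- p) * (of_int (3 * m))^2)"
    using \<open>r \<noteq> 0\<close> nonzero_square_power2 r by metis
  then show ?thesis
    by (rule nonzero_square_cancel) (use positive in \<open>intro nonzero_square_power2, simp\<close>)
qed

lemma classes_E:
  assumes P: "P \<in> phi.E.curve"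
  shows "\<exists>K\<in>{Infinity, phi.E.T, P1, ec_add A B phi.E.T P1}.
    nonzero_square (phi.E.descent P * phi.E.descent K)"
proof -
  have self: "nonzero_square (phi.E.descent P * phi.E.descent P)"
    using nonzero_square_power2[OF phi.E.descent_nonzero, of P] by (simp add: power2_eq_square)
  show ?thesis
  proof (cases "P = Infinity \<or> P = phi.E.T")
    case True
    then show ?thesis using self by blast
  next
    case False
    then obtain x y where xy: "P = Affine x y" "x \<noteq> 0" "y^2 = x^3 + A * x^2 + B * x"
      using phi.E.affine_nonzero[OF P] by metis
    moreover have "p mod 8 = 3" "q mod 8 = 3" using p_mod q_mod by presburger+
    ultimately obtain r where r: "r \<noteq> 0"
      "x = r^2 \<or> x = of_int p * r^2 \<or> x = of_int q * r^2 \<or> x = of_int (p * q) * r^2"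
      using descent_class_E[OF p_prime _ q_prime _ xy(2)] by blast
    have dP: "phi.E.descent P = x" unfolding xy(1) using xy(2) by (rule phi.E.descent_affine)
    have pq0: "of_int p \<noteq> (0::rat)" "of_int q \<noteq> (0::rat)" using positive by simp_all
    from r(2) show ?thesis
    proof (elim disjE)
      assume "x = r^2"
      then have "nonzero_square (phi.E.descent P * phi.E.descent Infinity)"
        unfolding dP phi.E.descent.simps(1) using nonzero_square_power2[OF r(1)] by simp
      then show ?thesis by blast
    next
      assume "x = of_int p * r^2"
      then have "phi.E.descent P * phi.E.descent P1 = (of_int p * r)^2"
        unfolding dP descent_P1 using pq0 by (simp add: power2_eq_square)
      then have "nonzero_square (phi.E.descent P * phi.E.descent P1)"
        using nonzero_square_power2[of "of_int p * r"] pq0 r(1) by (simp only: mult_eq_0_iff) auto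
      then show ?thesis by blast
    next
      assume "x = of_int q * r^2"
      then have "nonzero_square (phi.E.descent P * phi.E.descent (ec_add A B phi.E.T P1))"
        unfolding dP using nonzero_square_mult[OF descent_T_P1 nonzero_square_power2[OF r(1)]]
        by (simp add: mult_ac)
      then show ?thesis by blast
    next
      assume "x = of_int (p * q) * r^2"
      then have "phi.E.descent P * phi.E.descent phi.E.T = (of_int (2 * p * q) * r)^2"
        unfolding dP phi.E.descent_T by (simp add: power2_eq_square)
      then have "nonzero_square (phi.E.descent P * phi.E.descent phi.E.T)"
        using nonzero_square_power2[of "of_int (2 * p * q) * r"] pq0 r(1) by (simp only: mult_eq_0_iff) auto
      then show ?thesis by blast
    qed
  qed
qed

lemma classes_E':
  assumes Q: "Q \<in> phi.E'.curve"
  shows "\<exists>K\<in>{Infinity, phi.E'.T, R, ec_add A' B' phi.E'.T R}.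
    nonzero_square (phi.E'.descent Q * phi.E'.descent K)"
proof -
  have self: "nonzero_square (phi.E'.descent Q * phi.E'.descent Q)"
    using nonzero_square_power2[OF phi.E'.descent_nonzero, of Q] by (simp add: power2_eq_square)
  show ?thesis
  proof (cases "Q = Infinity \<or> Q = phi.E'.T")
    case True
    then show ?thesis using self by blast
  next
    case False
    then obtain x y where xy: "Q = Affine x y" "x \<noteq> 0" "y^2 = x^3 + A' * x^2 + B' * x"
      using phi.E'.affine_nonzero[OF Q] by metis
    moreover have "m mod 12 = 11" "p mod 12 = 11" using m_mod p_mod by presburger+
    ultimately obtain r where r: "r \<noteq> 0"
      "x = r^2 \<or> x = of_int (m * p) * r^2 \<or> x = of_int (- m) * r^2 \<or> x = of_int (- p) * r^2"
      using descent_class_E'[OF m_prime _ p_prime _ relation xy(2)] by blast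
    have dQ: "phi.E'.descent Q = x" unfolding xy(1) using xy(2) by (rule phi.E'.descent_affine)
    have mp0: "of_int m \<noteq> (0::rat)" "of_int p \<noteq> (0::rat)" using positive by simp_all
    from r(2) show ?thesis
    proof (elim disjE)
      assume "x = r^2"
      then have "nonzero_square (phi.E'.descent Q * phi.E'.descent Infinity)"
        unfolding dQ phi.E'.descent.simps(1) using nonzero_square_power2[OF r(1)] by simp
      then show ?thesis by blast
    next
      assume "x = of_int (- m) * r^2"
      then have "phi.E'.descent Q * phi.E'.descent R = (of_int m * r)^2"
        unfolding dQ descent_R using mp0 by (simp add: power2_eq_square)
      then have "nonzero_square (phi.E'.descent Q * phi.E'.descent R)"
        using nonzero_square_power2[of "of_int m * r"] mp0 r(1) by simp
      then show ?thesis by blast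
    next
      assume "x = of_int (- p) * r^2"
      then have "nonzero_square (phi.E'.descent Q * phi.E'.descent (ec_add A' B' phi.E'.T R))"
        unfolding dQ using nonzero_square_mult[OF descent_T_R nonzero_square_power2[OF r(1)]]
        by (simp add: mult_ac)
      then show ?thesis by blast
    next
      assume "x = of_int (m * p) * r^2"
      then have "phi.E'.descent Q * phi.E'.descent phi.E'.T = (of_int (3 * m * p) * r)^2"
        unfolding dQ phi.E'.descent_T by (simp add: power2_eq_square)
      then have "nonzero_square (phi.E'.descent Q * phi.E'.descent phi.E'.T)"
        using nonzero_square_power2[of "of_int (3 * m * p) * r"] mp0 r(1) by simp
      then show ?thesis by blast
    qed
  qed
qed

sublocale two_descent A B A' B' "of_int 1" "of_int 2" P1 R phi.R.ht phi.R'.ht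
proof
  show "P1 \<in> phi.E.curve" by (rule P1_on)
  show "R \<in> phi.E'.curve" by (rule R_on)
  show "\<exists>K\<in>{Infinity, phi.E.T, P1, ec_add A B phi.E.T P1}.
      nonzero_square (phi.E.descent P * phi.E.descent K)" if "P \<in> phi.E.curve" for P
    using that by (rule classes_E)
  show "\<exists>K\<in>{Infinity, phi.E'.T, R, ec_add A' B' phi.E'.T R}.
      nonzero_square (phi.E'.descent Q * phi.E'.descent K)" if "Q \<in> phi.E'.curve" for Q
    using that by (rule classes_E')
  show "\<not> nonzero_square (phi.E.descent P1)"
    unfolding descent_P1 nonzero_square_def using prime_nonsquare[OF p_prime] by metis
  show "\<not> nonzero_square (phi.E.descent P1 * B)"
  proof
    assume "nonzero_square (phi.E.descent P1 * B)"
    then have "nonzero_square (of_int q * (of_int (2 * p))^2)"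
      unfolding descent_P1 by (simp add: power2_eq_square mult_ac)
    then have "nonzero_square (of_int q)"
      by (rule nonzero_square_cancel) (use positive in \<open>intro nonzero_square_power2, simp\<close>)
    then show False unfolding nonzero_square_def using prime_nonsquare[OF q_prime] by metis
  qed
  have neg: "\<not> nonzero_square x" if "x < 0" for x
    using that zero_le_power2 unfolding nonzero_square_def by (metis not_less)
  show "\<not> nonzero_square (phi.E'.descent R)" unfolding descent_R using positive by (intro neg) simp
  show "\<not> nonzero_square (phi.E'.descent R * B')"
    unfolding descent_R using positive by (intro neg) (simp add: mult_neg_pos)
  show "finite {P \<in> phi.E.curve. phi.R.ht P \<le> c}" for c by (rule phi.R.finite_ht_le)
  show "\<exists>C. \<forall>P\<in>phi.E.curve. phi.R.ht (ec_add A B P Q) \<le> C * (phi.R.ht P)^2" if "Q \<in> phi.E.curve" for Q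
    using phi.R.ht_add[OF that] by metis
  show "\<exists>C. \<forall>P\<in>phi.E.curve. (phi.R.ht P)^4 \<le> C * (phi.R'.ht (phi.isog P))^2"
    using phi.ht_isog by metis
  show "\<exists>C. \<forall>Q\<in>phi.E'.curve. (phi.R'.ht Q)^4 \<le> C * (phi.R.ht (psi.isog Q))^2"
    using psi.ht_isog by metis
qed

text \<open>The right side is \<open>(N^2 + 5 * p * M^2)^2 - 16 * p * q * M^4\<close>. For odd
  \<open>M\<close> and \<open>N\<close> the inner sum is \<open>1 + 15\<close> modulo 8, so it is
  divisible by 8; dividing by 16 leaves a square congruent to \<open>- p * q * M^4\<close>, which is
  3 modulo 4.\<close>

lemma quartic_not_both_odd:
  assumes "odd M" "odd N"
  shows "W^2 \<noteq> N^4 - 2 * (- 5 * p) * M^2 * N^2 + ((- 5 * p)^2 - 4 * (4 * p * q)) * M^4"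
proof
  assume W: "W^2 = N^4 - 2 * (- 5 * p) * M^2 * N^2 + ((- 5 * p)^2 - 4 * (4 * p * q)) * M^4"
  have W': "W^2 = (N^2 + 5 * p * M^2)^2 - 16 * (p * q * M^4)" unfolding W by algebra
  have "[5 * p = 5 * 3] (mod 8)"
  proof (intro cong_mult cong_refl)
    have "p mod 8 = 3" using p_mod by presburger
    then show "[p = 3] (mod 8)" by (simp add: cong_def)
  qed
  then have "[N^2 + 5 * p * M^2 = 1 + 5 * 3 * 1] (mod 8)"
    using odd_square_cong(1) assms by (blast intro: cong_add cong_mult)
  then have "8 dvd N^2 + 5 * p * M^2" by (simp add: cong_def dvd_eq_mod_eq_0)
  then obtain k where k: "N^2 + 5 * p * M^2 = 8 * k" by (rule dvdE)
  have W16: "W^2 = 16 * (4 * k^2 - p * q * M^4)" unfolding W' k by (simp add: power_mult_distrib)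
  then have "even (W^2)" by simp
  then obtain V where V: "W = 2 * V" by auto
  then have "V^2 = 4 * (4 * k^2 - p * q * M^4)" using W16 by (simp add: power_mult_distrib)
  then have "even (V^2)" by simp
  then obtain U where "V = 2 * U" by auto
  then have U: "U^2 = 4 * k^2 - p * q * M^4"
    using \<open>V^2 = 4 * (4 * k^2 - p * q * M^4)\<close> by (simp add: power_mult_distrib)
  have "[p * q * (M^2)^2 = 3 * 3 * 1^2] (mod 4)"
  proof (intro cong_mult cong_pow)
    have "p mod 4 = 3" "q mod 4 = 3" using p_mod q_mod by presburger+
    then show "[p = 3] (mod 4)" "[q = 3] (mod 4)" by (simp_all add: cong_def)
    show "[M^2 = 1] (mod 4)" by (rule odd_square_cong(2)[OF assms(1)])
  qed
  then have "(p * q * M^4) mod 4 = 1" by (simp add: cong_def)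
  moreover have "x mod 4 = 1 \<Longrightarrow> (4 * y - x) mod 4 = 3" for x y :: int by presburger
  ultimately have "U^2 mod 4 = 3" unfolding U by blast
  then show False using square_mod_4[of U] by simp
qed

theorem iso: "G \<cong> integer_mod_group 2 \<times>\<times> (integer_group \<times>\<times> integer_group)"
proof (rule iso_if_torsion)
  fix P and k :: int
  assume P: "P \<in> phi.E.curve" "P \<noteq> Infinity" "P \<noteq> phi.E.T" and k: "k \<noteq> 0"
  have odd: "odd ((- 5 * p)^2 - 4 * (4 * p * q))"
  proof -
    have "odd m" "odd p" using m_mod p_mod by presburger+
    then show ?thesis unfolding disc_E by simp
  qed
  have "fst (phi.E.to_quartic P) \<noteq> 0" using phi.E.affine_nonzero[OF P] by metis
  moreover have "P \<in> carrier G" using P(1) carrier_G by simp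
  moreover have "fst (phi.E.to_quartic (Q \<otimes>\<^bsub>G\<^esub> Q)) \<noteq> 0 \<and> phi.R.val2 (Q \<otimes>\<^bsub>G\<^esub> Q) = phi.R.val2 Q + 1"
    if "Q \<in> carrier G" "fst (phi.E.to_quartic Q) \<noteq> 0" for Q
    using phi.R.val2_double[OF _ that(2) odd quartic_not_both_odd] that(1) unfolding carrier_G mult_G by blast
  ultimately show "P [^]\<^bsub>G\<^esub> k \<noteq> \<one>\<^bsub>G\<^esub>"
    using G.not_torsion_by_doubling[where N = "\<lambda>Q. fst (phi.E.to_quartic Q) \<noteq> 0" and f = phi.R.val2] k
    by blast
qed

end

theorem theorem1p2:
  fixes m n :: nat
  assumes "n > 0"
    and "prime m" and "prime (m + 16 * n^2)" and "prime (m + 25 * n^2)"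
    and "[m = 11] (mod 24)" and "[m + 16 * n^2 = 11] (mod 24)" and "[m + 25 * n^2 = 11] (mod 24)"
  shows "ec_group (- 5 * of_nat (m + 16 * n^2))
           (4 * of_nat (m + 16 * n^2) * of_nat (m + 25 * n^2)) (0 :: rat)
         \<cong> integer_mod_group 2 \<times>\<times> (integer_group \<times>\<times> integer_group)"
proof -
  have mod: "int k mod 24 = 11" if "[k = 11] (mod 24)" for k
  proof -
    have "int (k mod 24) = int 11" using that by (simp add: cong_def)
    then show ?thesis by (simp add: zmod_int)
  qed
  interpret prime_triple "int m" "int (m + 16 * n^2)" "int (m + 25 * n^2)" "int n"
    by unfold_locales (use assms mod in \<open>simp_all only: prime_nat_int_transfer, simp_all\<close>)
  have "of_int (- 5 * int (m + 16 * n^2)) = (- 5 * of_nat (m + 16 * n^2) :: rat)"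
    "of_int (4 * int (m + 16 * n^2) * int (m + 25 * n^2))
       = (4 * of_nat (m + 16 * n^2) * of_nat (m + 25 * n^2) :: rat)"
    by simp_all
  then show ?thesis using iso by (simp only:)
qed

end
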